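(* For every integer $d\geq 3$, let $\nu(d)$ denote the smallest number of vertices of a rigid $d$-regular graph. Then $$\nu(d)=\begin{cases}14 & \text{if } d=3,\\ 10 & \text{if } d=4,5,\\ 11 & \text{if } d=6,\\ 2\lceil d/2\rceil+4 & \text{if } d>6.\end{cases}$$
   Context: All graphs are finite, simple and undirected. A homomorphism between graphs is a map of vertex sets sending edges to edges; an endomorphism of $G$ is a homomorphism $G\to G$. A graph is rigid if its only endomorphism is the identity. *)

theory Defs
  imports Complex_Main "Graph_Theory.Pair_Digraph"
begin

text \<open>
  A finite simple undirected graph is a \<^locale>\<open>pair_graph\<close>: a finite vertex set \<^const>\<open>pverts\<close>
  with a symmetric irreflexive set \<^const>\<open>parcs\<close> of ordered pairs.  Each edge is present in both
  directions, so the degree of a vertex is its \<^const>\<open>out_degree\<close>.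
\<close>

definition graph_hom ::
    "'a pair_pre_digraph \<Rightarrow> 'b pair_pre_digraph \<Rightarrow> ('a \<Rightarrow> 'b) \<Rightarrow> bool" where
  "graph_hom G H f \<longleftrightarrow>
     (\<forall>v \<in> pverts G. f v \<in> pverts H) \<and> (\<forall>(u, v) \<in> parcs G. (f u, f v) \<in> parcs H)"

abbreviation graph_endo :: "'a pair_pre_digraph \<Rightarrow> ('a \<Rightarrow> 'a) \<Rightarrow> bool" where
  "graph_endo G \<equiv> graph_hom G G"

text \<open>Values of an endomorphism outside the vertex set carry no information.\<close>

definition rigid :: "'a pair_pre_digraph \<Rightarrow> bool" where
  "rigid G \<longleftrightarrow> (\<forall>f. graph_endo G f \<longrightarrow> (\<forall>v \<in> pverts G. f v = v))"

definition regular :: "nat \<Rightarrow> 'a pair_pre_digraph \<Rightarrow> bool" where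
  "regular d G \<longleftrightarrow> (\<forall>v \<in> pverts G. out_degree (with_proj G) v = d)"

text \<open>
  Graphs are nonempty: the null graph would vacuously be rigid and \<open>d\<close>-regular for every \<open>d\<close>.
  Vertices are natural numbers without loss of generality, see \<open>card_in_rigid_regular_orders\<close>.
\<close>

definition rigid_regular_orders :: "nat \<Rightarrow> nat set" where
  "rigid_regular_orders d =
     {card (pverts G) | G :: nat pair_pre_digraph.
        pair_graph G \<and> pverts G \<noteq> {} \<and> regular d G \<and> rigid G}"

definition nu :: "nat \<Rightarrow> nat" where
  "nu d = (LEAST n. n \<in> rigid_regular_orders d)"

lemma card_in_rigid_regular_orders:
  fixes G :: "'a pair_pre_digraph"
  assumes G: "pair_graph G" and ne: "pverts G \<noteq> {}" and reg: "regular d G" and rig: "rigid G"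
  shows "card (pverts G) \<in> rigid_regular_orders d"
proof -
  interpret G: pair_graph G by (rule G)
  obtain h :: "'a \<Rightarrow> nat" where h: "inj_on h (pverts G)"
    using finite_imp_inj_to_nat_seg[OF G.pair_finite_verts] by blast
  define H where "H = \<lparr> pverts = h ` pverts G, parcs = map_prod h h ` parcs G \<rparr>"
  have sub: "parcs G \<subseteq> pverts G \<times> pverts G"
    using G.wellformed' by auto
  have arc_iff: "(h u, h v) \<in> parcs H \<longleftrightarrow> (u, v) \<in> parcs G"
    if "u \<in> pverts G" "v \<in> pverts G" for u v
  proof
    assume "(h u, h v) \<in> parcs H"
    then obtain a b where ab: "(a, b) \<in> parcs G" "h a = h u" "h b = h v"
      by (auto simp: H_def)
    with sub have "a \<in> pverts G" "b \<in> pverts G" by auto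
    with ab that h show "(u, v) \<in> parcs G" by (simp add: inj_on_eq_iff)
  qed (force simp: H_def)
  have "pair_graph H"
  proof
    show "symmetric (with_proj H)"
      unfolding symmetric_def using G.arcs_symmetric by (auto simp: H_def sym_def)
    show "finite (pverts H)" "finite (parcs H)"
      using G.pair_finite_verts G.pair_finite_arcs by (auto simp: H_def)
    show "fst e \<in> pverts H" "snd e \<in> pverts H" if "e \<in> parcs H" for e
      using that sub by (auto simp: H_def)
    show "fst e \<noteq> snd e" if "e \<in> parcs H" for e
      using that sub h G.pair_no_loops by (fastforce simp: H_def inj_on_eq_iff)
  qed
  moreover have "regular d H"
  proof -
    have "out_degree (with_proj H) (h v) = out_degree (with_proj G) v" if v: "v \<in> pverts G" for v
    proof -
      have "out_arcs (with_proj H) (h v) = map_prod h h ` out_arcs (with_proj G) v"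
        using sub h v by (force simp: H_def out_arcs_def inj_on_eq_iff)
      moreover have "inj_on (map_prod h h) (out_arcs (with_proj G) v)"
        by (rule inj_on_subset[OF map_prod_inj_on[OF h h]]) (use sub in auto)
      ultimately show ?thesis by (simp add: out_degree_def card_image)
    qed
    then show ?thesis using reg by (simp add: regular_def H_def)
  qed
  moreover have "rigid H"
    unfolding rigid_def
  proof (intro allI impI ballI)
    fix f w assume f: "graph_endo H f" and w: "w \<in> pverts H"
    define g where "g = (\<lambda>v. inv_into (pverts G) h (f (h v)))"
    have fV: "f (h v) \<in> h ` pverts G" if "v \<in> pverts G" for v
      using f that by (auto simp: graph_hom_def H_def)
    have gV: "g v \<in> pverts G" and hg: "h (g v) = f (h v)" if "v \<in> pverts G" for v
      using fV[OF that] by (auto simp: g_def inv_into_into f_inv_into_f)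
    have "(g u, g v) \<in> parcs G" if "(u, v) \<in> parcs G" for u v
    proof -
      have uv: "u \<in> pverts G" "v \<in> pverts G" using that sub by auto
      then have "(f (h u), f (h v)) \<in> parcs H"
        using f that arc_iff by (fastforce simp: graph_hom_def)
      then show ?thesis using arc_iff[of "g u" "g v"] uv gV hg by simp
    qed
    then have "graph_endo G g" using gV by (auto simp: graph_hom_def)
    then have "g v = v" if "v \<in> pverts G" for v using rig that by (simp add: rigid_def)
    then show "f w = w" using w hg by (auto simp: H_def)
  qed
  moreover have "pverts H \<noteq> {}" "card (pverts H) = card (pverts G)"
    using ne h by (auto simp: H_def card_image)
  ultimately show ?thesis unfolding rigid_regular_orders_def by (metis (mono_tags, lifting) mem_Collect_eq)
qed

end

theory Submission
  imports Defs
begin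

text \<open>
  Passing to the complement turns a \<open>d\<close>-regular graph on \<open>n\<close> vertices into an \<open>(n - 1 - d)\<close>-regular graph
  with the same automorphisms. Regular graphs of degree at most 2 have nontrivial automorphisms, so a
  rigid \<open>d\<close>-regular graph has at least \<open>d + 4\<close> vertices; moreover \<open>n * d\<close> is even. The lower bounds that do
  not follow from this concern cubic graphs on at most 12 vertices, quartic graphs on at most 9 vertices,
  and automorphisms of cubic graphs on 10 vertices. For these, patterns (graphs that may occur as
  subgraphs) are refuted one after the other: either the pattern has a nontrivial endomorphism that
  moves only vertices whose neighbourhoods are complete in the pattern, so that it extends to the whole
  graph by the identity, or some vertex lacks a neighbour and each choice of that neighbour creates
  a pattern that has already been refuted. The last pattern refuted is a single vertex.

  For the upper bounds, the complement of a connected, triangle-free, non-bipartite, asymmetric regular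
  graph is rigid. Cubic and quartic graphs of this kind exist on every even number of vertices from 14 on:
  a circular ladder and a circulant graph, each with a few edges switched in one place. The remaining
  six graphs are checked by a search for endomorphisms.
\<close>

section \<open>Regular graphs and their complements\<close>

text \<open>For \<open>d > 6\<close>, and also for \<open>d = 5\<close>, the formula is
  \<open>d + 4\<close> rounded up until the parity condition holds, so an extremal graph is the
  complement of a cubic graph (\<open>d\<close> even) or of a quartic one (\<open>d\<close> odd).
  The value at 6 is one larger because no cubic graph on 10 vertices is asymmetric. For 3 and 4 this
  bound is too weak: small cubic graphs can be asymmetric and still have proper retracts, so there
  noninjective endomorphisms have to be produced as well. The difficulty of the upper bounds is to
  exclude noninjective endomorphisms of dense graphs. Fibres of such a map are cliques of the sparse
  complement; if that has no triangles, they have at most two vertices, and the map is controlled by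
  a matching. Bipartite graphs really are an obstruction: in a regular bipartite graph of positive
  degree a perfect matching folds the complement onto one colour class. The families begin at 14
  vertices, which leaves the degrees 7 and 8, with graphs on 12 vertices, to explicit
  examples.\<close>

definition endo_on :: "'a set \<Rightarrow> ('a \<Rightarrow> 'a \<Rightarrow> bool) \<Rightarrow> ('a \<Rightarrow> 'a) \<Rightarrow> bool" where
  "endo_on V E f \<longleftrightarrow> f ` V \<subseteq> V \<and> (\<forall>u v. E u v \<longrightarrow> E (f u) (f v))"

definition rigid_on :: "'a set \<Rightarrow> ('a \<Rightarrow> 'a \<Rightarrow> bool) \<Rightarrow> bool" where
  "rigid_on V E \<longleftrightarrow> (\<forall>f. endo_on V E f \<longrightarrow> (\<forall>v\<in>V. f v = v))"

text \<open>On a finite graph the injective endomorphisms are exactly the automorphisms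
  (\<open>inj_endo_reflects\<close>), so this is asymmetry in the usual sense.\<close>

definition asymmetric_on :: "'a set \<Rightarrow> ('a \<Rightarrow> 'a \<Rightarrow> bool) \<Rightarrow> bool" where
  "asymmetric_on V E \<longleftrightarrow> (\<forall>f. endo_on V E f \<and> inj_on f V \<longrightarrow> (\<forall>v\<in>V. f v = v))"

definition regular_on :: "'a set \<Rightarrow> ('a \<Rightarrow> 'a \<Rightarrow> bool) \<Rightarrow> nat \<Rightarrow> bool" where
  "regular_on V E d \<longleftrightarrow> (\<forall>v\<in>V. card {w. E v w} = d)"

definition compl_on :: "'a set \<Rightarrow> ('a \<Rightarrow> 'a \<Rightarrow> bool) \<Rightarrow> 'a \<Rightarrow> 'a \<Rightarrow> bool" where
  "compl_on V E u v \<longleftrightarrow> u \<in> V \<and> v \<in> V \<and> u \<noteq> v \<and> \<not> E u v"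

locale ugraph =
  fixes V :: "'a set" and E :: "'a \<Rightarrow> 'a \<Rightarrow> bool"
  assumes finV [simp]: "finite V"
    and E_in: "E u v \<Longrightarrow> u \<in> V \<and> v \<in> V"
    and E_sym: "E u v \<Longrightarrow> E v u"
    and E_irrefl: "\<not> E v v"
begin

lemma E_commute: "E u v \<longleftrightarrow> E v u"
  using E_sym by blast

lemma nbrs_subset: "{w. E v w} \<subseteq> V"
  using E_in by blast

lemma finite_nbrs [simp]: "finite {w. E v w}"
  using finite_subset[OF nbrs_subset] by simp

lemma finite_edges: "finite {(u, v). E u v}"
  by (rule finite_subset[of _ "V \<times> V"]) (use E_in in auto)

lemma ugraph_compl: "ugraph V (compl_on V E)"
  by unfold_locales (auto simp: compl_on_def E_commute)

lemma compl_compl: "compl_on V (compl_on V E) = E"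
  using E_in E_irrefl by (fastforce simp: compl_on_def fun_eq_iff)

lemma regular_compl:
  assumes "regular_on V E d"
  shows "regular_on V (compl_on V E) (card V - 1 - d)"
  unfolding regular_on_def
proof
  fix v assume v: "v \<in> V"
  have "{w. compl_on V E v w} = V - insert v {w. E v w}"
    using v by (auto simp: compl_on_def)
  moreover have "card (insert v {w. E v w}) = Suc d"
    using assms v E_irrefl by (simp add: regular_on_def)
  moreover have "insert v {w. E v w} \<subseteq> V"
    using v nbrs_subset by auto
  ultimately show "card {w. compl_on V E v w} = card V - 1 - d"
    by (simp add: card_Diff_subset)
qed

lemma degree_less_card:
  assumes "regular_on V E d" "v \<in> V"
  shows "d < card V"
proof -
  have "{w. E v w} \<subset> V" using nbrs_subset[of v] assms(2) E_irrefl by blast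
  then have "card {w. E v w} < card V" by (intro psubset_card_mono) simp
  with assms show ?thesis by (simp add: regular_on_def)
qed

text \<open>An injective map of the finite edge set into itself is onto, so an edge between images
  already comes from an edge.\<close>

lemma inj_endo_reflects:
  assumes f: "endo_on V E f" and inj: "inj_on f V" and uv: "u \<in> V" "v \<in> V" "E (f u) (f v)"
  shows "E u v"
proof -
  let ?A = "{(u, v). E u v}"
  have "map_prod f f ` ?A \<subseteq> ?A" using f by (auto simp: endo_on_def)
  moreover have "inj_on (map_prod f f) ?A"
    by (rule inj_on_subset[OF map_prod_inj_on[OF inj inj]]) (use E_in in auto)
  ultimately have "map_prod f f ` ?A = ?A" using finite_edges by (intro endo_inj_surj) auto
  with uv(3) obtain a b where "E a b" "f a = f u" "f b = f v" by force
  with uv inj E_in[of a b] show ?thesis by (metis inj_onD)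
qed

lemma inj_endo_compl:
  assumes "endo_on V E f" "inj_on f V"
  shows "endo_on V (compl_on V E) f"
proof -
  have V: "f v \<in> V" if "v \<in> V" for v using assms(1) that by (auto simp: endo_on_def)
  have "compl_on V E (f u) (f v)" if "compl_on V E u v" for u v
    using that V inj_endo_reflects[OF assms, of u v] inj_on_eq_iff[OF assms(2), of u v]
    by (auto simp: compl_on_def)
  then show ?thesis using V by (auto simp: endo_on_def)
qed

lemma asymmetric_compl: "asymmetric_on V (compl_on V E) \<longleftrightarrow> asymmetric_on V E"
  using inj_endo_compl ugraph.inj_endo_compl[OF ugraph_compl]
  unfolding asymmetric_on_def compl_compl by blast

lemma rigid_imp_asymmetric: "rigid_on V E \<Longrightarrow> asymmetric_on V E"
  by (simp add: rigid_on_def asymmetric_on_def)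

end

section \<open>Translation between edge relations and pair digraphs\<close>

lemma card_in_ordersI:
  fixes V :: "nat set"
  assumes "ugraph V E" "V \<noteq> {}" "regular_on V E d" "rigid_on V E"
  shows "card V \<in> rigid_regular_orders d"
proof -
  interpret ugraph V E by fact
  define G where "G = \<lparr> pverts = V, parcs = {(u, v). E u v} \<rparr>"
  have "pair_graph G"
  proof
    show "symmetric (with_proj G)"
      unfolding symmetric_def using E_sym by (auto simp: G_def sym_def)
    show "finite (pverts G)" "finite (parcs G)" using finite_edges by (auto simp: G_def)
    show "fst e \<in> pverts G" "snd e \<in> pverts G" "fst e \<noteq> snd e" if "e \<in> parcs G" for e
      using that E_in E_irrefl by (auto simp: G_def)
  qed
  moreover have "regular d G"
  proof -
    have "out_arcs (with_proj G) v = Pair v ` {w. E v w}" for v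
      by (auto simp: G_def out_arcs_def)
    then show ?thesis using assms(3)
      by (auto simp: regular_def regular_on_def out_degree_def G_def card_image inj_on_def)
  qed
  moreover have "rigid G"
    unfolding rigid_def
  proof (intro allI impI)
    fix f assume "graph_endo G f"
    then have "endo_on V E f" by (auto simp: endo_on_def graph_hom_def G_def)
    then show "\<forall>v\<in>pverts G. f v = v" using assms(4) by (simp add: rigid_on_def G_def)
  qed
  moreover have "pverts G = V" by (simp add: G_def)
  ultimately show ?thesis using assms(2) by (auto simp: rigid_regular_orders_def)
qed

lemma ordersE:
  assumes "n \<in> rigid_regular_orders d"
  obtains V :: "nat set" and E where
    "ugraph V E" "V \<noteq> {}" "card V = n" "regular_on V E d" "rigid_on V E"
proof -
  from assms obtain G :: "nat pair_pre_digraph" where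
    G: "pair_graph G" "pverts G \<noteq> {}" "regular d G" "rigid G" and n: "n = card (pverts G)"
    by (auto simp: rigid_regular_orders_def)
  interpret G: pair_graph G by (rule G(1))
  define E where "E u v \<longleftrightarrow> (u, v) \<in> parcs G" for u v
  have "ugraph (pverts G) E"
  proof
    show "finite (pverts G)" by (rule G.pair_finite_verts)
    show "u \<in> pverts G \<and> v \<in> pverts G" if "E u v" for u v
      using that G.wellformed' by (simp add: E_def)
    show "E v u" if "E u v" for u v
      using that G.arcs_symmetric by (simp add: E_def)
    show "\<not> E v v" for v
      using G.pair_no_loops[of "(v, v)"] by (auto simp: E_def)
  qed
  moreover have "regular_on (pverts G) E d"
  proof -
    have "out_arcs (with_proj G) v = Pair v ` {w. E v w}" for v
      by (auto simp: E_def out_arcs_def)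
    then show ?thesis using G(3)
      by (auto simp: regular_def regular_on_def out_degree_def card_image inj_on_def)
  qed
  moreover have "rigid_on (pverts G) E"
    unfolding rigid_on_def
  proof (intro allI impI)
    fix f assume "endo_on (pverts G) E f"
    then have "graph_endo G f" by (auto simp: endo_on_def graph_hom_def E_def)
    then show "\<forall>v\<in>pverts G. f v = v" using G(4) by (simp add: rigid_def)
  qed
  ultimately show thesis using that[of "pverts G" E] G(2) n by simp
qed

text \<open>The handshake lemma; the linear order selects one of the two orientations of each
  edge.\<close>

lemma even_card_mult_degree:
  fixes V :: "'a :: linorder set"
  assumes "ugraph V E" "regular_on V E d"
  shows "even (card V * d)"
proof -
  interpret ugraph V E by fact
  let ?A = "{(u, v). E u v}" and ?L = "{(u, v). E u v \<and> u < v}"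
  have "?A = Sigma V (\<lambda>u. {v. E u v})" using E_in by auto
  then have "card ?A = card V * d" using assms(2) by (simp add: regular_on_def)
  moreover have "?A = ?L \<union> prod.swap ` ?L"
  proof (intro equalityI subsetI)
    fix e assume e: "e \<in> ?A"
    obtain u v where uv: "e = (u, v)" by (cases e)
    with e have "E u v" by simp
    then have "u \<noteq> v" "E v u" using E_irrefl E_sym by auto
    then consider "u < v" | "v < u" by (meson neq_iff)
    then show "e \<in> ?L \<union> prod.swap ` ?L"
      by cases (use uv \<open>E u v\<close> \<open>E v u\<close> in \<open>auto intro!: image_eqI[of _ _ "(v, u)"]\<close>)
  qed (use E_sym in auto)
  moreover have "card (?L \<union> prod.swap ` ?L) = card ?L + card (prod.swap ` ?L)"
    by (rule card_Un_disjoint) (auto intro: finite_subset[OF _ finite_edges])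
  moreover have "card (prod.swap ` ?L) = card ?L" by (simp add: card_image)
  ultimately have "card V * d = 2 * card ?L" by simp
  then show ?thesis by simp
qed

text \<open>A 2-regular graph is a union of cycles; rotating one cycle by one step and fixing all
  other vertices is an automorphism. The cycle is obtained as an orbit of directed edges, which
  avoids numbering the vertices along it.\<close>

lemma (in ugraph) two_regular_not_asymmetric:
  assumes reg: "regular_on V E 2" and ne: "V \<noteq> {}"
  shows "\<not> asymmetric_on V E"
proof -
  \<comment> \<open>From the directed edge \<open>(u, v)\<close> the walk leaves \<open>v\<close> by
    its neighbour other than \<open>u\<close>, which is unique since the degree is 2.\<close>
  define nxt where "nxt = (\<lambda>(u, v). (v, THE c. E v c \<and> c \<noteq> u))"
  let ?D = "{(u, v). E u v}"
  have nxtE: "\<exists>c. nxt (u, v) = (v, c) \<and> E v c \<and> c \<noteq> u \<and> {w. E v w} = {u, c}" if uv: "E u v" for u v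
  proof -
    have "v \<in> V" "E v u" using uv E_in E_sym by auto
    then have "card {w. E v w} = 2" using reg by (simp add: regular_on_def)
    then obtain x y where xy: "{w. E v w} = {x, y}" "x \<noteq> y" by (auto simp: card_2_iff)
    define c where "c = (if u = x then y else x)"
    have "u = x \<or> u = y" using xy(1) \<open>E v u\<close> by blast
    then have c: "{w. E v w} = {u, c}" "c \<noteq> u" using xy by (auto simp: c_def)
    then have c': "E v w \<longleftrightarrow> w = u \<or> w = c" for w by blast
    then have "(THE c. E v c \<and> c \<noteq> u) = c" using c(2) by (intro the_equality) auto
    then have "nxt (u, v) = (v, c)" by (simp add: nxt_def)
    with c c' show ?thesis by blast
  qed
  have nxtD: "nxt e \<in> ?D" if "e \<in> ?D" for e
    using that nxtE by (cases e) fastforce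
  have inj: "inj_on nxt ?D"
  proof (intro inj_onI, clarify)
    fix u v u' v' assume e: "E u v" "E u' v'" and eq: "nxt (u, v) = nxt (u', v')"
    from nxtE[OF e(1)] nxtE[OF e(2)] eq show "u = u' \<and> v = v'"
      by (auto simp: doubleton_eq_iff)
  qed
  \<comment> \<open>Walking backwards undoes a step, because \<open>u\<close> is the neighbour of
    \<open>v\<close> other than \<open>c\<close>.\<close>
  have reversal: "nxt (c, v) = (v, u)" if "nxt (u, v) = (v, c)" "E u v" for u v c
  proof -
    from nxtE[OF that(2)] that(1) have "E v c" "{w. E v w} = {u, c}" "c \<noteq> u" by auto
    with nxtE[OF E_sym[OF \<open>E v c\<close>]] show ?thesis by (auto simp: doubleton_eq_iff)
  qed
  \<comment> \<open>A walk meeting its own reverse would turn back at its midpoint.\<close>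
  have norev: "(nxt ^^ m) e \<noteq> prod.swap e" if "e \<in> ?D" for m e
    using that
  proof (induction m arbitrary: e rule: less_induct)
    case (less m)
    obtain u v where e: "e = (u, v)" "E u v" using less.prems by (cases e) auto
    obtain c where c: "nxt (u, v) = (v, c)" "E v c" "c \<noteq> u" using nxtE[OF e(2)] by blast
    consider "m = 0" | "m = 1" | m' where "m = Suc (Suc m')" by (metis One_nat_def not0_implies_Suc)
    then show ?case
    proof cases
      case 1
      then show ?thesis using e E_irrefl by auto
    next
      case 2
      then show ?thesis using e c by auto
    next
      case 3
      show ?thesis
      proof
        assume "(nxt ^^ m) e = prod.swap e"
        then have "nxt ((nxt ^^ m') (v, c)) = nxt (c, v)"
          using e c reversal[OF c(1) e(2)] by (simp add: 3 funpow_swap1)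
        moreover have "(nxt ^^ m') (v, c) \<in> ?D"
          using c(2) nxtD by (induction m') auto
        ultimately have "(nxt ^^ m') (v, c) = (c, v)"
          using inj c(2) E_sym by (auto dest: inj_onD)
        with less.IH[of m' "(v, c)"] c(2) 3 show False by simp
      qed
    qed
  qed
  obtain a b where ab: "E a b"
  proof -
    from ne obtain a where "a \<in> V" by blast
    with reg have "card {w. E a w} = 2" by (simp add: regular_on_def)
    then have "{w. E a w} \<noteq> {}" by (metis card.empty zero_neq_numeral)
    with that show thesis by blast
  qed
  \<comment> \<open>The directed cycle through \<open>(a, b)\<close>. As \<open>nxt\<close> is
    injective, it permutes this finite orbit, so every member has a predecessor in it.\<close>
  define orb where "orb = range (\<lambda>i. (nxt ^^ i) (a, b))"
  have orbD: "orb \<subseteq> ?D"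
  proof -
    have "(nxt ^^ i) (a, b) \<in> ?D" for i using ab nxtD by (induction i) auto
    then show ?thesis unfolding orb_def by (rule image_subsetI)
  qed
  have "nxt ` orb \<subseteq> orb"
    unfolding orb_def by (auto intro: range_eqI[of _ _ "Suc _"])
  then have orb_img: "nxt ` orb = orb"
    using finite_subset[OF orbD finite_edges] inj_on_subset[OF inj orbD] by (intro endo_inj_surj)
  \<comment> \<open>Otherwise the walk would get from an edge to its reverse, against
    \<open>norev\<close>. Hence the orbit runs through its cycle in one direction only, and each
    vertex has at most one successor.\<close>
  have orb_rev: "(v, u) \<notin> orb" if uv: "(u, v) \<in> orb" for u v
  proof
    assume "(v, u) \<in> orb"
    then obtain i j where ij: "(nxt ^^ i) (a, b) = (u, v)" "(nxt ^^ j) (a, b) = (v, u)"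
      using uv by (auto simp: orb_def)
    have D: "(u, v) \<in> ?D" "(v, u) \<in> ?D" using uv \<open>(v, u) \<in> orb\<close> orbD by auto
    show False
    proof (cases "i \<le> j")
      case True
      then have "(nxt ^^ (j - i)) (u, v) = (v, u)"
        using ij funpow_add[of "j - i" i nxt] by simp
      with norev[OF D(1)] show False by simp
    next
      case False
      then have "(nxt ^^ (i - j)) (v, u) = (u, v)"
        using ij funpow_add[of "i - j" j nxt] by simp
      with norev[OF D(2)] show False by simp
    qed
  qed
  have pred: "\<exists>p. (p, u) \<in> orb \<and> {w. E u w} = {p, v} \<and> p \<noteq> v" if uv: "(u, v) \<in> orb" for u v
  proof -
    have "(u, v) \<in> nxt ` orb" using uv orb_img by simp
    then obtain x y where xy: "(x, y) \<in> orb" "nxt (x, y) = (u, v)" by auto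
    then have "E x y" using orbD by auto
    from nxtE[OF this] xy show ?thesis by auto
  qed
  have uniq: "v = v'" if uv: "(u, v) \<in> orb" "(u, v') \<in> orb" for u v v'
  proof (rule ccontr)
    assume "v \<noteq> v'"
    obtain p where p: "(p, u) \<in> orb" "{w. E u w} = {p, v}" using pred[OF uv(1)] by blast
    have "E u v'" using uv orbD by auto
    with p \<open>v \<noteq> v'\<close> have "v' = p" by auto
    with orb_rev[OF p(1)] uv show False by simp
  qed
  \<comment> \<open>The rotation: each vertex on the orbit goes to its successor.\<close>
  define f where "f v = (if \<exists>w. (v, w) \<in> orb then THE w. (v, w) \<in> orb else v)" for v
  have f1: "f v = w" if "(v, w) \<in> orb" for v w
    unfolding f_def using that uniq by (auto intro!: the_equality)
  have f2: "f v = v" if "\<not> (\<exists>w. (v, w) \<in> orb)" for v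
    using that by (simp add: f_def)
  have succ: "(v, f v) \<in> orb" if "(u, v) \<in> orb" for u v
  proof -
    have "nxt (u, v) \<in> orb" using that orb_img by blast
    moreover have "E u v" using that orbD by auto
    ultimately show ?thesis using nxtE[of u v] f1 by auto
  qed
  have edge: "E (f u) (f v)" if uv: "E u v" for u v
  proof (cases "\<exists>w. (u, w) \<in> orb")
    case True
    then obtain w where w: "(u, w) \<in> orb" by blast
    obtain p where p: "(p, u) \<in> orb" "{w. E u w} = {p, w}" using pred[OF w] by blast
    with uv consider "v = w" | "v = p" by auto
    then show ?thesis
    proof cases
      case 1
      with succ[OF w] f1[OF w] orbD show ?thesis by auto
    next
      case 2
      with f1[OF p(1)] f1[OF w] orbD w E_sym show ?thesis by auto
    qed
  next
    case False
    moreover have "\<not> (\<exists>w. (v, w) \<in> orb)"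
    proof
      assume "\<exists>w. (v, w) \<in> orb"
      then obtain w where w: "(v, w) \<in> orb" by blast
      obtain p where p: "(p, v) \<in> orb" "{w. E v w} = {p, w}" using pred[OF w] by blast
      with E_sym[OF uv] have "u = p \<or> u = w" by auto
      with p(1) succ[OF w] False show False by auto
    qed
    ultimately show ?thesis using uv f2 by simp
  qed
  have "inj_on f V"
  proof (rule inj_onI)
    fix u v assume eq: "f u = f v"
    have mixed: False if "(x, y) \<in> orb" "\<not> (\<exists>w. (z, w) \<in> orb)" "f x = f z" for x y z
      using that succ[OF that(1)] f1[OF that(1)] f2[OF that(2)] by auto
    consider w w' where "(u, w) \<in> orb" "(v, w') \<in> orb"
      | "\<not> (\<exists>w. (u, w) \<in> orb)" "\<not> (\<exists>w. (v, w) \<in> orb)"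
      using mixed[of u _ v] mixed[of v _ u] eq by metis
    then show "u = v"
    proof cases
      case 1
      then have w: "(u, w) \<in> orb" "(v, w) \<in> orb" using eq f1 by auto
      \<comment> \<open>Both \<open>u\<close> and \<open>v\<close> are neighbours of
        \<open>w\<close> other than its successor \<open>f w\<close>, so only the predecessor
        \<open>p\<close> is left for them.\<close>
      obtain p where p: "(p, w) \<in> orb" "{x. E w x} = {p, f w}"
        using pred[OF succ[OF w(1)]] by blast
      have "E w x" "f w \<noteq> x" if x: "(x, w) \<in> orb" for x
        using x orbD E_sym orb_rev[OF x] succ[OF x] by auto
      then have "E w u" "E w v" "f w \<noteq> u" "f w \<noteq> v" using w by auto
      moreover from this p(2) have "u \<in> {p, f w}" "v \<in> {p, f w}" by blast+
      ultimately show ?thesis by auto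
    qed (use eq f2 in simp)
  qed
  moreover have "f ` V \<subseteq> V"
  proof
    fix x assume "x \<in> f ` V"
    then obtain v where "v \<in> V" "x = f v" by blast
    then show "x \<in> V" using f1 f2 orbD E_in by (cases "\<exists>w. (v, w) \<in> orb") auto
  qed
  moreover have "f a \<noteq> a" "a \<in> V"
  proof -
    have "(a, b) \<in> orb" unfolding orb_def by (rule range_eqI[of _ _ 0]) simp
    from f1[OF this] ab E_irrefl E_in show "f a \<noteq> a" "a \<in> V" by auto
  qed
  ultimately show ?thesis
    using edge by (auto simp: asymmetric_on_def endo_on_def intro!: exI[of _ f])
qed

text \<open>In degree 0 any two vertices, in degree 1 the two ends of an edge, have no neighbours
  except possibly each other and can be transposed. The bound on \<open>card V\<close> provides the
  second vertex.\<close>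

lemma (in ugraph) asymmetric_imp_degree_gt_2:
  assumes reg: "regular_on V E k" and asym: "asymmetric_on V E" and card: "1 < card V"
  shows "2 < k"
proof (rule ccontr)
  assume "\<not> 2 < k"
  then consider "k = 0" | "k = 1" | "k = 2" by linarith
  then obtain a b where ab: "a \<in> V" "b \<in> V" "a \<noteq> b"
    and nb: "\<And>w. E a w \<Longrightarrow> w = b" "\<And>w. E b w \<Longrightarrow> w = a"
  proof cases
    case 1
    have "\<not> E u v" for u v using reg 1 E_in[of u v] by (auto simp: regular_on_def)
    moreover obtain a b where "a \<in> V" "b \<in> V" "a \<noteq> b" using card
      by (metis card_le_Suc0_iff_eq finV less_le_not_le One_nat_def)
    ultimately show ?thesis using that by blast
  next
    case 2
    obtain a where a: "a \<in> V" using card by force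
    then obtain b where b: "{w. E a w} = {b}" using reg 2 by (auto simp: regular_on_def card_1_singleton_iff)
    then have "E a b" by blast
    then have "E b a" "b \<in> V" using E_sym E_in by auto
    with reg 2 obtain c where c: "{w. E b w} = {c}" by (auto simp: regular_on_def card_1_singleton_iff)
    have "a \<in> {w. E b w}" using \<open>E b a\<close> by simp
    with c have "c = a" by simp
    show ?thesis
    proof (rule that)
      show "w = b" if "E a w" for w using that b by (metis mem_Collect_eq singletonD)
      show "w = a" if "E b w" for w using that c \<open>c = a\<close> by (metis mem_Collect_eq singletonD)
    qed (use a \<open>b \<in> V\<close> \<open>E a b\<close> E_irrefl in auto)
  next
    case 3
    with two_regular_not_asymmetric reg asym card show ?thesis by force
  qed
  let ?f = "id(a := b, b := a)"
  have "E (?f u) (?f v)" if uv: "E u v" for u v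
  proof -
    consider "u = a" "v = b" | "u = b" "v = a" | "u \<noteq> a" "u \<noteq> b" "v \<noteq> a" "v \<noteq> b"
      using nb uv E_sym[OF uv] by metis
    then show ?thesis using uv E_sym[OF uv] ab(3) by cases auto
  qed
  then have "endo_on V E ?f" using ab by (auto simp: endo_on_def)
  moreover have "inj_on ?f V" using ab by (auto simp: inj_on_def)
  ultimately have "?f a = a" using asym ab(1) unfolding asymmetric_on_def by blast
  with ab show False by simp
qed
section \<open>Refutation of patterns\<close>

text \<open>
  A pattern is a graph on \<open>{0..<length h}\<close>; each edge is recorded in \<open>h\<close> at one of its ends. Certificates
  encode the entries of \<open>h\<close> as sets of bits. In \<open>Fold f\<close>, the list \<open>f\<close> is an endomorphism of the pattern. In \<open>Branch v cs\<close>, an entry \<open>(w, j, f)\<close> of \<open>cs\<close>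
  says that with the additional edge from \<open>v\<close> to \<open>w\<close>, where \<open>w = length h\<close> stands for a new vertex, the
  pattern contains an image under \<open>f\<close> of the pattern of node \<open>j\<close>. The flag \<open>au\<close> restricts attention
  to automorphisms.
\<close>

datatype step = Fold "nat list" | Branch nat "(nat \<times> nat \<times> nat list) list"

primrec mem :: "nat \<Rightarrow> nat list \<Rightarrow> bool" where
  "mem x [] = False"
| "mem x (y # ys) = (if x = y then True else mem x ys)"

primrec no_dup :: "nat list \<Rightarrow> bool" where
  "no_dup [] = True"
| "no_dup (y # ys) = (if mem y ys then False else no_dup ys)"

definition adjacent :: "nat list list \<Rightarrow> nat \<Rightarrow> nat \<Rightarrow> bool" where
  "adjacent h a b = (if mem b (h ! a) then True else mem a (h ! b))"

definition neighbours :: "nat list list \<Rightarrow> nat \<Rightarrow> nat list" where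
  "neighbours h a = h ! a @ map fst (filter (\<lambda>(b, l). mem a l) (List.enumerate 0 h))"

text \<open>Distinctness matters: nothing prevents a certificate from recording an edge at both
  ends, and it would then be counted twice.\<close>

definition saturated :: "nat \<Rightarrow> nat list list \<Rightarrow> nat \<Rightarrow> bool" where
  "saturated r h a = (let l = neighbours h a in r \<le> length l \<and> no_dup l)"

definition fold_ok :: "nat \<Rightarrow> bool \<Rightarrow> nat list list \<Rightarrow> nat list \<Rightarrow> bool" where
  "fold_ok r au h f = (length f = length h \<and> list_all (\<lambda>y. y < length h) f \<and>
     (au \<longrightarrow> no_dup f) \<and> \<not> list_all (\<lambda>(x, y). x = y) (List.enumerate 0 f) \<and>
     list_all (\<lambda>(x, y). if y = x then True
       else saturated r h x \<and> list_all (\<lambda>z. adjacent h y (f ! z)) (neighbours h x)) (List.enumerate 0 f))"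

text \<open>The empty list appended to \<open>h\<close> is the entry of a possible new vertex. The
  added edge is not entered into the lists but recognised by its ends \<open>v\<close> and
  \<open>w\<close>; \<open>m\<close> is the number of vertices available after the
  extension.\<close>

definition child_ok ::
    "nat list list \<Rightarrow> nat \<Rightarrow> nat \<Rightarrow> nat list list \<Rightarrow> nat list \<Rightarrow> bool" where
  "child_ok h v w q f = (let k = length h; h' = h @ [[]]; m = (if w = k then Suc w else k) in
     length f = length q \<and> no_dup f \<and> list_all (\<lambda>y. y < m) f \<and>
     list_all (\<lambda>(a, l). list_all (\<lambda>y. let b = f ! y in
       if a = v \<and> b = w then True else if a = w \<and> b = v then True else adjacent h' a b) l) (zip f q))"

text \<open>Certificates omit the part of a vertex map from which on it is the identity.\<close>

fun pad :: "nat \<Rightarrow> 'a list \<Rightarrow> nat list \<Rightarrow> nat list" where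
  "pad i [] f = f"
| "pad i (x # xs) [] = i # pad (Suc i) xs []"
| "pad i (x # xs) (y # ys) = y # pad (Suc i) xs ys"

fun bits :: "nat \<Rightarrow> nat \<Rightarrow> nat list" where
  "bits i n = (if n = 0 then [] else if odd n then i # bits (Suc i) (n div 2) else bits (Suc i) (n div 2))"

declare bits.simps [simp del]

definition pattern :: "nat list \<times> step \<Rightarrow> nat list list" where
  "pattern nd = map (bits 0) (fst nd)"

text \<open>Since \<open>j < i\<close>, references form no cycle. The bound \<open>N\<close> enters
  only in that a pattern with \<open>N\<close> vertices need not offer a new vertex. An empty list
  of choices is then a dead end: \<open>v\<close> lacks a neighbour, but no candidate is
  left.\<close>

primrec step_ok ::
    "nat \<Rightarrow> nat \<Rightarrow> bool \<Rightarrow> (nat \<Rightarrow> nat list \<times> step) \<Rightarrow> nat \<Rightarrow> nat list list \<Rightarrow> step \<Rightarrow> bool" where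
  "step_ok r N au node i h (Fold f) = fold_ok r au h (pad 0 h f)"
| "step_ok r N au node i h (Branch v cs) = (v < length h \<and> length (neighbours h v) < r \<and>
     list_all (\<lambda>(w, j, f). j < i \<and> child_ok h v w (pattern (node j)) (pad 0 (pattern (node j)) f)) cs \<and>
     (let ws = map fst cs in
       (if length h < N then mem (length h) ws else True) \<and>
       list_all (\<lambda>(w, l). if mem w ws then True else if w = v then True
         else if adjacent h v w then True else saturated r h w) (List.enumerate 0 h)))"

definition node_ok :: "nat \<Rightarrow> nat \<Rightarrow> bool \<Rightarrow> (nat \<Rightarrow> nat list \<times> step) \<Rightarrow> nat \<Rightarrow> bool" where
  "node_ok r N au node i \<longleftrightarrow>
     list_all (list_all (\<lambda>x. x < length (pattern (node i)))) (pattern (node i)) \<and>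
     step_ok r N au node i (pattern (node i)) (snd (node i))"

section \<open>Soundness of the refutation checker\<close>

lemma mem_iff: "mem x xs \<longleftrightarrow> x \<in> set xs"
  by (induction xs) auto

lemma no_dup_iff: "no_dup xs \<longleftrightarrow> distinct xs"
  by (induction xs) (auto simp: mem_iff)

lemma list_all_enumerate:
  "list_all P (List.enumerate 0 xs) \<longleftrightarrow> (\<forall>i<length xs. P (i, xs ! i))"
  by (auto simp: list_all_iff in_set_enumerate_eq)

lemma list_all_zip:
  "length xs = length ys \<Longrightarrow> list_all P (zip xs ys) \<longleftrightarrow> (\<forall>i<length xs. P (xs ! i, ys ! i))"
  by (auto simp: list_all_length)

definition wf_pattern :: "nat list list \<Rightarrow> bool" where
  "wf_pattern h \<longleftrightarrow> (\<forall>i<length h. \<forall>j\<in>set (h ! i). j < length h)"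

lemma wf_patternI: "list_all (list_all (\<lambda>x. x < length h)) h \<Longrightarrow> wf_pattern h"
  by (auto simp: list_all_iff wf_pattern_def)

lemma set_neighbours:
  assumes "wf_pattern h" "a < length h"
  shows "set (neighbours h a) = {b. b < length h \<and> adjacent h a b}"
  using assms
  by (auto simp: neighbours_def adjacent_def mem_iff in_set_enumerate_eq wf_pattern_def image_iff Bex_def)

context ugraph
begin

text \<open>Occurrences need not be induced: absent edges of a pattern impose nothing. So a refuted
  pattern rules out every graph that contains it as a subgraph.\<close>

definition occurs :: "(nat \<Rightarrow> 'a) \<Rightarrow> nat list list \<Rightarrow> bool" where
  "occurs \<phi> h \<longleftrightarrow> inj_on \<phi> {..<length h} \<and> \<phi> ` {..<length h} \<subseteq> V \<and>
     (\<forall>i<length h. \<forall>j\<in>set (h ! i). E (\<phi> i) (\<phi> j))"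

lemma occurs_adjacent:
  assumes "occurs \<phi> h" "a < length h" "b < length h" "adjacent h a b"
  shows "E (\<phi> a) (\<phi> b)"
  using assms E_sym by (auto simp: occurs_def adjacent_def mem_iff split: if_splits)

text \<open>The \<open>r\<close> distinct neighbours inside the pattern already exhaust the
  neighbourhood in the graph.\<close>

lemma occurs_saturated:
  assumes occ: "occurs \<phi> h" and wf: "wf_pattern h" and reg: "regular_on V E r"
    and a: "a < length h" and sat: "saturated r h a" and x: "E (\<phi> a) x"
  shows "\<exists>b<length h. adjacent h a b \<and> x = \<phi> b"
proof -
  let ?S = "{b. b < length h \<and> adjacent h a b}"
  have "r \<le> card ?S"
    using sat set_neighbours[OF wf a] distinct_card[of "neighbours h a"]
    by (simp add: saturated_def Let_def no_dup_iff)
  moreover have "card (\<phi> ` ?S) = card ?S"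
    using occ by (intro card_image) (auto simp: occurs_def intro: inj_on_subset)
  moreover have "card {x. E (\<phi> a) x} = r"
    using reg occ a by (auto simp: regular_on_def occurs_def image_subset_iff)
  moreover have "\<phi> ` ?S \<subseteq> {x. E (\<phi> a) x}"
    using occurs_adjacent[OF occ a] by auto
  ultimately have "\<phi> ` ?S = {x. E (\<phi> a) x}"
    by (intro card_seteq) auto
  with x show ?thesis by blast
qed

text \<open>The map \<open>f\<close> is transported along \<open>\<phi>\<close> and extended by the
  identity. An edge at a moved vertex stays inside the copy by saturation, where the certificate has
  checked it; an edge between fixed vertices is preserved trivially.\<close>

lemma fold_ok_no_occurrence:
  assumes occ: "occurs \<phi> h" and wf: "wf_pattern h" and reg: "regular_on V E r"
    and ok: "fold_ok r au h f"
  obtains g v where "endo_on V E g" "au \<Longrightarrow> inj_on g V" "v \<in> V" "g v \<noteq> v"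
proof -
  let ?k = "length h"
  have len: "length f = ?k" and bd: "\<And>i. i < ?k \<Longrightarrow> f ! i < ?k"
    using ok by (auto simp: fold_ok_def list_all_length)
  obtain i0 where i0: "i0 < ?k" "f ! i0 \<noteq> i0"
    using ok by (auto simp: fold_ok_def list_all_enumerate)
  have moved: "saturated r h i" "\<And>z. \<lbrakk>z < ?k; adjacent h i z\<rbrakk> \<Longrightarrow> adjacent h (f ! i) (f ! z)"
    if "i < ?k" "f ! i \<noteq> i" for i
  proof -
    have "saturated r h i \<and> list_all (\<lambda>z. adjacent h (f ! i) (f ! z)) (neighbours h i)"
      using ok that by (simp add: fold_ok_def list_all_enumerate)
    then show "saturated r h i" "\<And>z. \<lbrakk>z < ?k; adjacent h i z\<rbrakk> \<Longrightarrow> adjacent h (f ! i) (f ! z)"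
      using set_neighbours[OF wf that(1)] by (auto simp: list_all_iff)
  qed
  have inj\<phi>: "\<phi> i = \<phi> j \<longleftrightarrow> i = j" if "i < ?k" "j < ?k" for i j
    using occ that by (auto simp: occurs_def inj_on_eq_iff)
  define g where "g x = (if x \<in> \<phi> ` {..<?k} then \<phi> (f ! inv_into {..<?k} \<phi> x) else x)" for x
  have g\<phi>: "g (\<phi> i) = \<phi> (f ! i)" if "i < ?k" for i
    using that occ by (auto simp: g_def occurs_def)
  have g_id: "g x = x" if "x \<notin> \<phi> ` {..<?k}" for x
    using that by (simp add: g_def)
  have \<phi>V: "\<phi> i \<in> V" if "i < ?k" for i using occ that by (auto simp: occurs_def)
  have key: "E (g u) (g w)" if uw: "E u w" and i: "u = \<phi> i" "i < ?k" "f ! i \<noteq> i" for u w i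
  proof -
    obtain b where b: "b < ?k" "adjacent h i b" "w = \<phi> b"
      using occurs_saturated[OF occ wf reg i(2) moved(1)[OF i(2,3)]] uw i by auto
    have "adjacent h (f ! i) (f ! b)" using moved(2)[OF i(2,3)] b by blast
    then show ?thesis using occurs_adjacent[OF occ] bd i b by (simp add: g\<phi>)
  qed
  have movedE: "\<exists>i<?k. u = \<phi> i \<and> f ! i \<noteq> i" if "g u \<noteq> u" for u
  proof -
    have "u \<in> \<phi> ` {..<?k}" using that g_id by blast
    then obtain i where "i < ?k" "u = \<phi> i" by blast
    with that g\<phi> show ?thesis by auto
  qed
  have edge: "E (g u) (g w)" if uw: "E u w" for u w
  proof (cases "g u = u \<and> g w = w")
    case False
    then consider "g u \<noteq> u" | "g w \<noteq> w" by blast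
    then show ?thesis
    proof cases
      case 1
      then show ?thesis using key[OF uw] movedE by blast
    next
      case 2
      then have "E (g w) (g u)" using key[OF E_sym[OF uw]] movedE by blast
      then show ?thesis by (rule E_sym)
    qed
  qed (use uw in simp)
  have gV: "g x \<in> V" if "x \<in> V" for x
    using that g_id[of x] g\<phi> bd \<phi>V by (cases "x \<in> \<phi> ` {..<?k}") auto
  have "inj_on g V" if au
  proof -
    have d: "distinct f" using ok that by (simp add: fold_ok_def no_dup_iff)
    show ?thesis
    proof (rule inj_onI)
      fix x y assume eq: "g x = g y"
      \<comment> \<open>Neither the copy nor its complement is left by \<open>g\<close>, so a
        collision could only occur inside the copy, where \<open>f\<close> is injective, or outside,
        where \<open>g\<close> is the identity.\<close>
      have rng: "g z \<in> \<phi> ` {..<?k} \<longleftrightarrow> z \<in> \<phi> ` {..<?k}" for z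
        using g_id[of z] g\<phi> bd by (cases "z \<in> \<phi> ` {..<?k}") auto
      show "x = y"
      proof (cases "x \<in> \<phi> ` {..<?k}")
        case True
        then obtain i j where ij: "i < ?k" "x = \<phi> i" "j < ?k" "y = \<phi> j"
          using rng[of x] rng[of y] eq by auto
        then have "f ! i = f ! j" using eq g\<phi> inj\<phi> bd by simp
        with d ij len show ?thesis by (simp add: nth_eq_iff_index_eq)
      next
        case False
        then show ?thesis using rng[of x] rng[of y] eq g_id by simp
      qed
    qed
  qed
  moreover have "endo_on V E g" using gV edge by (auto simp: endo_on_def)
  moreover have "g (\<phi> i0) \<noteq> \<phi> i0" using g\<phi> i0 inj\<phi> bd by simp
  ultimately show thesis using that \<phi>V i0(1) by blast
qed

text \<open>Here \<open>\<psi>\<close> is \<open>\<phi>\<close>, extended to the new vertex if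
  \<open>w\<close> is one; composing it with the vertex map \<open>f\<close> places \<open>q\<close>
  inside the enlarged copy.\<close>

lemma child_ok_occurs:
  assumes occ: "occurs \<phi> h" and wf: "wf_pattern h" "wf_pattern q"
    and v: "v < length h" and w: "w \<le> length h" and \<psi>: "\<And>i. i < length h \<Longrightarrow> \<psi> i = \<phi> i"
    and w': "w = length h \<Longrightarrow> \<psi> w \<in> V - \<phi> ` {..<length h}" and e: "E (\<phi> v) (\<psi> w)"
    and ok: "child_ok h v w q f"
  shows "occurs (\<lambda>i. \<psi> (f ! i)) q"
proof -
  let ?k = "length h"
  define m where "m = (if w = ?k then Suc w else ?k)"
  have len: "length f = length q" and d: "distinct f" and bd: "\<And>i. i < length q \<Longrightarrow> f ! i < m"
    using ok by (auto simp: child_ok_def m_def Let_def no_dup_iff list_all_length)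
  have ad: "f ! i = v \<and> f ! j = w \<or> f ! i = w \<and> f ! j = v \<or> adjacent (h @ [[]]) (f ! i) (f ! j)"
    if ij: "i < length q" "j \<in> set (q ! i)" for i j
  proof -
    have "list_all (\<lambda>j. let b = f ! j in if f ! i = v \<and> b = w then True
      else if f ! i = w \<and> b = v then True else adjacent (h @ [[]]) (f ! i) b) (q ! i)"
      using ok ij(1) len by (simp add: child_ok_def Let_def list_all_zip[OF len])
    with ij(2) show ?thesis by (auto simp: list_all_iff Let_def split: if_splits)
  qed
  have \<phi>k: "inj_on \<phi> {..<?k}" "\<phi> ` {..<?k} \<subseteq> V" using occ by (auto simp: occurs_def)
  have inj: "inj_on \<psi> {..<m}"
  proof (cases "w = ?k")
    case True
    then have "{..<m} = insert w {..<?k}" by (auto simp: m_def)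
    moreover have "inj_on \<psi> {..<?k}" "\<psi> ` {..<?k} = \<phi> ` {..<?k}"
      using \<phi>k(1) \<psi> by (auto simp: inj_on_def)
    ultimately show ?thesis using w'[OF True] by auto
  next
    case False
    then show ?thesis using \<phi>k(1) \<psi> by (auto simp: inj_on_def m_def)
  qed
  have \<psi>V: "\<psi> i \<in> V" if "i < m" for i
  proof (cases "i < ?k")
    case False
    with that have "i = w" "w = ?k" by (auto simp: m_def split: if_splits)
    with w' show ?thesis by simp
  qed (use \<phi>k(2) \<psi> in auto)
  have "E (\<psi> (f ! i)) (\<psi> (f ! j))" if "i < length q" "j \<in> set (q ! i)" for i j
  proof -
    have j: "j < length q" using wf(2) that by (auto simp: wf_pattern_def)
    have "E (\<psi> v) (\<psi> w)" using e v \<psi> by simp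
    moreover have "E (\<psi> (f ! i)) (\<psi> (f ! j))" if a: "adjacent (h @ [[]]) (f ! i) (f ! j)"
    proof -
      have le: "f ! i \<le> ?k" "f ! j \<le> ?k"
        using bd[OF \<open>i < length q\<close>] bd[OF j] by (auto simp: m_def split: if_splits)
      \<comment> \<open>The entry of the new vertex is empty and no entry of \<open>h\<close>
        mentions it, so adjacency in \<open>h @ [[]]\<close> is adjacency in
        \<open>h\<close>.\<close>
      have small: "c < ?k \<and> b < ?k" if b: "b \<in> set ((h @ [[]]) ! c)" "c \<le> ?k" for b c
      proof -
        have "c < ?k"
        proof (rule ccontr)
          assume "\<not> c < ?k"
          with b show False by (simp add: nth_append)
        qed
        with b wf(1) show ?thesis by (simp add: nth_append wf_pattern_def)
      qed
      have lt: "f ! i < ?k" "f ! j < ?k"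
        using a small[OF _ le(1)] small[OF _ le(2)]
        by (auto simp only: adjacent_def mem_iff split: if_splits)
      with a have "adjacent h (f ! i) (f ! j)" by (simp add: adjacent_def nth_append split: if_splits)
      with occurs_adjacent[OF occ] lt \<psi> show ?thesis by simp
    qed
    ultimately show ?thesis using ad[OF that] E_sym by metis
  qed
  moreover have "inj_on (\<lambda>i. \<psi> (f ! i)) {..<length q}"
  proof (rule inj_onI)
    fix x y assume xy: "x \<in> {..<length q}" "y \<in> {..<length q}" and "\<psi> (f ! x) = \<psi> (f ! y)"
    then have "f ! x = f ! y" using inj bd by (auto dest: inj_onD)
    with xy d len show "x = y" by (simp add: nth_eq_iff_index_eq)
  qed
  ultimately show ?thesis using bd \<psi>V by (auto simp: occurs_def)
qed

text \<open>Induction along the numbering of the nodes. At a branching, \<open>v\<close> has a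
  neighbour in the graph that the pattern does not show; wherever it lies, the copy together with
  the new edge contains a pattern with a smaller number.\<close>

theorem node_ok_no_occurrence:
  assumes reg: "regular_on V E r" and N: "card V \<le> N"
    and rig: "if au then asymmetric_on V E else rigid_on V E"
    and ok: "\<And>i. i < n \<Longrightarrow> node_ok r N au node i" and "i < n"
  shows "\<not> occurs \<phi> (pattern (node i))"
  using \<open>i < n\<close>
proof (induction i arbitrary: \<phi> rule: less_induct)
  case (less i)
  define h where "h = pattern (node i)"
  define s where "s = snd (node i)"
  let ?k = "length h"
  have wf: "wf_pattern h" and step_ok: "step_ok r N au node i h s"
    using ok[OF less.prems] by (auto simp: node_ok_def h_def s_def intro: wf_patternI)
  show ?case
  proof
    assume "occurs \<phi> (pattern (node i))"
    then have occ: "occurs \<phi> h" by (simp add: h_def)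
    have inj\<phi>: "\<phi> a = \<phi> b \<longleftrightarrow> a = b" if "a < ?k" "b < ?k" for a b
      using occ that by (auto simp: occurs_def inj_on_eq_iff)
    show False
    proof (cases s)
      case (Fold f)
      then have "fold_ok r au h (pad 0 h f)" using step_ok by simp
      from fold_ok_no_occurrence[OF occ wf reg this]
      obtain g v where "endo_on V E g" "au \<Longrightarrow> inj_on g V" "v \<in> V" "g v \<noteq> v" by blast
      then show False using rig by (auto simp: asymmetric_on_def rigid_on_def split: if_splits)
    next
      case (Branch v cs)
      have v: "v < ?k" "length (neighbours h v) < r"
        and child: "\<And>w j f. (w, j, f) \<in> set cs \<Longrightarrow> j < i \<and> child_ok h v w (pattern (node j)) (pad 0 (pattern (node j)) f)"
        and new: "?k < N \<Longrightarrow> ?k \<in> fst ` set cs"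
        and old: "\<And>w. w < ?k \<Longrightarrow> w \<in> fst ` set cs \<or> w = v \<or> adjacent h v w \<or> saturated r h w"
        using step_ok Branch
        by (auto simp: Let_def list_all_iff[of _ cs] list_all_enumerate mem_iff
            split: if_splits)
      have step: False if w: "w \<in> fst ` set cs" "w \<le> ?k"
        and \<psi>: "\<And>i. i < ?k \<Longrightarrow> \<psi> i = \<phi> i" "w = ?k \<Longrightarrow> \<psi> w \<in> V - \<phi> ` {..<?k}" "E (\<phi> v) (\<psi> w)"
      for w \<psi>
      proof -
        from w(1) obtain j f where "(w, j, f) \<in> set cs" by auto
        from child[OF this] have j: "j < i" and c: "child_ok h v w (pattern (node j)) (pad 0 (pattern (node j)) f)" by auto
        have "wf_pattern (pattern (node j))"
          using ok[of j] j less.prems by (auto simp: node_ok_def intro: wf_patternI)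
        from child_ok_occurs[OF occ wf this v(1) w(2) \<psi> c] less.IH[OF j] j less.prems
        show False by auto
      qed
      have "card (\<phi> ` set (neighbours h v)) < card {x. E (\<phi> v) x}"
      proof -
        have "card (\<phi> ` set (neighbours h v)) \<le> length (neighbours h v)"
          by (meson card_image_le card_length finite_set le_trans)
        moreover have "card {x. E (\<phi> v) x} = r"
          using reg occ v(1) by (auto simp: regular_on_def occurs_def image_subset_iff)
        ultimately show ?thesis using v(2) by simp
      qed
      then have "\<not> {x. E (\<phi> v) x} \<subseteq> \<phi> ` set (neighbours h v)"
        by (meson List.finite_set card_mono finite_imageI linorder_not_le)
      then obtain x where x: "E (\<phi> v) x" "x \<notin> \<phi> ` set (neighbours h v)" by blast
      show False
      proof (cases "x \<in> \<phi> ` {..<?k}")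
        case True
        then obtain w where w: "w < ?k" "x = \<phi> w" by auto
        have nadj: "\<not> adjacent h v w"
          using x(2) w set_neighbours[OF wf v(1)] by auto
        have "w \<noteq> v" using x(1) w E_irrefl by auto
        \<comment> \<open>If \<open>w\<close> were saturated, \<open>\<phi> v\<close> would be among
          the neighbours of \<open>w\<close> that the pattern shows.\<close>
        have "\<not> saturated r h w"
        proof
          assume "saturated r h w"
          from occurs_saturated[OF occ wf reg w(1) this, of "\<phi> v"] x w E_sym
          obtain b where "b < ?k" "adjacent h w b" "\<phi> v = \<phi> b" by blast
          with inj\<phi> v(1) nadj show False by (auto simp: adjacent_def split: if_splits)
        qed
        with old[OF w(1)] nadj \<open>w \<noteq> v\<close> have "w \<in> fst ` set cs" by blast
        from step[OF this, of \<phi>] w x(1) show False by auto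
      next
        case False
        have xV: "x \<in> V" using x(1) E_in by blast
        \<comment> \<open>A vertex outside the copy shows that the pattern has fewer than
          \<open>card V\<close> vertices, so the certificate must offer a new vertex.\<close>
        have "card (insert x (\<phi> ` {..<?k})) \<le> card V"
          using xV occ by (intro card_mono) (auto simp: occurs_def)
        moreover have "card (\<phi> ` {..<?k}) = ?k"
          using occ by (simp add: occurs_def card_image)
        ultimately have "?k < N" using False N by simp
        from step[OF new[OF this], of "\<phi>(?k := x)"] x(1) xV False show False by auto
      qed
    qed
  qed
qed

end

lemma (in ugraph) certificate_imp_card_greater:
  assumes "regular_on V E r" "V \<noteq> {}" "if au then asymmetric_on V E else rigid_on V E"
    and "list_all (node_ok r N au node) [0..<n]" "i < n" "pattern (node i) = [[]]"
  shows "N < card V"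
proof (rule ccontr)
  assume "\<not> N < card V"
  moreover obtain v where "v \<in> V" using assms(2) by blast
  then have "occurs (\<lambda>_. v) (pattern (node i))" by (simp add: occurs_def assms(6) lessThan_Suc)
  moreover have "node_ok r N au node j" if "j < n" for j
    using assms(4) that by (simp add: list_all_iff)
  ultimately show False
    using node_ok_no_occurrence[of r N au n node i, OF assms(1) _ assms(3) _ assms(5)] by simp
qed
section \<open>Search for endomorphisms\<close>

text \<open>The list \<open>f\<close> holds the images of the vertices placed so far and
  \<open>b\<close> the earlier neighbours of the next vertex, whose image is sought among the
  neighbours of the image of \<open>p\<close>. A vertex without earlier neighbours makes the check
  fail, so graphs must be numbered in a connected way from 0 on.\<close>

primrec search :: "(nat \<Rightarrow> nat list) \<Rightarrow> nat list \<Rightarrow> nat list list \<Rightarrow> nat list \<Rightarrow> bool" where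
  "search g t [] f = (f = t)"
| "search g t (b # bs) f = (case b of [] \<Rightarrow> False
     | p # ps \<Rightarrow> list_all (\<lambda>w. if list_all (\<lambda>q. mem w (g (f ! q))) ps
         then search g t bs (f @ [w]) else True) (g (f ! p)))"

definition only_identity :: "(nat \<Rightarrow> nat list) \<Rightarrow> nat list list \<Rightarrow> bool" where
  "only_identity g adj = (let t = map fst (List.enumerate 0 adj);
     bs = map (\<lambda>(i, l). filter (\<lambda>j. j < i) l) (tl (List.enumerate 0 adj)) in
     list_all (\<lambda>w. if w < length adj then search g t bs [w] else True) t)"

definition regular_graph :: "nat \<Rightarrow> nat list list \<Rightarrow> bool" where
  "regular_graph d adj = list_all (\<lambda>(i, l). length l = d \<and> no_dup l \<and>
     list_all (\<lambda>j. j < length adj \<and> \<not> i = j \<and> mem i (adj ! j)) l) (List.enumerate 0 adj)"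

text \<open>The values of a homomorphism \<open>h\<close> follow one branch of the search: none of
  the adjacency tests fails for them, so the branch ends with the comparison of \<open>h\<close> and
  \<open>t\<close>.\<close>

lemma search_sound:
  assumes hom: "\<And>i j. \<lbrakk>i < n; j \<in> set (g i)\<rbrakk> \<Longrightarrow> h j \<in> set (g (h i))"
    and sym: "\<And>i j. \<lbrakk>i < n; j \<in> set (g i)\<rbrakk> \<Longrightarrow> j < n \<and> i \<in> set (g j)"
    and "i + length bs = n"
    and "\<And>k p. \<lbrakk>k < length bs; p \<in> set (bs ! k)\<rbrakk> \<Longrightarrow> p < i + k \<and> p \<in> set (g (i + k))"
    and "search g t bs (map h [0..<i])"
  shows "map h [0..<n] = t"
  using assms(3-)
proof (induction bs arbitrary: i)
  case (Cons b bs)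
  have b: "p < i \<and> h i \<in> set (g (h p))" if "p \<in> set b" for p
  proof -
    have p: "p < i" "p \<in> set (g i)" using Cons.prems(2)[of 0 p] that by auto
    moreover have "i < n" using Cons.prems(1) by simp
    ultimately show ?thesis using sym[of i p] hom[of p i] by auto
  qed
  then obtain p ps where pp: "b = p # ps" using Cons.prems(3) by (cases b) auto
  have "search g t bs (map h [0..<i] @ [h i])"
    using Cons.prems(3) b by (simp add: pp list_all_iff mem_iff split: if_splits)
  then have "search g t bs (map h [0..<Suc i])" by simp
  moreover have "p < Suc i + k \<and> p \<in> set (g (Suc i + k))" if "k < length bs" "p \<in> set (bs ! k)" for k p
    using Cons.prems(2)[of "Suc k" p] that by simp
  ultimately show ?case using Cons.IH[of "Suc i"] Cons.prems(1) by simp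
qed auto

theorem only_identity_imp_order:
  assumes g: "g = (!) adj" and reg: "regular_graph d adj" and id: "only_identity g adj"
    and ne: "adj \<noteq> []"
  shows "length adj \<in> rigid_regular_orders d"
proof -
  let ?n = "length adj"
  define E where "E u v \<longleftrightarrow> u < ?n \<and> v \<in> set (g u)" for u v
  have adj: "length (g i) = d \<and> distinct (g i) \<and> (\<forall>j\<in>set (g i). j < ?n \<and> i \<noteq> j \<and> i \<in> set (g j))"
    if "i < ?n" for i
  proof -
    have "length (adj ! i) = d \<and> no_dup (adj ! i) \<and>
        list_all (\<lambda>j. j < ?n \<and> \<not> i = j \<and> mem i (adj ! j)) (adj ! i)"
      using reg that by (simp add: regular_graph_def list_all_enumerate)
    then show ?thesis by (simp add: g no_dup_iff list_all_iff mem_iff)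
  qed
  have "ugraph {..<?n} E"
    by unfold_locales (use adj in \<open>auto simp: E_def\<close>)
  moreover have "regular_on {..<?n} E d"
    unfolding regular_on_def
  proof
    fix v assume v: "v \<in> {..<?n}"
    then have "{w. E v w} = set (g v)" by (simp add: E_def)
    with adj[of v] v show "card {w. E v w} = d" by (simp add: distinct_card)
  qed
  moreover have "rigid_on {..<?n} E"
    unfolding rigid_on_def
  proof (intro allI impI)
    fix f assume f: "endo_on {..<?n} E f"
    define bs where "bs = map (\<lambda>(i, l). filter (\<lambda>j. j < i) l) (tl (List.enumerate 0 adj))"
    have t: "map fst (List.enumerate 0 adj) = [0..<?n]"
      by (simp add: enumerate_eq_zip)
    have f0: "f 0 < ?n" using f ne by (auto simp: endo_on_def)
    then have "search g [0..<?n] bs [f 0]"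
      using id by (auto simp: only_identity_def t bs_def list_all_iff)
    then have srch: "search g [0..<?n] bs (map f [0..<1])" by simp
    have len: "1 + length bs = ?n" using ne by (simp add: bs_def)
    \<comment> \<open>Dropping vertex 0 from the enumeration shifts the indices: entry
      \<open>k\<close> of \<open>bs\<close> belongs to vertex \<open>k + 1\<close>.\<close>
    have below: "p < 1 + k \<and> p \<in> set (g (1 + k))" if "k < length bs" "p \<in> set (bs ! k)" for k p
    proof -
      have "bs ! k = filter (\<lambda>j. j < Suc k) (adj ! Suc k)"
        using that(1) by (simp add: bs_def nth_tl nth_enumerate_eq)
      with that show ?thesis by (simp add: g)
    qed
    have hom: "f j \<in> set (g (f i))" if "i < ?n" "j \<in> set (g i)" for i j
    proof -
      have "E i j" using that by (simp add: E_def)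
      then have "E (f i) (f j)" using f by (simp add: endo_on_def)
      then show ?thesis by (simp add: E_def)
    qed
    have sym: "j < ?n \<and> i \<in> set (g j)" if "i < ?n" "j \<in> set (g i)" for i j
      using adj[OF that(1)] that(2) by blast
    have "map f [0..<?n] = [0..<?n]"
      by (rule search_sound[OF hom sym len below srch])
    then show "\<forall>v\<in>{..<?n}. f v = v"
      by (metis atLeast_upt lessThan_iff map_eq_conv map_ident)
  qed
  ultimately show ?thesis using card_in_ordersI[of "{..<?n}" E d] ne by auto
qed
section \<open>Rigid complements\<close>

context ugraph
begin

lemma endo_funpow: "endo_on V E f \<Longrightarrow> endo_on V E (f ^^ m)"
  by (induction m) (auto simp: endo_on_def image_subset_iff)

text \<open>On the finite set \<open>V\<close> the iterates of \<open>f\<close> are eventually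
  periodic, so some positive power is idempotent; being a power of \<open>f\<close>, it is not
  injective either.\<close>

lemma idempotent_endo:
  assumes f: "endo_on V E f" and ninj: "\<not> inj_on f V"
  obtains g where "endo_on V E g" "\<not> inj_on g V" "\<And>v. v \<in> V \<Longrightarrow> g (g v) = g v"
proof -
  have fV: "(f ^^ m) v \<in> V" if "v \<in> V" for m v
    using endo_funpow[OF f, of m] that by (auto simp: endo_on_def)
  have "(\<lambda>m. restrict (f ^^ m) V) ` UNIV \<subseteq> V \<rightarrow>\<^sub>E V" using fV by auto
  then have "finite (range (\<lambda>m. restrict (f ^^ m) V))"
    by (rule finite_subset) (simp add: finite_PiE)
  then have "\<not> inj (\<lambda>m. restrict (f ^^ m) V)" using range_inj_infinite by blast
  then obtain i j where ij: "i < j" "restrict (f ^^ i) V = restrict (f ^^ j) V"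
    by (metis (mono_tags, lifting) injI linorder_neqE_nat)
  define p where "p = j - i"
  have p: "0 < p" "j = i + p" using ij(1) by (auto simp: p_def)
  have base: "(f ^^ (i + p)) v = (f ^^ i) v" if "v \<in> V" for v
    using fun_cong[OF ij(2), of v] that p(2) by simp
  have period: "(f ^^ (r + i + q * p)) v = (f ^^ (r + i)) v" if "v \<in> V" for r q v
  proof (induction q)
    case (Suc q)
    have "(f ^^ (r + i + Suc q * p)) v = (f ^^ (r + q * p)) ((f ^^ (i + p)) v)"
      by (metis (no_types, opaque_lifting) add.assoc add.commute comp_apply funpow_add mult_Suc)
    also have "\<dots> = (f ^^ (r + i + q * p)) v"
      by (metis (no_types, opaque_lifting) base[OF that] add.assoc add.commute comp_apply funpow_add)
    finally show ?case using Suc.IH by simp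
  qed simp
  \<comment> \<open>A positive multiple of the period that is at least the preperiod
    \<open>i\<close>.\<close>
  define m where "m = Suc i * p"
  have "i * 1 \<le> m" unfolding m_def using p(1) by (intro mult_le_mono) auto
  then have m: "i \<le> m" "0 < m" using p(1) by (simp_all add: m_def)
  define g where "g = f ^^ m"
  have "g (g v) = g v" if "v \<in> V" for v
  proof -
    have "g (g v) = (f ^^ (m - i + i + Suc i * p)) v" using m(1) by (simp add: g_def funpow_add m_def)
    also have "\<dots> = g v" using period[OF that, of "m - i" "Suc i"] m(1) by (simp add: g_def)
    finally show ?thesis .
  qed
  moreover have "\<not> inj_on g V"
  proof
    assume "inj_on g V"
    moreover have "g = (f ^^ (m - 1)) \<circ> f" using m(2) by (metis Suc_diff_1 funpow_Suc_right g_def)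
    ultimately show False using ninj by (metis inj_on_imageI2)
  qed
  moreover have "endo_on V E g" using endo_funpow[OF f] by (simp add: g_def)
  ultimately show thesis using that by blast
qed

text \<open>
  A proper retraction \<open>g\<close> of the complement moves each vertex \<open>v\<close> it removes to a neighbour \<open>g v\<close>
  in the graph. Since there are no triangles, all neighbours of \<open>g v\<close> are removed as well, and counting
  edges shows that removed vertices and their images form a bipartite component.
\<close>

theorem rigid_compl:
  assumes reg: "regular_on V E k"
    and triangle_free: "\<And>u v w. \<lbrakk>E u v; E v w\<rbrakk> \<Longrightarrow> \<not> E u w"
    and connected: "\<And>S. \<lbrakk>S \<noteq> {}; S \<subseteq> V; \<And>u v. \<lbrakk>u \<in> S; E u v\<rbrakk> \<Longrightarrow> v \<in> S\<rbrakk> \<Longrightarrow> S = V"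
    and non_bipartite: "\<And>c :: 'a \<Rightarrow> bool. \<exists>u v. E u v \<and> c u = c v"
    and asym: "asymmetric_on V E"
  shows "rigid_on V (compl_on V E)"
  unfolding rigid_on_def
proof (intro allI impI)
  let ?C = "compl_on V E"
  fix f assume f: "endo_on V ?C f"
  interpret C: ugraph V ?C by (rule ugraph_compl)
  show "\<forall>v\<in>V. f v = v"
  proof (cases "inj_on f V")
    case True
    with f asym asymmetric_compl show ?thesis by (simp add: asymmetric_on_def)
  next
    case False
    from C.idempotent_endo[OF f this] obtain g where g: "endo_on V ?C g" "\<not> inj_on g V"
      and idem: "\<And>v. v \<in> V \<Longrightarrow> g (g v) = g v" by blast
    have gV: "g v \<in> V" if "v \<in> V" for v using g(1) that by (auto simp: endo_on_def)
    have gC: "?C (g u) (g v)" if "?C u v" for u v using g(1) that by (simp add: endo_on_def)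
    \<comment> \<open>The complement has no loops, so vertices with the same image cannot be
      adjacent in it.\<close>
    have fibre: "E u v" if "u \<in> V" "v \<in> V" "u \<noteq> v" "g u = g v" for u v
      using gC[of u v] that by (auto simp: compl_on_def)
    define R where "R = {v \<in> V. g v \<noteq> v}"
    have RV: "R \<subseteq> V" by (auto simp: R_def)
    have Rg: "E v (g v)" if "v \<in> R" for v
      using that fibre[of v "g v"] gV idem by (auto simp: R_def)
    \<comment> \<open>An unmoved neighbour \<open>a\<close> of \<open>g v\<close> is not adjacent to
      \<open>v\<close>, as there are no triangles. Then \<open>v\<close> and \<open>a\<close> are
      adjacent in the complement, and so would be their images \<open>g v\<close> and
      \<open>a\<close>.\<close>
    have nbrs_R: "a \<in> R" if v: "v \<in> R" and a: "E (g v) a" for v a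
    proof (rule ccontr)
      assume "a \<notin> R"
      then have "a \<in> V" "g a = a" "v \<noteq> a" using a v E_in by (auto simp: R_def)
      moreover have "\<not> E v a" using triangle_free[OF Rg[OF v] a] .
      ultimately have "?C v a" using v by (auto simp: compl_on_def R_def)
      from gC[OF this] \<open>g a = a\<close> a show False by (simp add: compl_on_def)
    qed
    \<comment> \<open>Two vertices of \<open>R\<close> with the same image would form a triangle
      with it.\<close>
    have inj: "inj_on g R"
    proof (rule inj_onI, rule ccontr)
      fix u v assume uv: "u \<in> R" "v \<in> R" "g u = g v" "u \<noteq> v"
      then have "E u v" using fibre RV by blast
      from triangle_free[OF this Rg[OF uv(2)]] Rg[OF uv(1)] uv(3) show False by simp
    qed
    let ?F = "g ` R"
    have finR: "finite R" using finite_subset[OF RV finV] .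
    have FV: "?F \<subseteq> V" using gV RV by auto
    have disj: "v \<notin> R" if "v \<in> ?F" for v using that idem by (auto simp: R_def)
    \<comment> \<open>Double counting: all edges at \<open>?F\<close> end in \<open>R\<close>, and
      their number \<open>card R * k\<close> is that of the edges at \<open>R\<close>, so
      \<open>R\<close> has no other edges.\<close>
    have nbrs_F: "s \<in> ?F" if "a \<in> R" "E a s" for a s
    proof -
      let ?A = "Sigma ?F (\<lambda>s. {a. E s a})" and ?B = "Sigma R (\<lambda>a. {s. E a s})"
      have card: "card (Sigma S (\<lambda>s. {a. E s a})) = card S * k" if "S \<subseteq> V" for S
        using that reg finite_subset[OF that finV] by (simp add: regular_on_def subset_iff)
      have "prod.swap ` ?A \<subseteq> ?B" using nbrs_R E_sym by auto
      moreover have "card (prod.swap ` ?A) = card ?B"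
        using card[OF FV] card[OF RV] inj by (simp add: card_image)
      moreover have "finite ?B" using finR by simp
      ultimately have "prod.swap ` ?A = ?B" by (intro card_subset_eq)
      then have "(a, s) \<in> prod.swap ` ?A" using that by auto
      then show ?thesis by auto
    qed
    have "R \<noteq> {}"
    proof
      assume "R = {}"
      then have "inj_on g V" by (auto simp: R_def inj_on_def)
      with g(2) show False ..
    qed
    \<comment> \<open>The disjoint sets \<open>R\<close> and \<open>?F\<close> have edges only to
      each other, so their union is closed under adjacency and 2-coloured by membership in
      \<open>R\<close>.\<close>
    then have "R \<union> ?F = V"
      using RV FV nbrs_R nbrs_F by (intro connected) blast+
    then have "(u \<in> R) \<noteq> (v \<in> R)" if "E u v" for u v
      using that E_in[OF that] nbrs_R nbrs_F disj by blast
    with non_bipartite[of "\<lambda>v. v \<in> R"] show ?thesis by blast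
  qed
qed

end
section \<open>A family of cubic graphs\<close>

text \<open>The finite set \<open>A\<close> is permuted by \<open>f\<close>, so nothing from outside
  can enter it. This makes sets defined by the absence of a local structure invariant.\<close>

lemma inj_invariant_compl:
  assumes "finite V" "f ` V \<subseteq> V" "inj_on f V" "A \<subseteq> V" "\<And>v. v \<in> A \<Longrightarrow> f v \<in> A" "v \<in> V" "v \<notin> A"
  shows "f v \<notin> A"
proof
  assume "f v \<in> A"
  have "f ` A = A"
    using assms by (intro endo_inj_surj) (auto intro: finite_subset inj_on_subset)
  then obtain u where "u \<in> A" "f u = f v" using \<open>f v \<in> A\<close> by (metis imageE)
  then show False using assms by (metis inj_onD subsetD)
qed

text \<open>
  On \<open>n = k + 14\<close> vertices, a circular ladder is the cycle \<open>0, 1, ..., n - 1\<close> with chords from each even \<open>i\<close>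
  to \<open>i + 3\<close>. The graph below is obtained from it by replacing the edges 01, 34, 67 with 06, 14, 37.
\<close>

definition cubic_arc :: "nat \<Rightarrow> nat \<Rightarrow> nat \<Rightarrow> bool" where
  "cubic_arc k u v \<longleftrightarrow>
     (u, v) \<in> {(0, 3), (0, 6), (0, k + 13), (1, 2), (1, 4), (1, k + 12), (2, 3), (2, 5), (3, 7), (4, 5),
       (4, 7), (5, 6), (6, 9), (7, 8)} \<or>
     8 \<le> u \<and> v < k + 14 \<and> (v = u + 1 \<or> even u \<and> v = u + 3)"

definition cubic_edge :: "nat \<Rightarrow> nat \<Rightarrow> nat \<Rightarrow> bool" where
  "cubic_edge k u v \<longleftrightarrow> cubic_arc k u v \<or> cubic_arc k v u"

section \<open>Neighbourhoods, parity and connectivity in the cubic family\<close>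

lemma cubic_nbrs_low:
  "cubic_edge k 0 v \<longleftrightarrow> v = 3 \<or> v = 6 \<or> v = k + 13"
  "cubic_edge k 1 v \<longleftrightarrow> v = 2 \<or> v = 4 \<or> v = k + 12"
  "cubic_edge k 2 v \<longleftrightarrow> v = 1 \<or> v = 3 \<or> v = 5"
  "cubic_edge k 3 v \<longleftrightarrow> v = 0 \<or> v = 2 \<or> v = 7"
  "cubic_edge k 4 v \<longleftrightarrow> v = 1 \<or> v = 5 \<or> v = 7"
  "cubic_edge k 5 v \<longleftrightarrow> v = 2 \<or> v = 4 \<or> v = 6"
  "cubic_edge k 6 v \<longleftrightarrow> v = 0 \<or> v = 5 \<or> v = 9"
  "cubic_edge k 7 v \<longleftrightarrow> v = 3 \<or> v = 4 \<or> v = 8"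
  "cubic_edge k 8 v \<longleftrightarrow> v = 7 \<or> v = 9 \<or> v = 11"
  "cubic_edge k 9 v \<longleftrightarrow> v = 6 \<or> v = 8 \<or> v = 10"
  by (auto simp: cubic_edge_def cubic_arc_def)

lemma cubic_nbrs_high:
  assumes "even k"
  shows "cubic_edge k (k + 12) v \<longleftrightarrow> v = 1 \<or> v = k + 11 \<or> v = k + 13"
    and "cubic_edge k (k + 13) v \<longleftrightarrow> v = 0 \<or> v = k + 10 \<or> v = k + 12"
  using assms by (auto simp: cubic_edge_def cubic_arc_def; presburger)+

text \<open>Chords lead upwards from even vertices, hence downwards from odd ones.\<close>

lemma cubic_nbrs_middle:
  assumes "even k" "10 \<le> u" "u < k + 12"
  shows "cubic_edge k u v \<longleftrightarrow> u = v + 1 \<or> v = u + 1 \<or> (if even u then v = u + 3 else u = v + 3)"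
proof -
  have "cubic_edge k u v \<longleftrightarrow> v = u + 1 \<or> even u \<and> v = u + 3 \<and> v < k + 14 \<or> u = v + 1 \<or> even v \<and> u = v + 3"
    using assms by (auto simp: cubic_edge_def cubic_arc_def)
  moreover have "even u \<Longrightarrow> u + 3 < k + 14" using assms by presburger
  ultimately show ?thesis using assms(2) by auto
qed

lemma cubic_path_edge: "8 \<le> u \<Longrightarrow> u < k + 13 \<Longrightarrow> cubic_edge k u (u + 1)"
  by (simp add: cubic_edge_def cubic_arc_def)

lemma cubic_chord: "8 \<le> u \<Longrightarrow> u < k + 11 \<Longrightarrow> even u \<Longrightarrow> cubic_edge k u (u + 3)"
  by (simp add: cubic_edge_def cubic_arc_def)

lemma cubic_edge_commute: "cubic_edge k u v \<longleftrightarrow> cubic_edge k v u"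
  by (auto simp: cubic_edge_def)

lemma cubic_ugraph: "ugraph {..<k + 14} (cubic_edge k)"
  by unfold_locales (auto simp: cubic_edge_def cubic_arc_def)

lemma cubic_vertex_cases:
  fixes u k :: nat
  assumes "u < k + 14"
  obtains "u = 0" | "u = 1" | "u = 2" | "u = 3" | "u = 4" | "u = 5" | "u = 6" | "u = 7" | "u = 8" | "u = 9"
    | "10 \<le> u" "u < k + 12" | "u = k + 12" | "u = k + 13"
proof -
  have "u = 0 \<or> u = 1 \<or> u = 2 \<or> u = 3 \<or> u = 4 \<or> u = 5 \<or> u = 6 \<or> u = 7 \<or> u = 8 \<or> u = 9 \<or>
    10 \<le> u \<and> u < k + 12 \<or> u = k + 12 \<or> u = k + 13"
    using assms by arith
  then show thesis by (elim disjE conjE) (rule that; assumption)+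
qed

lemma card_three:
  assumes "\<And>w. P w \<longleftrightarrow> w = a \<or> w = b \<or> w = c" "a \<noteq> b" "a \<noteq> c" "b \<noteq> c"
  shows "card {w. P w} = 3"
proof -
  have "{w. P w} = {a, b, c}" using assms(1) by auto
  with assms(2-) show ?thesis by simp
qed

lemma cubic_regular:
  assumes "even k"
  shows "regular_on {..<k + 14} (cubic_edge k) 3"
  unfolding regular_on_def
proof
  fix u assume "u \<in> {..<k + 14}"
  then have "u < k + 14" by simp
  then show "card {w. cubic_edge k u w} = 3"
  proof (cases rule: cubic_vertex_cases)
    case 11
    show ?thesis
    proof (rule card_three)
      show "cubic_edge k u w \<longleftrightarrow> w = u - 1 \<or> w = u + 1 \<or> w = (if even u then u + 3 else u - 3)" for w
        using cubic_nbrs_middle[OF assms 11, of w] 11 by auto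
    qed (use 11 in auto)
  qed (auto intro!: card_three simp: cubic_nbrs_low cubic_nbrs_high[OF assms] simp del: One_nat_def)
qed

text \<open>The order is even and the ladder has only steps 1 and 3, so it is bipartite by parity;
  of the new edges, 14 respects parity while 06 and 37 do not.\<close>

lemma cubic_same_parity:
  assumes "even k" "cubic_edge k u v" "even u = even v"
  shows "(u, v) \<in> {(0, 6), (6, 0), (3, 7), (7, 3)}"
  using assms by (auto simp: cubic_edge_def cubic_arc_def)

text \<open>Two vertices of a triangle have the same parity and hence span 06 or 37, but the ends of
  either of these edges have no common neighbour.\<close>

lemma cubic_triangle_free:
  assumes "even k" "cubic_edge k u v" "cubic_edge k v w"
  shows "\<not> cubic_edge k u w"
proof
  assume uw: "cubic_edge k u w"
  have no: False if "cubic_edge k a b" "even a = even b" "cubic_edge k a c" "cubic_edge k b c" for a b c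
    using cubic_same_parity[OF assms(1) that(1,2)] that(3,4) by (auto simp: cubic_nbrs_low)
  consider "even u = even v" | "even v = even w" | "even u = even w" by blast
  then show False
    using no[of u v w] no[of v w u] no[of u w v] assms uw cubic_edge_commute by cases metis+
qed

text \<open>Vertices from \<open>a\<close> on are joined by a path, and those below are linked to
  \<open>a\<close> case by case. In both families the path edges from 8 on are untouched by the
  switching.\<close>

lemma connected_by_path:
  assumes "S \<noteq> {}" "S \<subseteq> {..<n}"
    and closed: "\<And>u v. \<lbrakk>u \<in> S; E u v\<rbrakk> \<Longrightarrow> v \<in> S"
    and sym: "\<And>u v. E u v \<Longrightarrow> E v u"
    and path: "\<And>u. \<lbrakk>a \<le> u; u + 1 < n\<rbrakk> \<Longrightarrow> E u (u + 1)"
    and low: "\<And>u. u < a \<Longrightarrow> u \<in> S \<longleftrightarrow> a \<in> S"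
  shows "S = {..<n :: nat}"
proof -
  have seg: "a + i \<in> S \<longleftrightarrow> a \<in> S" if "a + i < n" for i
    using that
  proof (induction i)
    case (Suc i)
    then have "E (a + i) (a + Suc i)" using path[of "a + i"] by simp
    with sym closed have "a + Suc i \<in> S \<longleftrightarrow> a + i \<in> S" by blast
    with Suc show ?case by simp
  qed simp
  have "u \<in> S \<longleftrightarrow> a \<in> S" if "u < n" for u
    using low[of u] seg[of "u - a"] that by (cases "u < a") simp_all
  with assms(1,2) show ?thesis by blast
qed

lemma cubic_connected:
  assumes "S \<noteq> {}" "S \<subseteq> {..<k + 14}" and closed: "\<And>u v. \<lbrakk>u \<in> S; cubic_edge k u v\<rbrakk> \<Longrightarrow> v \<in> S"
  shows "S = {..<k + 14}"
proof (rule connected_by_path[where a = 8 and E = "cubic_edge k", OF assms])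
  have "3 \<in> S \<longleftrightarrow> 7 \<in> S" "7 \<in> S \<longleftrightarrow> 8 \<in> S" "0 \<in> S \<longleftrightarrow> 3 \<in> S" "2 \<in> S \<longleftrightarrow> 3 \<in> S"
    "4 \<in> S \<longleftrightarrow> 7 \<in> S" "1 \<in> S \<longleftrightarrow> 4 \<in> S" "5 \<in> S \<longleftrightarrow> 4 \<in> S" "6 \<in> S \<longleftrightarrow> 5 \<in> S"
    by (meson closed cubic_nbrs_low)+
  moreover have "u \<in> {0, 1, 2, 3, 4, 5, 6, 7}" if "u < 8" for u :: nat using that by auto
  ultimately show "u \<in> S \<longleftrightarrow> 8 \<in> S" if "u < 8" for u using that by blast
qed (use cubic_path_edge cubic_edge_commute in auto)

text \<open>The 5-cycle 0-3-2-5-6 uses exactly one of the two edges inside a parity class.\<close>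

lemma cubic_non_bipartite: "\<exists>u v. cubic_edge k u v \<and> c u = (c v :: bool)"
proof -
  have "cubic_edge k 0 3" "cubic_edge k 3 2" "cubic_edge k 2 5" "cubic_edge k 5 6" "cubic_edge k 6 0"
    by (simp_all add: cubic_nbrs_low)
  then show ?thesis by metis
qed

text \<open>
  The vertices 0, 3, 6 and 7 are the only ones on no 4-cycle. They induce the path 6-0-3-7, which
  cannot be reversed since 2, the third neighbour of 3, is adjacent to a neighbour of 6.
\<close>

lemma cubic_asymmetric:
  assumes k: "even k"
  shows "asymmetric_on {..<k + 14} (cubic_edge k)"
  unfolding asymmetric_on_def
proof (intro allI impI)
  let ?V = "{..<k + 14}" and ?E = "cubic_edge k"
  fix f assume "endo_on ?V ?E f \<and> inj_on f ?V"
  then have f: "endo_on ?V ?E f" and inj: "inj_on f ?V" by auto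
  note nbrs = cubic_nbrs_low cubic_nbrs_high[OF k]
  have hom: "?E (f u) (f v)" if "?E u v" for u v using f that by (simp add: endo_on_def)
  have fV: "f u < k + 14" if "u < k + 14" for u
    using f that by (auto simp: endo_on_def image_subset_iff)
  have eq: "f u = f v \<longleftrightarrow> u = v" if "u < k + 14" "v < k + 14" for u v
    using inj that by (simp add: inj_on_eq_iff)
  \<comment> \<open>That is, \<open>u\<close> lies on the 4-cycle \<open>u\<close>,
    \<open>v\<close>, \<open>y\<close>, \<open>x\<close>.\<close>
  define S where "S u \<longleftrightarrow> (\<exists>v x y. ?E u v \<and> ?E u x \<and> ?E v y \<and> ?E x y \<and> v \<noteq> x \<and> u \<noteq> y)" for u
  have SI: "S u" if "?E u v" "?E u x" "?E v y" "?E x y" "v \<noteq> x" "u \<noteq> y" for u v x y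
    using that unfolding S_def by blast
  have S_f: "S (f u)" if "S u" for u
  proof -
    from that obtain v x y where *: "?E u v" "?E u x" "?E v y" "?E x y" "v \<noteq> x" "u \<noteq> y"
      by (auto simp: S_def)
    then have "{u, v, x, y} \<subseteq> ?V" using ugraph.E_in[OF cubic_ugraph] by blast
    with * have "f v \<noteq> f x" "f u \<noteq> f y" using eq by auto
    with * hom show ?thesis unfolding S_def by blast
  qed
  have S_iff: "S u \<longleftrightarrow> u \<notin> {0, 3, 6, 7}" if u: "u < k + 14" for u
  proof -
    have square: "S a \<and> S b \<and> S c \<and> S d"
      if "?E a b" "?E b c" "?E c d" "?E d a" "a \<noteq> c" "b \<noteq> d" for a b c d
    proof -
      have "?E b a" "?E c b" "?E d c" "?E a d" using that cubic_edge_commute by blast+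
      with that SI[of a b d c] SI[of b a c d] SI[of c b d a] SI[of d a c b] show ?thesis by simp
    qed
    have "\<not> S u" if "u \<in> {0, 3, 6, 7}"
      using that by (auto simp: S_def nbrs)
    moreover have "S u" if "u \<in> {1, 2, 4, 5}"
    proof -
      have "?E 1 2" "?E 2 5" "?E 5 4" "?E 4 1" by (simp_all add: nbrs del: One_nat_def)
      from square[OF this] that show ?thesis by auto
    qed
    moreover have "S u" if "8 \<le> u"
    proof -
      \<comment> \<open>In the unswitched part a chord closes three consecutive path edges to a
        square, and each vertex from 8 on lies on such a square; the last one, at
        \<open>b = k + 10\<close>, takes care of \<open>k + 12\<close> and
        \<open>k + 13\<close>.\<close>
      have sq: "S b \<and> S (b + 1) \<and> S (b + 2) \<and> S (b + 3)" if "8 \<le> b" "b < k + 11" "even b" for b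
      proof -
        have "?E b (b + 1)" "?E (b + 1) (b + 2)" "?E (b + 2) (b + 3)" "?E (b + 3) b"
          using that k cubic_path_edge[of b k] cubic_path_edge[of "b + 1" k] cubic_path_edge[of "b + 2" k]
            cubic_chord[of b k] cubic_edge_commute[of k b "b + 3"] by (auto simp: numeral_eq_Suc)
        from square[OF this] show ?thesis by simp
      qed
      have "S (k + 10 + 2) \<and> S (k + 10 + 3)" using sq[of "k + 10"] k by simp
      then have last: "S (k + 12)" "S (k + 13)" by (simp_all add: add.commute)
      have "u < k + 11 \<and> even u \<or> u = k + 12 \<or> u = k + 13 \<or> odd u \<and> u < k + 12"
        using u k by presburger
      then consider "u < k + 11" "even u" | "u = k + 12" | "u = k + 13" | "odd u" "u < k + 12" by blast
      then show ?thesis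
      proof cases
        case 4
        then obtain b where b: "u = 2 * b + 1" by (elim oddE)
        with 4 that sq[of "2 * b"] show ?thesis by simp
      qed (use sq[of u] that last in simp_all)
    qed
    moreover have "u = 0 \<or> u = 1 \<or> u = 2 \<or> u = 3 \<or> u = 4 \<or> u = 5 \<or> u = 6 \<or> u = 7 \<or> 8 \<le> u"
      by arith
    ultimately show ?thesis by (elim disjE) simp_all
  qed
  have core: "f u \<in> {0, 3, 6, 7}" if "u \<in> {0, 3, 6, 7}" for u
  proof -
    have "f u \<notin> {v. v < k + 14 \<and> S v}"
      by (rule inj_invariant_compl[of ?V])
        (use fV inj S_f S_iff that in auto)
    moreover have "f u < k + 14" using fV that by auto
    ultimately show ?thesis using S_iff by auto
  qed
  let ?I = "{(0, 3), (3, 0), (0, 6), (6, 0), (3, 7), (7, 3 :: nat)}"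
  have induced: "(u, v) \<in> ?I" if "?E u v" "u \<in> {0, 3, 6, 7}" "v \<in> {0, 3, 6, 7}" for u v
    using that(2,1,3) by (elim insertE emptyE) (auto simp: nbrs)
  \<comment> \<open>The path 6-0-3-7 has only the identity and its reversal as
    automorphisms.\<close>
  have rev: "a = 0 \<and> b = 3 \<and> c = 6 \<and> d = 7 \<or> a = 3 \<and> b = 0 \<and> c = 7 \<and> d = 6"
    if "(a, b) \<in> ?I" "(a, c) \<in> ?I" "(b, d) \<in> ?I" "b \<noteq> c" "a \<noteq> d" for a b c d :: nat
    using that by auto
  have "(f 0, f 3) \<in> ?I" by (rule induced[OF hom core core]) (simp_all add: nbrs)
  moreover have "(f 0, f 6) \<in> ?I" by (rule induced[OF hom core core]) (simp_all add: nbrs)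
  moreover have "(f 3, f 7) \<in> ?I" by (rule induced[OF hom core core]) (simp_all add: nbrs)
  moreover have "f 3 \<noteq> f 6" "f 0 \<noteq> f 7" using eq by simp_all
  ultimately have "f 0 = 0 \<and> f 3 = 3 \<and> f 6 = 6 \<and> f 7 = 7 \<or> f 0 = 3 \<and> f 3 = 0 \<and> f 6 = 7 \<and> f 7 = 6"
    by (rule rev)
  \<comment> \<open>Under the reversal 2 would go to the remaining neighbour \<open>k + 13\<close>
    of 0, which is adjacent to neither 4 nor 8, the possible images of 5.\<close>
  moreover have False if "f 0 = 3" "f 3 = 0" "f 6 = 7" "f 7 = 6"
  proof -
    have "f 2 = k + 13"
      using hom[of 2 3] that eq[of 2 0] eq[of 2 7] by (auto simp: nbrs cubic_edge_commute[of k "f 2"])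
    moreover have "f 5 = 4 \<or> f 5 = 8"
      using hom[of 5 6] that eq[of 5 0] by (auto simp: nbrs cubic_edge_commute[of k "f 5"])
    ultimately show False using hom[of 2 5] by (auto simp: nbrs)
  qed
  ultimately have f0: "f 0 = 0" "f 3 = 3" "f 6 = 6" "f 7 = 7" by blast+
  \<comment> \<open>From here on, each vertex is forced as the only admissible neighbour of vertices
    already known to be fixed.\<close>
  have f2: "f 2 = 2" using hom[of 3 2] f0 eq[of 2 0] eq[of 2 7] by (auto simp: nbrs)
  have f5: "f 5 = 5" using hom[of 6 5] hom[of 2 5] f0 f2 by (auto simp: nbrs)
  have f9: "f 9 = 9" using hom[of 6 9] f0 f5 eq[of 9 0] eq[of 9 5] by (auto simp: nbrs)
  have f4: "f 4 = 4" using hom[of 7 4] hom[of 5 4] f0 f5 by (auto simp: nbrs)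
  have f8: "f 8 = 8" using hom[of 7 8] f0 f4 eq[of 8 3] eq[of 8 4] by (auto simp: nbrs)
  have f1: "f 1 = 1" using hom[of 2 1] f0 f2 f5 eq[of 1 3] eq[of 1 5] by (auto simp: nbrs)
  have f11: "f 11 = 11" using hom[of 8 11] f0 f8 f9 eq[of 11 7] eq[of 11 9] by (auto simp: nbrs)
  have f10: "f 10 = 10" using hom[of 9 10] f0 f8 f9 eq[of 10 6] eq[of 10 8] by (auto simp: nbrs)
  \<comment> \<open>An even vertex is reached from its predecessor, an odd one by the chord from
    three below; in either case the other two neighbours of that vertex are smaller and already
    fixed. The predecessor of an odd vertex would not do, because its own chord leads further
    up.\<close>
  have high: "f m = m" if "8 \<le> m" "m < k + 14" for m
    using that
  proof (induction m rule: less_induct)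
    case (less m)
    consider "m = 8" | "m = 9" | "m = 10" | "m = 11" | l where "m = l + 12" "even l" | l where "m = l + 12" "odd l"
      using less.prems(1) le_Suc_ex[of 12 m] by force
    then show ?case
    proof cases
      case 5
      have "?E (l + 11) (l + 12)" using 5 less.prems cubic_path_edge[of "l + 11" k] by (simp add: numeral_eq_Suc)
      then have "?E (l + 11) (f m)" using hom less.IH[of "l + 11"] 5 less.prems by force
      moreover have "l + 11 < k + 12" using 5 less.prems k by presburger
      ultimately have "f m = l + 10 \<or> f m = l + 12 \<or> f m = l + 8"
        using cubic_nbrs_middle[OF k, of "l + 11" "f m"] 5 by auto
      then show ?thesis
        using less.IH[of "l + 10"] less.IH[of "l + 8"] eq[of m "l + 10"] eq[of m "l + 8"] 5 less.prems by auto
    next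
      case 6
      have "l + 9 < k + 11" using 6 less.prems by simp
      then have "?E (l + 9) (l + 12)" using 6 cubic_chord[of "l + 9" k] by (simp add: add.commute)
      then have "?E (l + 9) (f m)" using hom less.IH[of "l + 9"] 6 less.prems by force
      moreover have "1 \<le> l" using 6 by (cases l) auto
      ultimately have "f m = l + 8 \<or> f m = l + 10 \<or> f m = l + 12"
        using cubic_nbrs_middle[OF k, of "l + 9" "f m"] 6 less.prems by auto
      then show ?thesis
        using less.IH[of "l + 10"] less.IH[of "l + 8"] eq[of m "l + 10"] eq[of m "l + 8"] 6 less.prems by auto
    qed (use f8 f9 f10 f11 in simp_all)
  qed
  show "\<forall>v\<in>?V. f v = v"
  proof
    fix v assume "v \<in> ?V"
    then have "v < k + 14" by simp
    then show "f v = v"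
      using high f0 f1 f2 f4 f5 by (cases "8 \<le> v") (auto simp: not_le less_Suc_eq numeral_eq_Suc)
  qed
qed

text \<open>With \<open>d + 4\<close> vertices the complement is cubic, and
  \<open>k + 14 - 1 - 3 = k + 10\<close> dictates \<open>k = d - 10\<close>.\<close>

lemma order_even_degree:
  assumes "even d" "10 \<le> d"
  shows "d + 4 \<in> rigid_regular_orders d"
proof -
  define k where "k = d - 10"
  have k: "even k" "d = k + 10" using assms by (auto simp: k_def)
  interpret ugraph "{..<k + 14}" "cubic_edge k" by (rule cubic_ugraph)
  have "rigid_on {..<k + 14} (compl_on {..<k + 14} (cubic_edge k))"
    by (rule rigid_compl[OF cubic_regular cubic_triangle_free cubic_connected cubic_non_bipartite cubic_asymmetric])
      (use k(1) in auto)
  moreover have "regular_on {..<k + 14} (compl_on {..<k + 14} (cubic_edge k)) d"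
    using regular_compl[OF cubic_regular[OF k(1)]] by (simp add: k(2) add.commute)
  ultimately have "card {..<k + 14} \<in> rigid_regular_orders d"
    using ugraph_compl by (intro card_in_ordersI) (auto simp: lessThan_empty_iff)
  moreover have "d + 4 = card {..<k + 14}" using k(2) by simp
  ultimately show ?thesis by (simp only:)
qed
section \<open>A family of quartic graphs\<close>

text \<open>
  This is the circulant graph on \<open>k + 14\<close> vertices with steps 1 and 3 in which the edges
  12, 47, 58, 69 are replaced by 16, 27, 48, 59.
\<close>

definition quartic_arc :: "nat \<Rightarrow> nat \<Rightarrow> nat \<Rightarrow> bool" where
  "quartic_arc k u v \<longleftrightarrow>
     (u, v) \<in> {(0, 1), (0, 3), (0, k + 11), (0, k + 13), (1, 4), (1, 6), (1, k + 12), (2, 3), (2, 5),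
       (2, 7), (2, k + 13), (3, 4), (3, 6), (4, 5), (4, 8), (5, 6), (5, 9), (6, 7), (7, 8), (7, 10)} \<or>
     8 \<le> u \<and> v < k + 14 \<and> (v = u + 1 \<or> v = u + 3)"

definition quartic_edge :: "nat \<Rightarrow> nat \<Rightarrow> nat \<Rightarrow> bool" where
  "quartic_edge k u v \<longleftrightarrow> quartic_arc k u v \<or> quartic_arc k v u"

section \<open>Neighbourhoods, parity and connectivity in the quartic family\<close>

lemma quartic_nbrs_low:
  "quartic_edge k 0 v \<longleftrightarrow> v = 1 \<or> v = 3 \<or> v = k + 11 \<or> v = k + 13"
  "quartic_edge k 1 v \<longleftrightarrow> v = 0 \<or> v = 4 \<or> v = 6 \<or> v = k + 12"
  "quartic_edge k 2 v \<longleftrightarrow> v = 3 \<or> v = 5 \<or> v = 7 \<or> v = k + 13"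
  "quartic_edge k 3 v \<longleftrightarrow> v = 0 \<or> v = 2 \<or> v = 4 \<or> v = 6"
  "quartic_edge k 4 v \<longleftrightarrow> v = 1 \<or> v = 3 \<or> v = 5 \<or> v = 8"
  "quartic_edge k 5 v \<longleftrightarrow> v = 2 \<or> v = 4 \<or> v = 6 \<or> v = 9"
  "quartic_edge k 6 v \<longleftrightarrow> v = 1 \<or> v = 3 \<or> v = 5 \<or> v = 7"
  "quartic_edge k 7 v \<longleftrightarrow> v = 2 \<or> v = 6 \<or> v = 8 \<or> v = 10"
  "quartic_edge k 8 v \<longleftrightarrow> v = 4 \<or> v = 7 \<or> v = 9 \<or> v = 11"
  "quartic_edge k 9 v \<longleftrightarrow> v = 5 \<or> v = 8 \<or> v = 10 \<or> v = 12"
  "quartic_edge k 10 v \<longleftrightarrow> v = 7 \<or> v = 9 \<or> v = 11 \<or> v = 13"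
  by (auto simp: quartic_edge_def quartic_arc_def)

lemma quartic_nbrs_high:
  "quartic_edge k (k + 11) v \<longleftrightarrow> v = 0 \<or> v = k + 8 \<or> v = k + 10 \<or> v = k + 12"
  "quartic_edge k (k + 12) v \<longleftrightarrow> v = 1 \<or> v = k + 9 \<or> v = k + 11 \<or> v = k + 13"
  "quartic_edge k (k + 13) v \<longleftrightarrow> v = 0 \<or> v = 2 \<or> v = k + 10 \<or> v = k + 12"
  by (auto simp: quartic_edge_def quartic_arc_def)

lemma quartic_nbrs_middle:
  assumes "11 \<le> u" "u < k + 11"
  shows "quartic_edge k u v \<longleftrightarrow> u = v + 1 \<or> v = u + 1 \<or> u = v + 3 \<or> v = u + 3"
  using assms by (auto simp: quartic_edge_def quartic_arc_def)

lemma quartic_path_edge: "8 \<le> u \<Longrightarrow> u < k + 13 \<Longrightarrow> quartic_edge k u (u + 1)"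
  by (simp add: quartic_edge_def quartic_arc_def)

lemma quartic_chord: "8 \<le> u \<Longrightarrow> u < k + 11 \<Longrightarrow> quartic_edge k u (u + 3)"
  by (simp add: quartic_edge_def quartic_arc_def)

lemma quartic_edge_commute: "quartic_edge k u v \<longleftrightarrow> quartic_edge k v u"
  by (auto simp: quartic_edge_def)

lemma quartic_ugraph: "ugraph {..<k + 14} (quartic_edge k)"
  by unfold_locales (auto simp: quartic_edge_def quartic_arc_def)

lemma quartic_vertex_cases:
  fixes u k :: nat
  assumes "u < k + 14"
  obtains "u = 0" | "u = 1" | "u = 2" | "u = 3" | "u = 4" | "u = 5" | "u = 6" | "u = 7" | "u = 8" | "u = 9" | "u = 10"
    | "11 \<le> u" "u < k + 11" | "u = k + 11" | "u = k + 12" | "u = k + 13"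
proof -
  have "u = 0 \<or> u = 1 \<or> u = 2 \<or> u = 3 \<or> u = 4 \<or> u = 5 \<or> u = 6 \<or> u = 7 \<or> u = 8 \<or> u = 9 \<or> u = 10 \<or>
    11 \<le> u \<and> u < k + 11 \<or> u = k + 11 \<or> u = k + 12 \<or> u = k + 13"
    using assms by arith
  then show thesis by (elim disjE conjE) (rule that; assumption)+
qed

lemma card_four:
  assumes "\<And>w. P w \<longleftrightarrow> w = a \<or> w = b \<or> w = c \<or> w = d"
    and "a \<noteq> b" "a \<noteq> c" "a \<noteq> d" "b \<noteq> c" "b \<noteq> d" "c \<noteq> d"
  shows "card {w. P w} = 4"
proof -
  have "{w. P w} = {a, b, c, d}" using assms(1) by auto
  with assms(2-) show ?thesis by simp
qed

lemma quartic_regular: "regular_on {..<k + 14} (quartic_edge k) 4"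
  unfolding regular_on_def
proof
  fix u assume "u \<in> {..<k + 14}"
  then have "u < k + 14" by simp
  then show "card {w. quartic_edge k u w} = 4"
  proof (cases rule: quartic_vertex_cases)
    case 12
    show ?thesis
    proof (rule card_four)
      show "quartic_edge k u w \<longleftrightarrow> w = u - 1 \<or> w = u + 1 \<or> w = u - 3 \<or> w = u + 3" for w
        using quartic_nbrs_middle[OF 12, of w] 12 by auto
    qed (use 12 in auto)
  qed (auto intro!: card_four simp: quartic_nbrs_low quartic_nbrs_high simp del: One_nat_def)
qed

text \<open>The steps 1 and 3 are odd, so the circulant of even order is bipartite by parity; of the
  new edges, 16 and 27 respect parity while 48 and 59 do not.\<close>

lemma quartic_same_parity:
  assumes "even k" "quartic_edge k u v" "even u = even v"
  shows "(u, v) \<in> {(4, 8), (8, 4), (5, 9), (9, 5)}"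
proof -
  have arc: "(u, v) \<in> {(4, 8), (5, 9)}" if "quartic_arc k u v" "even u = even v" for u v
    using that(1) unfolding quartic_arc_def
    by (elim disjE conjE insertE emptyE) (use that(2) assms(1) in simp_all)
  from assms(2) show ?thesis
    using arc[of u v] arc[of v u] assms(3) unfolding quartic_edge_def by auto
qed

lemma quartic_triangle_free:
  assumes "even k" "quartic_edge k u v" "quartic_edge k v w"
  shows "\<not> quartic_edge k u w"
proof
  assume uw: "quartic_edge k u w"
  have no: False if "quartic_edge k a b" "even a = even b" "quartic_edge k a c" "quartic_edge k b c" for a b c
    using quartic_same_parity[OF assms(1) that(1,2)] that(3,4) by (auto simp: quartic_nbrs_low)
  consider "even u = even v" | "even v = even w" | "even u = even w" by blast
  then show False
    using no[of u v w] no[of v w u] no[of u w v] assms uw quartic_edge_commute by cases metis+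
qed

lemma quartic_connected:
  assumes "S \<noteq> {}" "S \<subseteq> {..<k + 14}" and closed: "\<And>u v. \<lbrakk>u \<in> S; quartic_edge k u v\<rbrakk> \<Longrightarrow> v \<in> S"
  shows "S = {..<k + 14}"
proof (rule connected_by_path[where a = 8 and E = "quartic_edge k", OF assms])
  have "7 \<in> S \<longleftrightarrow> 8 \<in> S" "6 \<in> S \<longleftrightarrow> 7 \<in> S" "5 \<in> S \<longleftrightarrow> 6 \<in> S" "4 \<in> S \<longleftrightarrow> 5 \<in> S" "3 \<in> S \<longleftrightarrow> 4 \<in> S"
    "2 \<in> S \<longleftrightarrow> 3 \<in> S" "1 \<in> S \<longleftrightarrow> 4 \<in> S" "0 \<in> S \<longleftrightarrow> 1 \<in> S"
    by (meson closed quartic_nbrs_low)+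
  moreover have "u \<in> {0, 1, 2, 3, 4, 5, 6, 7}" if "u < 8" for u :: nat using that by auto
  ultimately show "u \<in> S \<longleftrightarrow> 8 \<in> S" if "u < 8" for u using that by blast
qed (use quartic_path_edge quartic_edge_commute in auto)

lemma quartic_non_bipartite: "\<exists>u v. quartic_edge k u v \<and> c u = (c v :: bool)"
proof -
  have "quartic_edge k 2 5" "quartic_edge k 5 9" "quartic_edge k 9 8" "quartic_edge k 8 7" "quartic_edge k 7 2"
    by (simp_all add: quartic_nbrs_low)
  then show ?thesis by metis
qed

text \<open>In the circulant, \<open>u\<close> and \<open>u + 2\<close> have the common neighbours
  \<open>u - 1\<close>, \<open>u + 1\<close> and \<open>u + 3\<close>. Such pairs are preserved by
  injective endomorphisms, and the switching leaves only the vertex 7 without a partner.\<close>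

definition quartic_partner :: "nat \<Rightarrow> nat \<Rightarrow> nat \<Rightarrow> bool" where
  "quartic_partner k u w \<longleftrightarrow> u \<noteq> w \<and> (\<exists>a b c. a \<noteq> b \<and> a \<noteq> c \<and> b \<noteq> c \<and>
     quartic_edge k u a \<and> quartic_edge k u b \<and> quartic_edge k u c \<and>
     quartic_edge k a w \<and> quartic_edge k b w \<and> quartic_edge k c w)"

lemma quartic_partnerI:
  assumes "quartic_edge k u a" "quartic_edge k u b" "quartic_edge k u c"
    and "quartic_edge k a w" "quartic_edge k b w" "quartic_edge k c w"
    and "a \<noteq> b" "a \<noteq> c" "b \<noteq> c" "u \<noteq> w"
  shows "quartic_partner k u w"
  using assms unfolding quartic_partner_def by blast

text \<open>For \<open>k = 0\<close> the chord leading up from 11 wraps around to 0.\<close>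

lemma quartic_nbrs_11: "quartic_edge k 11 v \<longleftrightarrow> v = 8 \<or> v = 10 \<or> v = 12 \<or> v = (if k = 0 then 0 else 14)"
  by (auto simp: quartic_edge_def quartic_arc_def)

lemma no_quartic_partner_7: "\<not> quartic_partner k 7 w"
  by (auto simp: quartic_partner_def quartic_nbrs_low)

text \<open>The only possible partners of 2 and of 8 are neighbours of 7, whereas 6 and 10 have the
  partners 4 and 12, which are not. This tells 2 and 8 from 6 and 10 among the neighbours of
  7.\<close>

lemma quartic_partner_2: "quartic_partner k 2 w \<Longrightarrow> w = 6"
  by (auto simp: quartic_partner_def quartic_nbrs_low quartic_nbrs_high)

lemma quartic_partner_8: "quartic_partner k 8 w \<Longrightarrow> w = 10"
  by (auto simp: quartic_partner_def quartic_nbrs_low quartic_nbrs_11 split: if_splits)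

lemma quartic_partners:
  "quartic_partner k 2 6" "quartic_partner k 6 4" "quartic_partner k 10 12"
proof -
  show "quartic_partner k 2 6" by (rule quartic_partnerI[of _ _ 3 5 7]) (simp_all add: quartic_nbrs_low del: One_nat_def)
  show "quartic_partner k 6 4" by (rule quartic_partnerI[of _ _ 1 3 5]) (simp_all add: quartic_nbrs_low del: One_nat_def)
  have "quartic_edge k 13 12" using quartic_path_edge[of 12 k] by (simp add: quartic_edge_commute)
  then show "quartic_partner k 10 12"
    by (intro quartic_partnerI[of _ _ 9 11 13]) (simp_all add: quartic_nbrs_low quartic_nbrs_11 del: One_nat_def)
qed

lemma quartic_partner_exists:
  assumes u: "u < k + 14" "u \<noteq> 7"
  shows "\<exists>w. quartic_partner k u w"
proof -
  note nbrs = quartic_nbrs_low quartic_nbrs_high quartic_nbrs_11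
  consider "u = 0" | "u = 1" | "u = 2" | "u = 3" | "u = 4" | "u = 5" | "u = 6" | "u = 8" | "u = 9" | "u = 10"
    | l where "u = l + 11" "l < k + 2" | "u = k + 13"
  proof -
    have "u = 0 \<or> u = 1 \<or> u = 2 \<or> u = 3 \<or> u = 4 \<or> u = 5 \<or> u = 6 \<or> u = 8 \<or> u = 9 \<or> u = 10 \<or>
      u = (u - 11) + 11 \<and> u - 11 < k + 2 \<or> u = k + 13"
      using u by arith
    then show thesis by (elim disjE conjE) (rule that; assumption)+
  qed
  then show ?thesis
  proof cases
    case 1
    have "quartic_partner k 0 (k + 12)"
      by (rule quartic_partnerI[of _ _ 1 "k + 11" "k + 13"]) (simp_all add: nbrs del: One_nat_def)
    with 1 show ?thesis by blast
  next
    case 2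
    have "quartic_partner k 1 3"
      by (rule quartic_partnerI[of _ _ 0 4 6]) (simp_all add: nbrs del: One_nat_def)
    with 2 show ?thesis by blast
  next
    case 4
    have "quartic_partner k 3 1"
      by (rule quartic_partnerI[of _ _ 0 4 6]) (simp_all add: nbrs del: One_nat_def)
    with 4 show ?thesis by blast
  next
    case 5
    have "quartic_partner k 4 6"
      by (rule quartic_partnerI[of _ _ 1 3 5]) (simp_all add: nbrs del: One_nat_def)
    with 5 show ?thesis by blast
  next
    case 6
    have "quartic_partner k 5 3"
      by (rule quartic_partnerI[of _ _ 2 4 6]) (simp_all add: nbrs del: One_nat_def)
    with 6 show ?thesis by blast
  next
    case 8
    have "quartic_partner k 8 10"
      by (rule quartic_partnerI[of _ _ 7 9 11]) (simp_all add: nbrs del: One_nat_def)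
    with 8 show ?thesis by blast
  next
    case 9
    have "quartic_edge k 12 11" using quartic_path_edge[of 11 k] by (simp add: quartic_edge_commute)
    then have "quartic_partner k 9 11"
      by (intro quartic_partnerI[of _ _ 8 10 12]) (simp_all add: nbrs del: One_nat_def)
    with 9 show ?thesis by blast
  next
    case 11
    \<comment> \<open>Away from the switched edges, \<open>u\<close> and \<open>u - 2\<close> are
      partners as in the circulant.\<close>
    have "quartic_partner k (l + 11) (l + 9)"
    proof (rule quartic_partnerI[of _ _ "l + 8" "l + 10" "l + 12"])
      show "quartic_edge k (l + 11) (l + 8)" "quartic_edge k (l + 12) (l + 9)"
        using quartic_chord[of "l + 8" k] quartic_chord[of "l + 9" k] 11
        by (simp_all add: quartic_edge_commute add.commute)
      show "quartic_edge k (l + 11) (l + 10)" "quartic_edge k (l + 11) (l + 12)" "quartic_edge k (l + 8) (l + 9)"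
        "quartic_edge k (l + 10) (l + 9)"
        using quartic_path_edge[of "l + 10" k] quartic_path_edge[of "l + 11" k] quartic_path_edge[of "l + 8" k]
          quartic_path_edge[of "l + 9" k] 11
        by (simp_all add: quartic_edge_commute add.commute)
    qed simp_all
    with 11 show ?thesis by blast
  next
    case 12
    have "quartic_edge k (k + 10) (k + 11)" "quartic_edge k (k + 12) (k + 11)"
      using quartic_path_edge[of "k + 10" k] quartic_path_edge[of "k + 11" k]
      by (simp_all add: quartic_edge_commute add.commute)
    then have "quartic_partner k (k + 13) (k + 11)"
      by (intro quartic_partnerI[of _ _ 0 "k + 10" "k + 12"]) (simp_all add: nbrs del: One_nat_def)
    with 12 show ?thesis by blast
  next
    case 10
    have "quartic_partner k 10 12" by (rule quartic_partners)
    with 10 show ?thesis by blast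
  qed (use quartic_partners in blast)+
qed

text \<open>
  The vertex 7 is fixed by automorphisms, being the only one that shares three neighbours with no other
  vertex. Its neighbours 2 and 8 might be interchanged, as might 6 and 10, but then the neighbours 3 and 5 of both
  2 and 6 would go to 9 and 11, and unlike 3 and 5 these have no common neighbour that is adjacent to 2.
\<close>

lemma quartic_asymmetric:
  assumes k: "even k"
  shows "asymmetric_on {..<k + 14} (quartic_edge k)"
  unfolding asymmetric_on_def
proof (intro allI impI)
  let ?V = "{..<k + 14}" and ?E = "quartic_edge k" and ?P = "quartic_partner k"
  fix f assume "endo_on ?V ?E f \<and> inj_on f ?V"
  then have f: "endo_on ?V ?E f" and inj: "inj_on f ?V" by auto
  note nbrs = quartic_nbrs_low quartic_nbrs_high
  have hom: "?E (f u) (f v)" if "?E u v" for u v using f that by (simp add: endo_on_def)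
  have fV: "f u < k + 14" if "u < k + 14" for u
    using f that by (auto simp: endo_on_def image_subset_iff)
  have eq: "f u = f v \<longleftrightarrow> u = v" if "u < k + 14" "v < k + 14" for u v
    using inj that by (simp add: inj_on_eq_iff)
  have reflect: "?E u v" if "u < k + 14" "v < k + 14" "?E (f u) (f v)" for u v
    using ugraph.inj_endo_reflects[OF quartic_ugraph f inj] that by simp
  have P_f: "?P (f u) (f w)" if "?P u w" for u w
  proof -
    from that obtain a b c where *: "u \<noteq> w" "a \<noteq> b" "a \<noteq> c" "b \<noteq> c" "?E u a" "?E u b" "?E u c"
      "?E a w" "?E b w" "?E c w"
      by (auto simp: quartic_partner_def)
    then have "{u, w, a, b, c} \<subseteq> ?V" using ugraph.E_in[OF quartic_ugraph] by blast
    with * have "f u \<noteq> f w" "f a \<noteq> f b" "f a \<noteq> f c" "f b \<noteq> f c" using eq by auto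
    with * hom show ?thesis by (intro quartic_partnerI[of k _ "f a" "f b" "f c"]) auto
  qed
  have f7: "f 7 = 7"
  proof -
    have "f 7 \<notin> {u. u < k + 14 \<and> (\<exists>w. ?P u w)}"
      by (rule inj_invariant_compl[of ?V])
        (use fV inj P_f no_quartic_partner_7 in auto)
    moreover have "f 7 < k + 14" using fV by simp
    ultimately show ?thesis using quartic_partner_exists by blast
  qed
  have N7: "f u \<in> {2, 6, 8, 10}" if "u \<in> {2, 6, 8, 10}" for u
  proof -
    have "?E 7 u" using that by (auto simp: nbrs)
    from hom[OF this] f7 show ?thesis by (simp add: nbrs)
  qed
  have not_N7: "\<not> ?E 7 (f u)" if "u \<in> {4, 12}" for u
    using reflect[of 7 u] that f7 by (auto simp: nbrs)
  \<comment> \<open>If 6 went to 2 or 8, its partner 4 would go to 6 or 10, hence to a neighbour of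
    7, although 4 is not one.\<close>
  have f6: "f 6 = 6 \<or> f 6 = 10"
    using N7[of 6] P_f[OF quartic_partners(2)] not_N7[of 4] quartic_partner_2[of k "f 4"] quartic_partner_8[of k "f 4"]
    by (auto simp: nbrs)
  have f10: "f 10 = 6 \<or> f 10 = 10"
    using N7[of 10] P_f[OF quartic_partners(3)] not_N7[of 12] quartic_partner_2[of k "f 12"] quartic_partner_8[of k "f 12"]
    by (auto simp: nbrs)
  have P26: "f 2 = 2 \<longrightarrow> f 6 = 6" "f 2 = 8 \<longrightarrow> f 6 = 10"
    using P_f[OF quartic_partners(1)] quartic_partner_2[of k "f 6"] quartic_partner_8[of k "f 6"] by auto
  have finish: "a = 2 \<and> b = 6 \<and> c = 8 \<and> d = 10 \<or> a = 8 \<and> b = 10 \<and> c = 2 \<and> d = 6"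
    if "b = 6 \<or> b = 10" "d = 6 \<or> d = 10" "a \<in> {2, 6, 8, 10}" "c \<in> {2, 6, 8, 10}"
      "a = 2 \<longrightarrow> b = 6" "a = 8 \<longrightarrow> b = 10" "distinct [a, b, c, d]" for a b c d :: nat
    using that by (elim disjE insertE emptyE) simp_all
  have "distinct [f 2, f 6, f 8, f 10]" using eq by simp
  then have f28: "f 2 = 2 \<and> f 6 = 6 \<and> f 8 = 8 \<and> f 10 = 10 \<or> f 2 = 8 \<and> f 6 = 10 \<and> f 8 = 2 \<and> f 10 = 6"
    by (intro finish[OF f6 f10 N7 N7 P26]) simp_all
  have False if g: "f 2 = 8" "f 6 = 10" "f 8 = 2" "f 10 = 6"
  proof -
    have "f 3 = 9 \<or> f 3 = 11" "f 5 = 9 \<or> f 5 = 11"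
      using hom[of 2 3] hom[of 6 3] hom[of 2 5] hom[of 6 5] g f7 eq[of 3 7] eq[of 5 7] by (auto simp: nbrs)
    moreover have "f 3 \<noteq> f 5" using eq[of 3 5] by simp
    ultimately have "?E (f 4) 9" "?E (f 4) 11" using hom[of 4 3] hom[of 4 5] by (auto simp: nbrs)
    then have "?E 9 (f 4)" "?E 11 (f 4)" using quartic_edge_commute by blast+
    then show False
      using hom[of 8 4] g f7 eq[of 4 7] k by (auto simp: nbrs quartic_nbrs_11 split: if_splits)
  qed
  then have g: "f 2 = 2" "f 6 = 6" "f 8 = 8" "f 10 = 10" using f28 by blast+
  \<comment> \<open>The pair 3, 5 is mapped to itself, being the common neighbours of 2 and 6 other
    than 7, and likewise the pair 9, 11 for 8 and 10. Since 59 is the only edge between the pairs,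
    all four vertices are fixed.\<close>
  have f35: "f 3 = 3 \<or> f 3 = 5" "f 5 = 3 \<or> f 5 = 5"
    using hom[of 2 3] hom[of 6 3] hom[of 2 5] hom[of 6 5] g f7 eq[of 3 7] eq[of 5 7] by (auto simp: nbrs)
  have f911: "f 9 = 9 \<or> f 9 = 11" "f 11 = 9 \<or> f 11 = 11"
    using hom[of 8 9] hom[of 10 9] hom[of 8 11] hom[of 10 11] g f7 eq[of 9 7] eq[of 11 7] by (auto simp: nbrs)
  have f5: "f 5 = 5" using f35 f911 hom[of 5 9] by (auto simp: nbrs)
  have f3: "f 3 = 3" using f35 f5 eq[of 3 5] by auto
  have f9: "f 9 = 9" using f911 f5 hom[of 5 9] by (auto simp: nbrs)
  have f11: "f 11 = 11" using f911 f9 eq[of 11 9] by auto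
  have f4: "f 4 = 4" using hom[of 8 4] g f7 f9 f11 eq[of 4 7] eq[of 4 9] eq[of 4 11] by (auto simp: nbrs)
  have f1: "f 1 = 1" using hom[of 6 1] g f3 f5 f7 eq[of 1 3] eq[of 1 5] eq[of 1 7] by (auto simp: nbrs)
  have f0: "f 0 = 0" using hom[of 3 0] g f3 f4 eq[of 0 2] eq[of 0 4] eq[of 0 6] by (auto simp: nbrs)
  have f12: "f 12 = 12" using hom[of 9 12] g f5 f9 eq[of 12 5] eq[of 12 8] eq[of 12 10] by (auto simp: nbrs)
  have f13: "f 13 = 13" using hom[of 10 13] g f7 f9 f11 eq[of 13 7] eq[of 13 9] eq[of 13 11] by (auto simp: nbrs)
  \<comment> \<open>The neighbour \<open>m - 3\<close> of \<open>m\<close> has its other neighbours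
    \<open>m - 6\<close>, \<open>m - 4\<close> and \<open>m - 2\<close> below \<open>m\<close>. The
    base reaches up to 13 because \<open>m - 3\<close> must be at least 11 to have this regular
    neighbourhood.\<close>
  have high: "f m = m" if "8 \<le> m" "m < k + 14" for m
    using that
  proof (induction m rule: less_induct)
    case (less m)
    consider "m = 8" | "m = 9" | "m = 10" | "m = 11" | "m = 12" | "m = 13" | l where "m = l + 14"
      using less.prems(1) le_Suc_ex[of 14 m] by force
    then show ?case
    proof cases
      case 7
      have "?E (l + 11) (l + 14)" using 7 less.prems quartic_chord[of "l + 11" k] by (simp add: numeral_eq_Suc)
      then have "?E (l + 11) (f m)" using hom less.IH[of "l + 11"] 7 less.prems by force
      then have "f m = l + 8 \<or> f m = l + 10 \<or> f m = l + 12 \<or> f m = l + 14"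
        using quartic_nbrs_middle[of "l + 11" k "f m"] 7 less.prems by auto
      then show ?thesis
        using less.IH[of "l + 8"] less.IH[of "l + 10"] less.IH[of "l + 12"]
          eq[of m "l + 8"] eq[of m "l + 10"] eq[of m "l + 12"] 7 less.prems by auto
    qed (use g f9 f11 f12 f13 in simp_all)
  qed
  show "\<forall>v\<in>?V. f v = v"
  proof
    fix v assume "v \<in> ?V"
    then have "v < k + 14" by simp
    then show "f v = v"
      using high g f0 f1 f3 f4 f5 f7 by (cases "8 \<le> v") (auto simp: not_le less_Suc_eq numeral_eq_Suc)
  qed
qed

text \<open>For odd \<open>d\<close> parity excludes \<open>d + 4\<close>; with \<open>d + 5\<close>
  vertices the complement is quartic, and \<open>k + 14 - 1 - 4 = k + 9\<close> dictates
  \<open>k = d - 9\<close>.\<close>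

lemma order_odd_degree:
  assumes "odd d" "9 \<le> d"
  shows "d + 5 \<in> rigid_regular_orders d"
proof -
  define k where "k = d - 9"
  have k: "even k" "d = k + 9" using assms by (auto simp: k_def)
  interpret ugraph "{..<k + 14}" "quartic_edge k" by (rule quartic_ugraph)
  have "rigid_on {..<k + 14} (compl_on {..<k + 14} (quartic_edge k))"
    by (rule rigid_compl[OF quartic_regular quartic_triangle_free quartic_connected quartic_non_bipartite quartic_asymmetric])
      (use k(1) in auto)
  moreover have "regular_on {..<k + 14} (compl_on {..<k + 14} (quartic_edge k)) d"
    using regular_compl[OF quartic_regular[of k]] by (simp add: k(2) add.commute)
  ultimately have "card {..<k + 14} \<in> rigid_regular_orders d"
    using ugraph_compl by (intro card_in_ordersI) (auto simp: lessThan_empty_iff)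
  moreover have "d + 5 = card {..<k + 14}" using k(2) by simp
  ultimately show ?thesis by (simp only:)
qed
section \<open>Evaluation of the checkers\<close>

text \<open>
  Simplifying \<open>tabulated_nth\<close> for a given list yields one rewrite rule per entry, so that the list itself
  does not occur in the terms to be evaluated.
\<close>

primrec tabulated :: "(nat \<Rightarrow> 'a) \<Rightarrow> 'a list \<Rightarrow> nat \<Rightarrow> bool" where
  "tabulated f [] i = True"
| "tabulated f (x # xs) i = (f i = x \<and> tabulated f xs (Suc i))"

lemma tabulated_nth: "tabulated ((!) xs) xs 0"
proof -
  have "tabulated f ys i" if "\<And>j. j < length ys \<Longrightarrow> f (i + j) = ys ! j" for f :: "nat \<Rightarrow> 'a" and ys i
    using that
  proof (induction ys arbitrary: i)
    case (Cons y ys)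
    from Cons.prems[of 0] have "f i = y" by simp
    moreover have "tabulated f ys (Suc i)" using Cons.prems[of "Suc _"] by (intro Cons.IH) simp
    ultimately show ?case by simp
  qed simp
  then show ?thesis by simp
qed

lemmas tabulate_simps =
  tabulated.simps Suc_numeral One_nat_def[symmetric] Suc_1 arith_simps simp_thms

text \<open>
  The checkers are evaluated by rewriting. They are written with conditionals because the weak congruence rule
  keeps their branches, in particular recursive calls below a binder, from being rewritten before the
  condition is decided.
\<close>

lemma nth_literal:
  "(x0 # xs) ! 0 = x0"
  "(x0 # x1 # xs) ! 1 = x1"
  "(x0 # x1 # x2 # xs) ! 2 = x2"
  "(x0 # x1 # x2 # x3 # xs) ! 3 = x3"
  "(x0 # x1 # x2 # x3 # x4 # xs) ! 4 = x4"
  "(x0 # x1 # x2 # x3 # x4 # x5 # xs) ! 5 = x5"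
  "(x0 # x1 # x2 # x3 # x4 # x5 # x6 # xs) ! 6 = x6"
  "(x0 # x1 # x2 # x3 # x4 # x5 # x6 # x7 # xs) ! 7 = x7"
  "(x0 # x1 # x2 # x3 # x4 # x5 # x6 # x7 # x8 # xs) ! 8 = x8"
  "(x0 # x1 # x2 # x3 # x4 # x5 # x6 # x7 # x8 # x9 # xs) ! 9 = x9"
  "(x0 # x1 # x2 # x3 # x4 # x5 # x6 # x7 # x8 # x9 # x10 # xs) ! 10 = x10"
  "(x0 # x1 # x2 # x3 # x4 # x5 # x6 # x7 # x8 # x9 # x10 # x11 # xs) ! 11 = x11"
  "(x0 # x1 # x2 # x3 # x4 # x5 # x6 # x7 # x8 # x9 # x10 # x11 # x12 # xs) ! 12 = x12"
  "(x0 # x1 # x2 # x3 # x4 # x5 # x6 # x7 # x8 # x9 # x10 # x11 # x12 # x13 # xs) ! 13 = x13"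
  by simp_all

lemmas literal_simps =
  nth_literal mem.simps no_dup.simps adjacent_def neighbours_def saturated_def Let_def
  prod.case fst_conv list.map list.pred_inject filter.simps append_Cons append_Nil
  List.enumerate_simps length_Cons list.size(3) if_True if_False simp_thms
  Suc_numeral One_nat_def[symmetric] Suc_1 rel_simps arith_simps

lemma bits_numeral:
  "bits i 0 = []" "bits i 1 = [i]" "bits i (numeral num.One) = [i]"
  "bits i (numeral (num.Bit0 n)) = bits (Suc i) (numeral n)"
  "bits i (numeral (num.Bit1 n)) = i # bits (Suc i) (numeral n)"
  by (subst bits.simps; simp add: bits.simps[of _ 0])+

lemma list_all_upt: "list_all P [a..<b] = (if a < b then P a \<and> list_all P [Suc a..<b] else True)"
  by (simp add: upt_rec)

lemmas node_simps =
  literal_simps list_all_upt pad.simps pattern_def bits_numeral snd_conv node_ok_def step_ok.simps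
  fold_ok_def child_ok_def zip_Cons_Cons zip_Nil zip.simps(1)
section \<open>Sporadic rigid graphs\<close>

lemmas search_simps =
  literal_simps search.simps only_identity_def regular_graph_def list.case list.sel(3) list.inject list.distinct

text \<open>As \<open>search\<close> demands, the vertices of this and the following graphs are
  numbered such that each one after 0 has a smaller neighbour.\<close>

definition quartic10 :: "nat list list" where
  "quartic10 =
   [[1, 2, 4, 7], [0, 2, 3, 9], [0, 1, 3, 4], [1, 2, 5, 6],
    [0, 2, 5, 8], [3, 4, 6, 9], [3, 5, 7, 8], [0, 6, 8, 9],
    [4, 6, 7, 9], [1, 5, 7, 8]]"

definition "quartic10_adj = (!) quartic10"

lemmas quartic10_adj_simps = tabulated_nth[of quartic10, folded quartic10_adj_def, unfolded quartic10_def, simplified tabulate_simps]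

lemma order_quartic10: "10 \<in> rigid_regular_orders 4"
proof -
  have "regular_graph 4 quartic10"
    by (simp only: quartic10_def search_simps cong: if_weak_cong)
  moreover have "only_identity quartic10_adj quartic10"
    by (simp only: quartic10_def search_simps quartic10_adj_simps cong: if_weak_cong)
  moreover have "length quartic10 = 10"
    by (simp add: quartic10_def)
  ultimately show ?thesis
    using only_identity_imp_order[OF quartic10_adj_def] by fastforce
qed

definition quintic10 :: "nat list list" where
  "quintic10 =
   [[1, 2, 5, 6, 7], [0, 2, 3, 4, 5], [0, 1, 3, 8, 9], [1, 2, 4, 6, 8],
    [1, 3, 5, 6, 8], [0, 1, 4, 7, 9], [0, 3, 4, 7, 9], [0, 5, 6, 8, 9],
    [2, 3, 4, 7, 9], [2, 5, 6, 7, 8]]"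

definition "quintic10_adj = (!) quintic10"

lemmas quintic10_adj_simps = tabulated_nth[of quintic10, folded quintic10_adj_def, unfolded quintic10_def, simplified tabulate_simps]

lemma order_quintic10: "10 \<in> rigid_regular_orders 5"
proof -
  have "regular_graph 5 quintic10"
    by (simp only: quintic10_def search_simps cong: if_weak_cong)
  moreover have "only_identity quintic10_adj quintic10"
    by (simp only: quintic10_def search_simps quintic10_adj_simps cong: if_weak_cong)
  moreover have "length quintic10 = 10"
    by (simp add: quintic10_def)
  ultimately show ?thesis
    using only_identity_imp_order[OF quintic10_adj_def] by fastforce
qed

text \<open>Order \<open>d + 4 = 10\<close> is impossible for \<open>d = 6\<close>; at order 11 the
  complement is quartic.\<close>

definition sextic11 :: "nat list list" where
  "sextic11 =
   [[1, 2, 3, 6, 7, 10], [0, 2, 3, 4, 8, 10], [0, 1, 3, 4, 5, 9], [0, 1, 2, 4, 5, 6],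
    [1, 2, 3, 5, 8, 9], [2, 3, 4, 6, 7, 10], [0, 3, 5, 7, 8, 9], [0, 5, 6, 8, 9, 10],
    [1, 4, 6, 7, 9, 10], [2, 4, 6, 7, 8, 10], [0, 1, 5, 7, 8, 9]]"

definition "sextic11_adj = (!) sextic11"

lemmas sextic11_adj_simps = tabulated_nth[of sextic11, folded sextic11_adj_def, unfolded sextic11_def, simplified tabulate_simps]

lemma order_sextic11: "11 \<in> rigid_regular_orders 6"
proof -
  have "regular_graph 6 sextic11"
    by (simp only: sextic11_def search_simps cong: if_weak_cong)
  moreover have "only_identity sextic11_adj sextic11"
    by (simp only: sextic11_def search_simps sextic11_adj_simps cong: if_weak_cong)
  moreover have "length sextic11 = 11"
    by (simp add: sextic11_def)
  ultimately show ?thesis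
    using only_identity_imp_order[OF sextic11_adj_def] by fastforce
qed

text \<open>Degrees 7 and 8 call for 12 vertices and so lie just below the range of the two
  families.\<close>

definition septic12 :: "nat list list" where
  "septic12 =
   [[1, 2, 3, 4, 5, 8, 10], [0, 2, 3, 4, 5, 6, 7], [0, 1, 3, 4, 6, 8, 11], [0, 1, 2, 7, 9, 10, 11],
    [0, 1, 2, 5, 6, 9, 11], [0, 1, 4, 7, 9, 10, 11], [1, 2, 4, 7, 8, 9, 10], [1, 3, 5, 6, 8, 9, 10],
    [0, 2, 6, 7, 9, 10, 11], [3, 4, 5, 6, 7, 8, 11], [0, 3, 5, 6, 7, 8, 11], [2, 3, 4, 5, 8, 9, 10]]"

definition "septic12_adj = (!) septic12"

lemmas septic12_adj_simps = tabulated_nth[of septic12, folded septic12_adj_def, unfolded septic12_def, simplified tabulate_simps]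

lemma order_septic12: "12 \<in> rigid_regular_orders 7"
proof -
  have "regular_graph 7 septic12"
    by (simp only: septic12_def search_simps cong: if_weak_cong)
  moreover have "only_identity septic12_adj septic12"
    by (simp only: septic12_def search_simps septic12_adj_simps cong: if_weak_cong)
  moreover have "length septic12 = 12"
    by (simp add: septic12_def)
  ultimately show ?thesis
    using only_identity_imp_order[OF septic12_adj_def] by fastforce
qed

definition octic12 :: "nat list list" where
  "octic12 =
   [[1, 2, 3, 4, 5, 6, 7, 11], [0, 2, 3, 4, 5, 6, 7, 8], [0, 1, 3, 4, 5, 8, 9, 11], [0, 1, 2, 4, 7, 8, 9, 10],
    [0, 1, 2, 3, 5, 6, 10, 11], [0, 1, 2, 4, 6, 8, 9, 10], [0, 1, 4, 5, 7, 9, 10, 11], [0, 1, 3, 6, 8, 9, 10, 11],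
    [1, 2, 3, 5, 7, 9, 10, 11], [2, 3, 5, 6, 7, 8, 10, 11], [3, 4, 5, 6, 7, 8, 9, 11], [0, 2, 4, 6, 7, 8, 9, 10]]"

definition "octic12_adj = (!) octic12"

lemmas octic12_adj_simps = tabulated_nth[of octic12, folded octic12_adj_def, unfolded octic12_def, simplified tabulate_simps]

lemma order_octic12: "12 \<in> rigid_regular_orders 8"
proof -
  have "regular_graph 8 octic12"
    by (simp only: octic12_def search_simps cong: if_weak_cong)
  moreover have "only_identity octic12_adj octic12"
    by (simp only: octic12_def search_simps octic12_adj_simps cong: if_weak_cong)
  moreover have "length octic12 = 12"
    by (simp add: octic12_def)
  ultimately show ?thesis
    using only_identity_imp_order[OF octic12_adj_def] by fastforce
qed

definition cubic14 :: "nat list list" where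
  "cubic14 =
   [[1, 2, 5], [0, 3, 10], [0, 4, 11], [1, 4, 8],
    [2, 3, 6], [0, 6, 12], [4, 5, 7], [6, 8, 12],
    [3, 7, 9], [8, 10, 11], [1, 9, 13], [2, 9, 13],
    [5, 7, 13], [10, 11, 12]]"

definition "cubic14_adj = (!) cubic14"

lemmas cubic14_adj_simps = tabulated_nth[of cubic14, folded cubic14_adj_def, unfolded cubic14_def, simplified tabulate_simps]

lemma order_cubic14: "14 \<in> rigid_regular_orders 3"
proof -
  have "regular_graph 3 cubic14"
    by (simp only: cubic14_def search_simps cong: if_weak_cong)
  moreover have "only_identity cubic14_adj cubic14"
    by (simp only: cubic14_def search_simps cubic14_adj_simps cong: if_weak_cong)
  moreover have "length cubic14 = 14"
    by (simp add: cubic14_def)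
  ultimately show ?thesis
    using only_identity_imp_order[OF cubic14_adj_def] by fastforce
qed
section \<open>Refutation certificates\<close>

text \<open>Checked with the automorphism flag set, because it is meant for complements of 6-regular
  graphs on 10 vertices. Node 0, for instance, is the complete graph on four vertices without the
  edge 12; its saturated vertices 0 and 3 can be exchanged.\<close>

definition cubic_10 :: "(nat list \<times> step) list" where
  "cubic_10 = [
([0,1,1,7],Fold [3,1,2,0]),([0,1,1,3,4,22],Fold [1,0,5,3,4,2]),([0,1,0,3,12,6,48],Fold [0,3,2,1,5,4]),
([0,1,0,3,12,6,32,80,192],Fold [0,3,2,1,5,4,7,6]),([0,1,1,3,12,6,32,80,64,256],Branch 8 [(7,3,[])]),
([0,1,1,3,12,6,32,80,64],Branch 8 [(7,3,[]),(9,4,[])]),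
([0,1,1,3,12,6,32,64,192,128],Branch 8 [(4,3,[0,1,2,3,4,5,6,8,7]),(9,0,[7,9,6,8])]),
([0,1,1,3,12,6,32,64,192],Branch 7 [(4,3,[]),(9,6,[])]),
([0,1,1,3,12,6,32,64,64,128],Branch 7 [(4,5,[]),(8,7,[0,1,2,3,4,5,6,8,7])]),
([0,1,1,3,12,6,32,64,64],Branch 7 [(4,5,[]),(8,7,[]),(9,8,[])]),
([0,1,1,3,12,6,32,64],Branch 6 [(4,2,[]),(8,9,[])]),([0,1,1,3,12,6,32],Branch 6 [(4,2,[]),(7,10,[])]),
([0,1,1,3,12,6],Branch 5 [(4,1,[]),(6,11,[])]),([0,1,1,3,12,0,36,112],Fold [3,1,4,0,2,5,7,6]),
([0,1,1,3,12,2,36,80,160,256],Branch 9 []),([0,1,1,3,12,2,36,80,160],Branch 8 [(9,14,[])]),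
([0,1,1,3,12,2,36,80,128,256],Branch 8 [(5,15,[])]),([0,1,1,3,12,2,36,80,128],Branch 8 [(5,15,[]),(9,16,[])]),
([0,1,1,3,12,2,36,80],Branch 7 [(5,13,[]),(8,17,[])]),([0,1,1,3,12,2,36,16,224,128],Branch 9 []),
([0,1,1,3,12,2,36,16,224],Branch 7 [(9,19,[])]),([0,1,1,3,12,2,36,16,96,128],Branch 7 [(8,20,[])]),
([0,1,1,3,12,2,36,16,96],Branch 7 [(8,20,[]),(9,21,[])]),
([0,1,1,3,12,2,36,16,192,416],Fold [8,7,6,9,5,4,2,1,0,3]),([0,1,1,3,12,2,36,16,192,288],Branch 7 [(9,23,[])]),
([0,1,1,3,12,2,36,16,192,384],Branch 5 [(9,24,[])]),
([0,1,1,3,12,2,36,16,192,256],Branch 9 [(5,24,[]),(7,25,[])]),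
([0,1,1,3,12,2,36,16,192],Branch 8 [(5,22,[]),(9,26,[])]),
([0,1,1,3,12,2,36,16,64,256],Branch 8 [(5,22,[]),(7,27,[])]),
([0,1,1,3,12,2,36,16,64],Branch 8 [(5,22,[]),(7,27,[]),(9,28,[])]),
([0,1,1,3,12,2,36,16],Branch 6 [(7,18,[]),(8,29,[])]),([0,1,1,3,12,0,4,80,160,352],Fold [3,1,4,0,2,5,7,6,9,8]),
([0,1,1,3,12,2,4,80,160,288],Branch 9 [(6,31,[])]),
([0,1,1,3,12,2,4,80,160,32],Branch 8 [(6,13,[0,1,2,3,4,8]),(9,32,[])]),
([0,1,1,3,12,2,4,80,32,32],Branch 7 [(8,33,[]),(9,33,[0,1,2,3,4,5,6,7,9,8])]),([0,0,0,7,7],Fold [0,1,2,4,3]),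
([0,1,1,3,12,2,4,16,160,224],Branch 8 [(6,35,[5,6,7,8,9])]),
([0,1,1,3,12,2,4,16,160,160],Branch 9 [(6,36,[]),(8,0,[8,5,7,9])]),
([0,1,1,3,12,2,4,16,160,32],Branch 7 [(6,34,[]),(9,37,[])]),
([0,1,1,3,12,2,4,16,32,32],Branch 7 [(6,34,[]),(8,38,[]),(9,38,[0,1,2,3,4,5,6,7,9,8])]),
([0,1,1,3,12,2,4,16,32],Branch 5 [(6,30,[]),(7,30,[3,1,4,0,2,5,7,6]),(9,39,[])]),
([0,1,1,3,12,2,4,16],Branch 5 [(6,30,[]),(7,30,[3,1,4,0,2,5,7,6]),(8,40,[])]),
([0,1,1,3,12,2,4],Branch 4 [(5,12,[3,0,4,1,5,2]),(6,1,[0,3,2,1,6,4]),(7,41,[])]),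
([0,1,1,3,12,2],Branch 2 [(5,12,[]),(6,42,[])]),([0,1,1,3,0,2,36,20,48,384],Fold [1,0,5,3,4,2,6,8,7]),
([0,1,1,3,8,2,36,20,48,256],Branch 7 [(6,3,[0,1,8,3,4,5,6,7,2]),(9,44,[])]),
([0,1,1,3,8,2,36,20,48],Branch 8 [(6,3,[1,0,7,3,4,2,6,8,5]),(7,3,[3,0,6,1,5,2,7,8,4]),(9,45,[])]),
([0,1,1,3,8,0,36,4,176,208],Fold [3,1,4,0,2,5,8,9,6,7]),([0,1,1,3,8,2,36,4,176,80],Branch 9 [(7,47,[])]),
([0,1,1,3,8,2,36,4,48,80],Branch 8 [(7,48,[]),(9,43,[8,4,5,9,6,3])]),
([0,1,1,3,8,2,36,68,16,400],Fold [2,6,0,7,9,5,1,3,8,4]),([0,1,1,3,8,2,36,4,48,400],Branch 6 [(7,50,[])]),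
([0,1,1,3,8,2,36,4,48,144],Branch 9 [(6,49,[]),(8,51,[])]),
([0,1,1,3,8,2,36,4,48,272],Branch 9 [(6,43,[8,4,5,9,6,3]),(7,52,[])]),
([0,1,1,3,8,2,36,4,48,16],Branch 9 [(6,49,[]),(7,52,[]),(8,53,[])]),
([0,1,1,3,8,2,36,4,48],Branch 4 [(6,2,[0,1,8]),(7,46,[]),(9,54,[])]),
([0,1,1,3,8,2,36,4,96,16],Branch 4 [(7,55,[1,0,5,3,4,2,6,8,7]),(8,55,[])]),
([0,1,1,3,8,2,36,4,96],Branch 4 [(7,55,[1,0,5,3,4,2,6,8,7]),(8,55,[]),(9,56,[])]),
([0,1,1,3,8,2,36,4,160,128],Branch 8 [(4,55,[]),(6,43,[6,5,2,8,7,1]),(9,3,[3,0,6,1,5,2,7,8,9])]),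
([0,1,1,3,8,2,36,4,160],Branch 7 [(4,55,[1,0,5,3,4,2,6,8,7]),(6,43,[6,2,5,7,8,0]),(9,58,[])]),
([0,1,1,3,8,2,36,4,32,256],Branch 8 [(4,55,[]),(6,57,[]),(7,59,[])]),
([0,1,1,3,8,2,36,4,32],Branch 8 [(4,55,[]),(6,57,[]),(7,59,[]),(9,60,[])]),
([0,1,1,3,8,2,36,4],Branch 5 [(4,43,[1,0,5,3,4,2]),(7,2,[3,0,6,1,5,2,7]),(8,61,[])]),
([0,1,1,3,8,2,4,4,32,32],Branch 4 [(6,62,[0,3,2,1,5,4]),(7,62,[0,3,2,1,5,4,7,6]),(8,62,[1,3,5,0,2,4,8,9]),(9,62,[1,3,5,0,2,4,9,8])]),
([0,1,1,3,8,2,4,4,32],Branch 5 [(4,43,[1,0,5,3,4,2]),(6,62,[]),(7,62,[0,1,2,3,4,5,7,6]),(9,63,[])]),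
([0,1,1,3,8,2,4,4],Branch 5 [(4,43,[1,0,5,3,4,2]),(6,62,[]),(7,62,[0,1,2,3,4,5,7,6]),(8,64,[])]),
([0,1,1,3,8,2,4],Branch 2 [(4,43,[]),(5,43,[0,3,2,1,5,4]),(7,65,[])]),
([0,1,1,3,8,2],Branch 2 [(4,43,[]),(5,43,[0,3,2,1,5,4]),(6,66,[])]),
([0,1,1,3,8],Branch 1 [(2,0,[0,2,3,1]),(4,0,[1,0,4]),(5,67,[])]),([0,1,1,3],Branch 3 [(2,0,[]),(4,68,[])]),
([0,1,1,1,12,10,36,18],Fold [3,4,5,0,1,2]),([0,1,1,1,12,10,36,80,130],Fold [4,7,3,2,0,6,5,1]),
([0,1,1,1,12,10,36,80,2,256],Branch 8 [(7,71,[])]),([0,1,1,1,12,10,36,80,2],Branch 8 [(7,71,[]),(9,72,[])]),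
([0,1,1,1,12,10,36,16,130,256],Branch 7 [(6,73,[]),(9,69,[7,8,4,9])]),
([0,1,1,1,12,10,36,16,130],Branch 8 [(6,73,[1,8,0,5,3,6,2,4,7]),(9,74,[])]),
([0,1,1,1,12,10,36,16,2,128],Branch 7 [(6,73,[]),(8,75,[])]),
([0,1,1,1,12,10,36,16,2],Branch 7 [(6,73,[]),(8,75,[]),(9,76,[])]),
([0,1,1,1,12,10,36,16],Branch 1 [(6,69,[1,5,0,6]),(7,70,[]),(8,77,[])]),
([0,1,1,0,12,10,6,48],Fold [0,2,1,3,5,4]),([0,1,1,1,12,10,4,48,2,448],Branch 6 [(8,69,[6,8,2,9])]),
([0,1,1,1,12,10,4,48,2,192],Branch 9 [(8,80,[])]),
([0,1,1,1,12,10,4,48,2,128],Branch 9 [(6,81,[]),(8,81,[0,2,1,3,5,4,8,7,6])]),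
([0,1,1,1,12,10,4,48,2],Branch 7 [(6,79,[1,0,5,4,7,2,3,6]),(8,79,[2,0,4,8,7,1,3,5]),(9,82,[])]),
([0,1,1,1,12,10,4,48],Branch 1 [(6,79,[]),(7,69,[1,5,0,7]),(8,83,[])]),
([0,1,1,0,12,10,4,16,224,194],Fold [0,2,1,3,5,4,9,8,7,6]),([0,1,1,1,12,10,4,16,96,194],Branch 8 [(7,85,[])]),
([0,1,1,1,12,10,4,16,32,194],Branch 6 [(7,69,[6,9,2,7]),(8,86,[])]),
([0,1,1,1,12,10,4,16,160,322],Fold [1,0,9,5,8,3,6,7,4,2]),
([0,1,1,1,12,10,4,16,32,322],Branch 8 [(6,69,[6,8,2,9]),(7,88,[])]),
([0,1,1,1,12,10,4,16,32,66],Branch 9 [(7,87,[]),(8,89,[])]),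
([0,1,1,1,12,10,4,16,96,386],Fold [5,3,8,1,9,0,6,7,2,4]),
([0,1,1,1,12,10,4,16,32,386],Branch 8 [(6,91,[]),(7,69,[7,8,4,9])]),
([0,1,1,1,12,10,4,16,32,130],Branch 9 [(6,90,[]),(8,92,[])]),
([0,1,1,1,12,10,4,16,32,258],Branch 9 [(6,90,[]),(7,93,[])]),
([0,1,1,1,12,10,4,16,32,2],Branch 9 [(6,90,[]),(7,93,[]),(8,94,[])]),
([0,1,1,1,12,10,4,16,32],Branch 1 [(6,84,[1,6,5,0,3,2,8,4]),(7,78,[0,2,1,3,5,4,7,8]),(8,69,[1,8,0,5]),(9,95,[])]),
([0,1,1,1,12,10,4,16],Branch 5 [(6,78,[]),(7,84,[]),(8,96,[])]),
([0,1,1,1,12,8,36,18,66,128],Branch 5 [(8,69,[5,8,3,6]),(9,85,[8,1,6,9,5,7,2,3,4,0])]),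
([0,1,1,1,12,8,36,18,2,128],Branch 6 [(8,98,[]),(9,98,[4,7,2,3,0,5,6,1,9,8])]),
([0,1,1,1,12,8,4,18,98,192],Branch 9 [(5,79,[0,2,3,8,5,6,4,9])]),
([0,1,1,1,12,8,4,18,66,192],Branch 8 [(5,100,[]),(9,69,[6,8,2,9])]),
([0,1,1,1,12,8,4,18,66,128],Branch 6 [(5,99,[]),(9,101,[])]),
([0,1,1,1,12,8,4,18,2,128],Branch 6 [(5,99,[]),(8,102,[]),(9,102,[4,7,2,3,0,5,6,1,9,8])]),
([0,1,1,1,12,8,4,18,2],Branch 7 [(5,97,[3,5,0,4,2,7,1,6]),(6,97,[2,6,0,4,3,7,1,5]),(8,69,[1,8,0,7]),(9,103,[])]),
([0,1,1,1,12,8,4,18],Branch 1 [(5,97,[]),(6,97,[0,1,3,2,4,6,5]),(8,104,[])]),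
([0,1,1,1,12,8,4,16,130,2],Branch 7 [(5,97,[3,5,0,4,2,7,1,6]),(6,97,[2,6,0,4,3,7,1,5]),(9,79,[2,0,4,8,7,1,3,9])]),
([0,1,1,1,12,8,4,16,2,2],Branch 7 [(5,97,[3,5,0,4,2,7,1,6]),(6,97,[2,6,0,4,3,7,1,5]),(8,106,[]),(9,106,[0,1,2,3,4,5,6,7,9,8])]),
([0,1,1,1,12,8,4,16,2],Branch 1 [(5,97,[]),(6,97,[0,1,3,2,4,6,5]),(7,105,[]),(9,107,[])]),
([0,1,1,1,12,8,4,16],Branch 1 [(5,97,[]),(6,97,[0,1,3,2,4,6,5]),(7,105,[]),(8,108,[])]),
([0,1,1,1,12,8,4],Branch 4 [(1,35,[1,2,3,0]),(5,69,[3,4,0,5]),(6,69,[2,4,0,6]),(7,109,[])]),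
([0,1,1,1,12,8],Branch 2 [(1,69,[0,1,3,2]),(5,35,[0,4,5,2,3]),(6,110,[])]),
([0,1,1,1,8,8,20,20,2,2],Branch 7 [(5,111,[2,0,6,7]),(6,69,[2,6,0,7]),(8,111,[2,0,6,7,4,8]),(9,111,[2,0,6,7,4,9])]),
([0,1,1,1,8,20,4,82,34],Fold [4,5,7,3,0,1,6,2]),
([0,1,1,1,8,8,20,4,18,66],Branch 8 [(5,111,[3,0,5,4,8,6]),(7,113,[0,1,2,3,4,6,7,8,9]),(9,69,[1,8,0,9])]),
([0,1,1,1,8,8,20,4,18,2],Branch 6 [(5,111,[3,0,5,4,6,8]),(7,69,[2,6,0,7]),(8,69,[4,8,3,6]),(9,114,[])]),
([0,1,1,1,8,8,20,4,2,2],Branch 4 [(5,69,[3,4,0,5]),(7,112,[]),(8,115,[]),(9,115,[0,1,2,3,4,5,6,7,9,8])]),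
([0,1,1,1,8,8,4,4,2,2],Branch 4 [(5,69,[3,4,0,5]),(6,116,[]),(7,116,[0,1,2,3,4,5,7,6]),(8,116,[0,2,1,3,4,5,8,9,6,7]),(9,116,[0,2,1,3,4,5,9,8,6,7])]),
([0,1,1,1,8,8,4,4,2],Branch 1 [(4,111,[0,2,3,1,4,8]),(5,111,[0,2,3,1,5,8]),(6,111,[0,3,2,1,6,8]),(7,111,[0,3,2,1,7,8]),(9,117,[])]),
([0,1,1,1,8,8,4,4],Branch 1 [(4,111,[0,2,1]),(5,111,[0,2,1,3,5,4]),(6,111,[0,3,1,2,6,7]),(7,111,[0,3,1,2,7,6]),(8,118,[])]),
([0,1,1,1,8,8,4],Branch 2 [(1,69,[0,1,3,2]),(4,111,[0,1,3,2,4,6]),(5,111,[0,1,3,2,5,6]),(7,119,[])]),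
([0,1,1,1,8,8],Branch 2 [(1,69,[0,1,3,2]),(4,111,[]),(5,111,[0,1,2,3,5,4]),(6,120,[])]),
([0,1,1,1,8],Branch 3 [(1,69,[]),(2,69,[0,2,1]),(5,121,[])]),
([0,1,1,1],Branch 3 [(1,69,[]),(2,69,[0,2,1]),(4,122,[])]),([0,1,1],Branch 0 [(3,123,[])]),
([0,1],Branch 0 [(2,124,[])]),([0],Branch 0 [(1,125,[])])]"

definition "cubic_10_node = (!) cubic_10"

lemmas cubic_10_node_simps =
  tabulated_nth[of cubic_10, folded cubic_10_node_def, unfolded cubic_10_def, simplified tabulate_simps]

lemma cubic_10_ok: "list_all (node_ok 3 10 True cubic_10_node) [0..<127]"
  by (simp only: node_simps cubic_10_node_simps cong: if_weak_cong)

lemma cubic_10_root: "pattern (cubic_10_node 126) = [[]]"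
  by (simp only: pattern_def cubic_10_node_simps fst_conv list.map bits_numeral)

text \<open>Folds may identify vertices here. Node 0 is still an exchange, of two adjacent vertices
  with the common neighbours 2, 3 and 4; node 2 is a proper folding.\<close>

definition quartic_9 :: "(nat list \<times> step) list" where
  "quartic_9 = [
([0,1,3,3,3],Fold [1,0]),([0,0,3,3,12,12],Fold [0,1,3]),([0,1,3,3,6,13,24,112],Fold [4,6,7,7,4,6]),
([0,1,3,3,6,13,24,48,64],Branch 6 [(7,2,[])]),([0,1,3,3,6,13,24,48],Branch 6 [(7,2,[]),(8,3,[])]),
([0,1,3,3,6,13,24,80,128],Branch 7 [(5,4,[])]),([0,1,3,3,6,13,24,80],Branch 7 [(5,4,[]),(8,5,[])]),
([0,1,3,3,6,13,24,16,128],Branch 7 [(5,4,[]),(6,6,[])]),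
([0,1,3,3,6,13,24,16],Branch 7 [(5,4,[]),(6,6,[]),(8,7,[])]),
([0,1,3,3,6,13,24],Branch 4 [(5,1,[0,2,1,5,3,4]),(7,8,[])]),([0,1,3,3,6,13,40],Fold [0,2,1,5,4,3]),
([0,1,3,3,6,13,8,16,16],Branch 5 [(6,10,[]),(7,9,[0,2,1,5,4,3,7]),(8,9,[0,2,1,5,4,3,8])]),
([0,1,3,3,6,13,8,16],Branch 4 [(5,1,[0,2,1,5,3,4]),(6,9,[]),(8,11,[])]),
([0,1,3,3,6,13,8],Branch 4 [(5,1,[0,2,1,5,3,4]),(6,9,[]),(7,12,[])]),
([0,1,3,3,6,13],Branch 3 [(4,1,[]),(6,13,[])]),([0,1,3,3,6,5,40,40],Fold [0,2,1,5,4,3]),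
([0,1,3,3,6,5,40,112,216],Fold [6,8,7]),([0,1,3,3,6,5,40,112,152],Branch 6 [(8,16,[])]),
([0,1,3,3,6,5,40,112,24],Branch 7 [(8,17,[])]),
([0,1,3,3,6,5,40,48,24],Branch 6 [(7,18,[]),(8,18,[0,2,1,5,4,3,6,8,7])]),
([0,1,3,3,6,5,40,48,8],Branch 4 [(6,15,[2,0,1,5,3,4]),(8,19,[])]),
([0,1,3,3,6,5,40,96,136],Branch 7 [(4,20,[])]),([0,1,3,3,6,5,40,96,8],Branch 7 [(4,20,[]),(8,21,[])]),
([0,1,3,3,6,5,40,32,136],Branch 8 [(4,20,[0,2,1,5,4,3,6,8,7]),(6,22,[0,2,1,5,4,3,6,8,7])]),
([0,1,3,3,6,5,40,32,8],Branch 7 [(4,20,[]),(6,22,[]),(8,23,[])]),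
([0,1,3,3,6,5,40,32],Branch 3 [(4,14,[1,0,2,3,5,4]),(7,15,[]),(8,24,[])]),
([0,1,3,3,6,5,32,32,8],Branch 3 [(4,14,[1,0,2,3,5,4]),(6,25,[]),(7,25,[0,1,2,3,4,5,7,6])]),
([0,1,3,3,6,5,32,32],Branch 3 [(4,14,[1,0,2,3,5,4]),(6,25,[]),(7,25,[0,1,2,3,4,5,7,6]),(8,26,[])]),
([0,1,3,3,6,5,32],Branch 5 [(3,14,[]),(4,14,[2,0,1,5,3,4]),(7,27,[])]),
([0,1,3,3,6,5],Branch 5 [(3,14,[]),(4,14,[2,0,1,5,3,4]),(6,28,[])]),([0,1,3,3,6,25,60],Fold [1,0,3,2,5,4]),
([0,1,3,3,6,25,28,96],Fold [4,1,2,2,4,6]),([0,1,3,3,6,25,28,64,128],Branch 7 [(5,31,[])]),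
([0,1,3,3,6,25,28,64],Branch 7 [(5,31,[]),(8,32,[])]),([0,1,3,3,6,25,28],Branch 6 [(5,30,[]),(7,33,[])]),
([0,1,3,3,6,9,28,112,160],Fold [8,5,7,7,8,5,5]),([0,1,3,3,6,9,28,112,128],Branch 8 [(5,35,[])]),
([0,1,3,3,6,9,28,112],Branch 7 [(8,36,[])]),([0,1,3,3,6,9,28,48,128],Branch 7 [(6,37,[])]),
([0,1,3,3,6,9,28,48],Branch 7 [(6,37,[]),(8,38,[])]),([0,1,3,3,6,9,28,80,32],Branch 5 [(7,39,[])]),
([0,1,3,3,6,9,28,80],Branch 5 [(7,39,[]),(8,40,[])]),([0,1,3,3,6,9,28,16,128],Branch 7 [(5,39,[]),(6,41,[])]),
([0,1,3,3,6,9,28,16],Branch 7 [(5,39,[]),(6,41,[]),(8,42,[])]),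
([0,1,3,3,6,9,28],Branch 4 [(5,34,[]),(7,43,[])]),([0,1,3,2,6,9,12,80,240],Branch 5 [(7,0,[7,8,4,5,6])]),
([0,1,3,3,6,9,12,64,240],Branch 7 [(4,45,[]),(5,45,[1,0,3,2,5,4])]),
([0,1,3,3,6,9,12,64,112],Branch 8 [(7,46,[])]),([0,1,3,3,6,9,12,64,208],Branch 8 [(5,47,[])]),
([0,1,3,3,6,9,12,64,80],Branch 8 [(5,47,[]),(7,48,[])]),
([0,1,3,3,6,9,12,64,192],Branch 8 [(4,49,[]),(5,49,[1,0,3,2,5,4])]),
([0,1,3,3,6,9,12,64,64],Branch 8 [(4,49,[]),(5,49,[1,0,3,2,5,4]),(7,50,[])]),
([0,1,3,3,6,9,12,64],Branch 6 [(4,44,[]),(5,44,[1,0,3,2,5,4]),(8,51,[])]),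
([0,1,3,3,6,9,12],Branch 6 [(4,44,[]),(5,44,[1,0,3,2,5,4]),(7,52,[])]),
([0,1,3,3,6,9,52,120],Fold [2,1,0,4,3,6,5]),([0,1,3,3,6,9,20,120,96],Fold [2,1,0,4,3,6,5]),
([0,1,3,3,6,9,20,120,64],Branch 8 [(5,55,[])]),([0,1,3,3,6,9,20,120],Branch 6 [(5,54,[]),(8,56,[])]),
([0,1,3,3,6,9,4,120,112],Branch 8 []),([0,1,3,3,6,9,4,120,48],Branch 6 [(8,58,[])]),
([0,1,3,3,6,9,4,120,80],Branch 8 [(5,59,[])]),([0,1,3,3,6,9,4,120,16],Branch 8 [(5,59,[]),(6,60,[])]),
([0,1,3,3,6,9,4,120],Branch 4 [(5,53,[0,3,5,1,7,2,4]),(6,57,[]),(8,61,[])]),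
([0,1,3,3,6,9,20,56,192],Branch 6 [(5,62,[0,3,5,1,7,2,6,4])]),
([0,1,3,3,6,9,20,56,128],Branch 6 [(5,62,[0,3,5,1,7,2,6,4]),(8,63,[])]),
([0,1,3,3,6,9,4,56,208],Branch 8 [(5,62,[0,3,5,1,7,2,8,4])]),
([0,1,3,3,6,9,4,56,144],Branch 8 [(5,62,[0,3,5,1,7,2,8,4]),(6,65,[])]),
([0,1,3,3,6,9,4,56,128],Branch 4 [(5,53,[0,3,5,1,7,2,4]),(6,64,[]),(8,66,[])]),
([0,1,3,3,6,9,4,56],Branch 7 [(6,62,[]),(8,67,[])]),([0,1,3,3,6,9,36,88,240],Fold [6,7,8,8]),
([0,1,3,3,6,9,36,88,208],Branch 5 [(8,69,[])]),
([0,1,3,3,6,9,36,88,192],Branch 8 [(4,70,[]),(5,70,[1,0,3,2,5,4,7,6])]),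
([0,1,3,3,6,9,36,88,128],Branch 6 [(4,68,[1,0,3,2,5,4,7,6]),(8,71,[])]),
([0,1,3,3,6,9,4,88,192],Branch 6 [(4,68,[2,1,0,4,3,6,5]),(5,72,[])]),
([0,1,3,3,6,9,4,88,128],Branch 6 [(4,68,[2,1,0,4,3,6,5]),(5,72,[]),(8,73,[])]),
([0,1,3,3,6,9,4,88],Branch 7 [(5,68,[]),(8,74,[])]),([0,1,3,3,6,9,4,24,128],Branch 7 [(5,68,[]),(6,75,[])]),
([0,1,3,3,6,9,4,24],Branch 7 [(5,68,[]),(6,75,[]),(8,76,[])]),([0,1,3,3,6,9,20,104,240],Fold [4,6,2,8,4,6]),
([0,1,3,3,6,9,20,104,112],Branch 8 [(7,78,[])]),([0,1,3,3,6,9,20,40,112],Branch 6 [(7,79,[])]),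
([0,1,3,3,6,9,20,40,48],Branch 8 [(6,80,[]),(7,80,[1,0,3,2,5,4,7,6])]),
([0,1,3,3,6,9,20,40,32],Branch 4 [(7,77,[]),(8,81,[])]),([0,1,3,3,6,9,4,40,48],Branch 4 [(6,82,[]),(7,77,[])]),
([0,1,3,3,6,9,4,40,32],Branch 4 [(6,82,[]),(7,77,[]),(8,83,[])]),
([0,1,3,3,6,9,4,40],Branch 5 [(4,53,[0,3,5,1,7,2,4]),(6,77,[1,0,3,2,5,4,7,6]),(8,84,[])]),
([0,1,3,3,6,9,4,72,128],Branch 7 [(4,77,[]),(5,85,[])]),
([0,1,3,3,6,9,4,72],Branch 7 [(4,77,[]),(5,85,[]),(8,86,[])]),
([0,1,3,3,6,9,4,8,128],Branch 7 [(4,77,[]),(5,85,[]),(6,87,[])]),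
([0,1,3,3,6,9,4,8],Branch 7 [(4,77,[]),(5,85,[]),(6,87,[]),(8,88,[])]),
([0,1,3,3,6,9,4],Branch 3 [(4,29,[0,1,3,2]),(6,53,[]),(7,89,[])]),([0,1,3,3,6,17,44,120],Fold [6,7,5]),
([0,1,3,3,6,17,12,112,136],Fold [4,5,7,7]),([0,1,3,3,6,17,44,112,8],Branch 8 [(7,92,[])]),
([0,1,3,3,6,17,44,112],Branch 3 [(7,91,[]),(8,93,[])]),([0,1,3,3,6,17,36,48,200],Branch 8 []),
([0,1,3,3,6,17,36,48,72],Branch 8 [(7,95,[])]),([0,1,3,3,6,17,36,48,192],Branch 8 [(3,96,[])]),
([0,1,3,3,6,17,36,48,64],Branch 8 [(3,96,[]),(7,97,[])]),([0,1,3,3,6,17,44,48],Branch 6 [(7,94,[]),(8,98,[])]),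
([0,1,3,3,6,17,36,112],Branch 6 [(3,99,[]),(8,98,[])]),
([0,1,3,3,6,17,36,48],Branch 6 [(3,99,[]),(7,100,[]),(8,98,[])]),
([0,1,3,3,6,17,36,88,232],Fold [7,8,6,3,5,4,2,0,1]),([0,1,3,3,6,17,36,80,232],Branch 3 [(7,102,[])]),
([0,1,3,3,6,17,36,16,232],Branch 6 [(3,101,[2,1,0,4,3,6,5,8]),(7,103,[])]),
([0,1,3,3,6,17,36,16,104],Branch 8 [(7,104,[])]),([0,1,3,3,6,17,36,16,168],Branch 8 [(6,105,[])]),
([0,1,3,3,6,17,36,16,40],Branch 8 [(6,105,[]),(7,106,[])]),([0,1,3,3,6,17,36,16,224],Branch 8 [(3,107,[])]),
([0,1,3,3,6,17,36,16,96],Branch 8 [(3,107,[]),(7,108,[])]),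
([0,1,3,3,6,17,36,16,160],Branch 8 [(3,107,[]),(6,109,[])]),
([0,1,3,3,6,17,36,16,32],Branch 8 [(3,107,[]),(6,109,[]),(7,110,[])]),
([0,1,3,3,6,17,36,16],Branch 5 [(3,90,[]),(7,101,[]),(8,111,[])]),
([0,1,3,3,6,17,4,112,232],Branch 6 [(3,90,[7,8,6,5,3,4,2])]),
([0,1,3,3,6,17,4,48,232],Branch 6 [(3,92,[2,1,0,4,3,6,5,8,7]),(7,113,[])]),
([0,1,3,3,6,17,4,48,104],Branch 8 [(7,114,[])]),([0,1,3,3,6,17,4,48,168],Branch 8 [(6,115,[])]),
([0,1,3,3,6,17,4,48,40],Branch 8 [(6,115,[]),(7,116,[])]),([0,1,3,3,6,17,4,48,224],Branch 8 [(3,117,[])]),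
([0,1,3,3,6,17,4,48,96],Branch 8 [(3,117,[]),(7,118,[])]),
([0,1,3,3,6,17,4,48,160],Branch 8 [(3,117,[]),(6,119,[])]),
([0,1,3,3,6,17,4,48,32],Branch 8 [(3,117,[]),(6,119,[]),(7,120,[])]),
([0,1,3,3,6,17,4,48],Branch 5 [(3,90,[]),(6,112,[]),(8,121,[])]),
([0,1,3,3,6,17,4,16,32],Branch 5 [(3,90,[]),(6,112,[]),(7,122,[])]),
([0,1,3,3,6,17,4,16],Branch 5 [(3,90,[]),(6,112,[]),(7,122,[]),(8,123,[])]),
([0,1,3,3,6,17,4],Branch 4 [(3,1,[1,2,0,4,3]),(6,90,[1,2,4,0,6,3,5]),(7,124,[])]),
([0,0,3,3,6,1,36,120,112],Branch 3 [(8,1,[3,4,7,8,5,6])]),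
([0,1,3,3,6,1,36,120,96],Branch 4 [(3,29,[1,3,4,0,7,2]),(8,126,[])]),
([0,1,1,1,14,1,32,32,240],Fold [4,1,2,3,0,8,6,7,5]),([0,1,3,3,6,1,36,104,240],Branch 3 [(4,128,[])]),
([0,1,3,3,6,1,36,104,224],Branch 8 [(3,0,[7,8,3,5,6]),(4,129,[])]),
([0,1,3,3,6,1,36,104,96],Branch 7 [(4,127,[]),(8,130,[])]),
([0,1,3,3,6,1,36,96,224],Branch 7 [(3,131,[]),(4,131,[2,1,0,4,3,6,5])]),
([0,1,3,3,6,1,36,96,96],Branch 7 [(3,131,[]),(4,131,[2,1,0,4,3,6,5]),(8,132,[])]),
([0,1,3,3,6,1,36,96,64],Branch 5 [(3,90,[]),(4,125,[]),(8,133,[])]),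
([0,1,3,3,6,1,36,64,64],Branch 5 [(3,90,[]),(4,125,[]),(7,134,[]),(8,134,[0,1,2,3,4,5,6,8,7])]),
([0,1,3,3,6,1,36,64],Branch 6 [(3,125,[2,1,0,4,3,6,5]),(4,90,[2,1,0,4,3,6,5]),(8,135,[])]),
([0,1,3,3,6,1,36],Branch 6 [(3,125,[2,1,0,4,3,6,5]),(4,90,[2,1,0,4,3,6,5]),(7,136,[])]),
([0,1,3,3,6,1,4,32,32],Branch 5 [(3,90,[]),(4,125,[]),(6,137,[])]),
([0,1,3,3,6,1,4,32],Branch 5 [(3,90,[]),(4,125,[]),(6,137,[]),(8,138,[])]),
([0,1,3,3,6,1,4],Branch 5 [(3,90,[]),(4,125,[]),(6,137,[]),(7,139,[])]),
([0,1,3,3,6,1],Branch 2 [(3,0,[1,2,0]),(5,29,[]),(6,140,[])]),([0,1,3,3,2,17,48,48],Fold [1,0,2,3,5,4]),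
([0,1,3,3,2,17,48,16,108],Branch 6 [(2,141,[5,6,8,4,2,0]),(3,141,[5,6,8,4,3,0]),(7,141,[4,6,5,7,8,1])]),
([0,1,3,3,2,17,52,88,172],Fold [6,5,4,4,4,5,6,7,6]),([0,1,3,3,2,17,52,24,172],Branch 6 [(7,144,[])]),
([0,1,3,3,2,17,52,16,172],Branch 3 [(6,1,[0,1,2,3,6,8]),(7,145,[])]),
([0,1,3,3,2,17,48,20,172],Branch 3 [(6,146,[0,1,3,2]),(7,1,[0,1,2,3,8,7])]),
([0,1,3,3,2,17,48,16,172],Branch 2 [(3,0,[2,3,0,1,8]),(6,146,[]),(7,147,[])]),
([0,1,3,3,2,17,48,16,44],Branch 8 [(6,143,[]),(7,148,[])]),
([0,1,3,3,2,17,48,20,224],Branch 7 [(3,149,[1,0,2,3,5,4,6,8,7]),(6,141,[4,6,5,7,8,1])]),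
([0,1,3,3,2,17,48,16,228],Branch 2 [(3,128,[4,5,6,7,8,1,0,3,2]),(6,141,[5,6,8,4,2,0]),(7,150,[])]),
([0,1,3,3,2,17,48,16,100],Branch 8 [(3,149,[]),(7,151,[])]),
([0,1,3,3,2,17,48,16,164],Branch 8 [(3,149,[]),(6,152,[])]),
([0,1,3,3,2,17,48,16,36],Branch 8 [(3,149,[]),(6,152,[]),(7,153,[])]),
([0,1,3,3,2,17,48,16,224],Branch 8 [(2,154,[]),(3,154,[0,1,3,2])]),
([0,1,3,3,2,17,48,16,96],Branch 8 [(2,154,[]),(3,154,[0,1,3,2]),(7,155,[])]),
([0,1,3,3,2,17,48,16,160],Branch 7 [(2,154,[1,0,2,3,5,4,6,8,7]),(3,154,[1,0,3,2,5,4,6,8,7]),(6,156,[1,0,2,3,5,4,6,8,7])]),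
([0,1,3,3,2,17,48,16,32],Branch 8 [(2,154,[]),(3,154,[0,1,3,2]),(6,156,[]),(7,157,[])]),
([0,1,3,3,2,17,48,16],Branch 5 [(2,141,[1,0,2,3,5,4]),(3,141,[1,0,3,2,5,4]),(7,142,[]),(8,158,[])]),
([0,1,3,3,2,17,16,16,32],Branch 5 [(2,141,[1,0,2,3,5,4]),(3,141,[1,0,3,2,5,4]),(6,159,[]),(7,159,[0,1,2,3,4,5,7,6])]),
([0,1,3,3,2,17,16,16],Branch 5 [(2,141,[1,0,2,3,5,4]),(3,141,[1,0,3,2,5,4]),(6,159,[]),(7,159,[0,1,2,3,4,5,7,6]),(8,160,[])]),
([0,1,3,3,2,17,16],Branch 4 [(2,141,[]),(3,141,[0,1,3,2]),(7,161,[])]),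
([0,1,3,3,2,17],Branch 4 [(2,141,[]),(3,141,[0,1,3,2]),(6,162,[])]),
([0,1,3,3,2,1,48,48,16],Branch 5 [(2,141,[1,0,2,3,5,4]),(3,141,[1,0,3,2,5,4]),(8,128,[4,8,6,7,5,1,2,3,0])]),
([0,1,3,3,2,1,48,16,16],Branch 5 [(2,141,[1,0,2,3,5,4]),(3,141,[1,0,3,2,5,4]),(7,164,[]),(8,164,[0,1,2,3,4,5,8,6,7])]),
([0,1,3,3,2,1,16,16,16],Branch 5 [(2,141,[1,0,2,3,5,4]),(3,141,[1,0,3,2,5,4]),(6,165,[]),(7,165,[0,1,2,3,4,5,7,8,6]),(8,165,[0,1,2,3,4,5,8,6,7])]),
([0,1,3,3,2,1,16,16],Branch 4 [(2,141,[]),(3,141,[0,1,3,2]),(5,163,[]),(8,166,[])]),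
([0,1,3,3,2,1,16],Branch 4 [(2,141,[]),(3,141,[0,1,3,2]),(5,163,[]),(7,167,[])]),
([0,1,3,3,2,1],Branch 4 [(2,141,[]),(3,141,[0,1,3,2]),(5,163,[]),(6,168,[])]),
([0,1,3,3,2],Branch 0 [(4,0,[]),(5,169,[])]),([0,1,3,2,10,17,17,12,12],Fold [4,1,3]),
([0,1,3,2,10,17,17,12,4],Branch 3 [(5,170,[4,3,1,5,7]),(6,170,[4,3,1,6,7]),(8,171,[])]),
([0,1,3,2,10,17,17,4,4],Branch 3 [(5,170,[3,4,1,5,6]),(6,170,[3,4,1,6,5]),(7,172,[]),(8,172,[0,1,2,3,4,5,6,8,7])]),
([0,1,3,2,10,17,41,80,40],Fold [1,0,2,5,6,3,4]),
([0,1,3,2,10,17,41,84,12],Branch 5 [(7,170,[6,5,0,7]),(8,174,[])]),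
([0,1,3,2,10,17,41,48,72],Fold [1,0,2,6,5,4,3]),
([0,1,3,2,10,17,41,20,76],Branch 5 [(7,176,[]),(8,170,[6,5,0,8])]),
([0,1,3,2,10,17,41,20,12],Branch 6 [(7,175,[]),(8,177,[])]),
([0,1,3,2,10,17,9,84,12],Branch 7 [(5,178,[4,1,3,0,2,7,5,8,6]),(8,178,[2,1,0,3,4,7,8,5,6])]),
([0,1,3,2,10,17,9,20,12],Branch 6 [(5,178,[]),(7,179,[]),(8,178,[3,1,4,0,2,8,6,7,5])]),
([0,1,3,2,10,17,9,20,4],Branch 3 [(5,170,[4,3,1,5,6]),(7,170,[4,3,1,7,6]),(8,180,[])]),
([0,1,3,2,10,17,1,20,4],Branch 3 [(5,170,[3,4,1,5,7]),(6,181,[]),(7,170,[3,4,1,7,5]),(8,181,[2,1,0,3,4,7,8,5,6])]),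
([0,1,3,2,10,17,1,4,4],Branch 4 [(6,173,[]),(7,182,[]),(8,182,[0,1,2,3,4,5,6,8,7])]),
([0,1,3,2,10,1,1,4,4],Branch 4 [(5,183,[]),(6,183,[0,1,2,3,4,6,5,8,7]),(7,183,[2,1,0,3,4,7,8,5,6]),(8,183,[2,1,0,3,4,8,7,5,6])]),
([0,1,3,2,2,9,9,68,92],Fold [3,8,6]),([0,1,3,2,2,25,9,36,92],Branch 6 [(4,170,[8,6,3,4,0]),(7,185,[])]),
([0,1,3,2,2,25,1,36,92],Branch 3 [(4,170,[4,3,8,1,5]),(6,186,[]),(7,186,[2,1,0,3,4,8,7,6,5])]),
([0,1,3,2,2,25,1,36,28],Branch 8 [(6,187,[]),(7,184,[0,2,1,8,7,5,6,3,4])]),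
([0,1,3,2,2,25,1,36,76],Branch 8 [(4,188,[]),(7,184,[0,2,1,8,7,5,6,3,4])]),
([0,1,3,2,2,25,1,36,12],Branch 8 [(4,188,[]),(6,189,[]),(7,184,[0,2,1,8,7,5,6,3,4])]),
([0,1,3,2,2,25,1,36,68],Branch 8 [(3,190,[]),(4,190,[0,1,2,4,3]),(7,184,[0,2,1,8,7,5,6,3,4])]),
([0,1,3,2,2,25,1,36,4],Branch 8 [(3,190,[]),(4,190,[0,1,2,4,3]),(6,191,[]),(7,184,[0,2,1,8,7,5,6,3,4])]),
([0,1,3,2,2,25,1,4,4],Branch 5 [(6,184,[1,0,2,5,6,3,4,8,7]),(7,192,[]),(8,192,[0,1,2,3,4,5,6,8,7])]),
([0,1,3,2,2,17,1,36,4],Branch 5 [(3,193,[0,1,2,3,4,5,6,8,7]),(6,184,[1,0,2,5,6,3,4,8,7]),(8,193,[0,2,1,8,7,5,6,3,4])]),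
([0,1,3,2,2,17,1,4,4],Branch 5 [(3,193,[]),(6,184,[1,0,2,5,6,3,4,8,7]),(7,194,[]),(8,194,[0,1,2,3,4,5,6,8,7])]),
([0,1,3,2,2,1,1,4,4],Branch 4 [(3,184,[]),(5,195,[]),(6,195,[0,1,2,3,4,6,5,8,7]),(7,195,[1,2,0,8,7,4,3,5,6]),(8,195,[1,2,0,7,8,4,3,5,6])]),
([0,1,3,2,2,1,1,4],Branch 2 [(3,170,[2,1,0]),(4,170,[2,1,0,4,3]),(5,170,[2,0,1,5,6]),(6,170,[2,0,1,6,5]),(8,196,[])]),
([0,1,3,2,2,1,1],Branch 2 [(3,170,[2,1,0]),(4,170,[2,1,0,4,3]),(5,170,[2,0,1,5,6]),(6,170,[2,0,1,6,5]),(7,197,[])]),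
([0,1,3,2,2,1],Branch 0 [(3,170,[1,0,2,3,5]),(4,170,[1,0,2,4,5]),(6,198,[])]),
([0,1,3,2,2],Branch 0 [(3,170,[]),(4,170,[0,1,2,4,3]),(5,199,[])]),
([0,1,2,2,2,5,13,1,4],Branch 6 [(4,1,[0,2,1,6,3,4]),(5,200,[5,0,6,1,7]),(7,200,[6,0,7,1,5]),(8,200,[8,2,6,1,5])]),
([0,1,2,2,2,5,5,1,4],Branch 6 [(3,201,[]),(4,201,[0,1,2,4,3]),(5,200,[5,0,6,1,7]),(7,200,[6,0,7,1,5]),(8,200,[8,2,6,1,5])]),
([0,1,2,2,2,5,5,1],Branch 2 [(3,200,[2,1,3,0]),(4,200,[2,1,4,0,3]),(7,1,[1,5,0,2,6,7]),(8,202,[])]),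
([0,1,2,2,2,5,1,1,4],Branch 2 [(3,200,[2,1,3,0]),(4,200,[2,1,4,0,3]),(6,203,[]),(7,203,[0,1,2,3,4,5,7,6])]),
([0,1,2,2,2,5,1,1],Branch 2 [(3,200,[2,1,3,0]),(4,200,[2,1,4,0,3]),(6,203,[]),(7,203,[0,1,2,3,4,5,7,6]),(8,204,[])]),
([0,1,2,2,2,1,1,1,4],Branch 2 [(3,200,[2,1,3,0]),(4,200,[2,1,4,0,3]),(5,205,[]),(6,205,[0,1,2,3,4,6,5]),(7,205,[0,1,2,3,4,7,5,6])]),
([0,1,2,2,2,1,1,1],Branch 2 [(3,200,[2,1,3,0]),(4,200,[2,1,4,0,3]),(5,205,[]),(6,205,[0,1,2,3,4,6,5]),(7,205,[0,1,2,3,4,7,5,6]),(8,206,[])]),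
([0,1,2,2,2,1,1],Branch 0 [(2,200,[1,0,2,5,6]),(3,200,[1,0,3,5,6]),(4,200,[1,0,4,5,6]),(7,207,[])]),
([0,1,2,2,2,1],Branch 0 [(2,200,[]),(3,200,[0,1,3,2]),(4,200,[0,1,4,2,3]),(6,208,[])]),
([0,1,2,2,2],Branch 0 [(2,200,[]),(3,200,[0,1,3,2]),(4,200,[0,1,4,2,3]),(5,209,[])]),
([0,1,2,2],Branch 1 [(4,210,[])]),([0,1,2],Branch 1 [(3,211,[])]),([0,1],Branch 1 [(2,212,[])]),
([0],Branch 0 [(1,213,[])])]"

definition "quartic_9_node = (!) quartic_9"

lemmas quartic_9_node_simps =
  tabulated_nth[of quartic_9, folded quartic_9_node_def, unfolded quartic_9_def, simplified tabulate_simps]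

lemma quartic_9_ok: "list_all (node_ok 4 9 False quartic_9_node) [0..<215]"
  by (simp only: node_simps quartic_9_node_simps cong: if_weak_cong)

lemma quartic_9_root: "pattern (quartic_9_node 214) = [[]]"
  by (simp only: pattern_def quartic_9_node_simps fst_conv list.map bits_numeral)

text \<open>Asymmetry alone cannot be refuted on 12 vertices: the complement of
  \<open>octic12\<close> is an asymmetric cubic graph of that order. Hence noninjective folds are
  indispensable.\<close>

definition cubic_12 :: "(nat list \<times> step) list" where
  "cubic_12 = [
([0,1,3,3],Fold [1,0]),([0,1,3,2,9,28],Fold [3,5,4]),([0,1,3,0,9,12,48],Fold [2,1,0,3,5,4]),
([0,1,3,2,9,12,32,80,192],Fold [7,8,6,6,8]),([0,1,3,2,9,12,32,16,64,384,768],Fold [8,9,10,10,9,8]),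
([0,1,3,2,9,12,32,80,64,384,256,1024],Branch 10 [(9,4,[])]),
([0,1,3,2,9,12,32,80,64,384,256],Branch 10 [(9,4,[]),(11,5,[])]),
([0,1,3,2,9,12,32,80,64,256,768,512],Branch 10 [(7,4,[0,1,2,3,4,5,6,7,8,10,9]),(11,0,[9,10,8,11])]),
([0,1,3,2,9,12,32,80,64,256,768],Branch 9 [(7,4,[]),(11,7,[])]),
([0,1,3,2,9,12,32,80,64,256,256,512],Branch 9 [(7,6,[]),(10,8,[])]),
([0,1,3,2,9,12,32,80,64,256,256],Branch 9 [(7,6,[]),(10,8,[]),(11,9,[])]),
([0,1,3,2,9,12,32,80,64,256],Branch 8 [(7,3,[]),(10,10,[])]),
([0,1,3,2,9,12,32,80,64],Branch 8 [(7,3,[]),(9,11,[])]),([0,1,3,2,9,12,32,64,192,144],Fold [8,7,6,6,7]),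
([0,1,3,2,12,24],Fold [0,2,1,4,3]),
([0,1,3,2,9,12,32,64,192,128,768,1024],Branch 9 [(4,13,[]),(11,14,[6,7,8,9,10,11])]),
([0,1,3,2,9,12,32,64,192,128,768],Branch 10 [(4,13,[0,1,2,3,4,5,6,8,7,10]),(11,15,[])]),
([0,1,3,2,9,12,32,64,192,128,256,512],Branch 9 [(4,13,[]),(10,16,[0,1,2,3,4,5,6,8,7,10,9])]),
([0,1,3,2,9,12,32,64,192,128,256],Branch 9 [(4,13,[]),(10,16,[]),(11,17,[])]),
([0,1,3,2,9,12,32,64,192,128],Branch 8 [(4,12,[0,1,2,3,4,5,6,8,7]),(9,0,[7,8,9,6]),(10,18,[])]),
([0,1,3,2,9,12,32,64,192],Branch 7 [(4,12,[]),(9,19,[])]),([0,1,1,6,6],Fold [0,2]),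
([0,1,3,2,9,12,32,64,0,384,640,272],Fold [9,7,10,9,8,7]),
([0,1,3,2,9,12,32,64,64,384,128,272],Branch 9 [(10,22,[]),(11,20,[2,1,0,3,5,4,11,8,9])]),
([0,1,3,2,9,12,32,64,64,384,128,768],Branch 4 [(10,22,[0,1,2,3,4,5,6,8,7,9,11,10]),(11,20,[2,1,0,3,5,4,11,8,9])]),
([0,1,3,2,9,12,32,64,64,384,128,1280],Branch 11 [(4,23,[]),(9,24,[])]),
([0,1,3,2,9,12,32,64,64,384,128,256],Branch 11 [(4,23,[]),(9,24,[]),(10,25,[])]),
([0,1,3,2,9,12,32,64,64,384,128],Branch 8 [(4,12,[0,1,2,3,4,5,6,8,7]),(10,21,[6,7,8,9,10]),(11,26,[])]),
([0,1,3,2,9,12,32,64,64,128,128,256],Branch 8 [(4,12,[0,1,2,3,4,5,6,8,7]),(9,27,[0,1,2,3,4,5,6,8,7,9,11]),(10,27,[0,1,2,3,4,5,6,8,7,10,11])]),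
([0,1,3,2,9,12,32,64,64,128,128],Branch 8 [(4,12,[0,1,2,3,4,5,6,8,7]),(9,27,[]),(10,27,[0,1,2,3,4,5,6,7,8,10,9]),(11,28,[])]),
([0,1,3,2,9,12,32,64,64,128],Branch 7 [(4,12,[]),(8,20,[0,1,2,3,4,5,6,8,7]),(10,29,[])]),
([0,1,3,2,9,12,32,64,64],Branch 7 [(4,12,[]),(8,20,[]),(9,30,[])]),
([0,1,3,2,9,12,32,64],Branch 6 [(4,2,[]),(8,31,[])]),([0,1,3,2,9,12,32],Branch 6 [(4,2,[]),(7,32,[])]),
([0,1,3,2,9,12],Branch 5 [(4,1,[]),(6,33,[])]),([0,1,3,2,1,12,24,112],Fold [6,4,7,7]),
([0,1,3,2,0,12,24,48,192],Fold [0,2,1,5,4,3,7,6]),([0,1,3,2,1,12,24,48,64,256,896],Fold [8,10,9,8,10,10,9]),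
([0,1,3,2,1,12,24,48,64,256,384,512],Branch 9 [(10,37,[])]),
([0,1,3,2,1,12,24,48,64,256,384],Branch 9 [(10,37,[]),(11,38,[])]),
([0,1,3,2,1,12,24,48,64,256,768,512],Branch 10 [(7,39,[]),(11,0,[9,10,8,11])]),
([0,1,3,2,1,12,24,48,64,256,768],Branch 9 [(7,39,[0,1,2,3,4,5,6,7,8,10,9]),(11,40,[])]),
([0,1,3,2,1,12,24,48,64,256,256,1024],Branch 10 [(7,39,[]),(9,41,[])]),
([0,1,3,2,1,12,24,48,64,256,256],Branch 10 [(7,39,[]),(9,41,[]),(11,42,[])]),
([0,1,3,2,1,12,24,48,64,256],Branch 8 [(7,36,[0,1,2,3,8,5,6,7,4]),(10,43,[])]),
([0,1,3,2,1,12,24,48,64],Branch 8 [(7,36,[]),(9,44,[])]),([0,1,3,2,1,12,24,48],Branch 6 [(7,35,[]),(8,45,[])]),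
([0,1,3,2,1,12,24,32,208],Fold [6,8,4,4,4,8]),([0,1,3,2,1,12,24,32,80,384],Fold [6,4,8,8,4,9]),
([0,1,3,2,1,12,24,32,80,128,640,1024],Branch 9 [(8,48,[]),(11,0,[9,10,11,7])]),
([0,1,3,2,1,12,24,32,80,128,640],Branch 10 [(8,48,[0,1,2,3,4,5,6,7,8,10]),(11,49,[])]),
([0,1,3,2,1,12,24,32,80,128,128,512],Branch 9 [(8,48,[]),(10,50,[])]),
([0,1,3,2,1,12,24,32,80,128,128],Branch 9 [(8,48,[]),(10,50,[]),(11,51,[])]),
([0,1,3,2,1,12,24,32,80,128],Branch 7 [(8,47,[]),(10,52,[])]),
([0,1,3,2,1,12,24,32,80],Branch 7 [(8,47,[]),(9,53,[])]),([0,1,3,2,1,12,24,32,144,448],Fold [8,9,7,7,4,5,8]),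
([0,1,0,1,6,12,16,72,160,320],Fold [0,1,2,1,4,4,6,4,6]),
([0,1,3,2,1,12,24,32,144,320,128,1024],Branch 10 [(9,56,[0,2,3,4,5,6,7,8,9,10])]),
([0,1,3,2,1,12,24,32,144,320,128],Branch 10 [(9,56,[0,2,3,4,5,6,7,8,9,10]),(11,57,[])]),
([0,1,3,2,1,12,24,32,144,320],Branch 7 [(9,55,[]),(10,58,[])]),
([0,1,3,2,1,12,8,32,144,384,576],Fold [8,9,7,10,4,9]),
([0,1,3,2,1,12,24,32,144,384,512,1024],Branch 10 [(6,60,[])]),
([0,1,3,2,1,12,24,32,144,384,512],Branch 10 [(6,60,[]),(11,61,[])]),
([0,1,3,2,1,12,24,32,144,384],Branch 9 [(6,59,[]),(10,62,[])]),
([0,1,3,2,1,12,24,32,144,256,576,1664],Fold [9,11,10,10,10,11,6,7,11]),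
([0,1,3,2,1,12,24,32,144,256,576,640],Branch 10 [(11,64,[])]),
([0,1,3,2,1,12,24,32,144,256,576,1536],Fold [10,11,9,9,9,8,11]),
([0,1,3,2,1,12,24,32,144,256,576,512],Branch 11 [(7,65,[]),(10,66,[])]),
([0,1,3,2,1,12,24,32,144,256,640,512],Branch 6 [(10,67,[]),(11,67,[0,1,2,3,4,5,6,7,8,9,11,10])]),
([0,1,3,2,1,12,24,32,144,256,512,1536],Branch 10 [(6,67,[]),(7,68,[])]),
([0,1,3,2,1,12,24,32,144,256,512,512],Branch 10 [(6,67,[]),(7,68,[]),(11,69,[])]),
([0,1,3,2,1,12,24,32,144,256,512],Branch 9 [(6,59,[]),(7,63,[]),(11,70,[])]),
([0,1,3,2,1,12,24,32,144,256],Branch 9 [(6,59,[]),(7,63,[]),(10,71,[])]),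
([0,1,3,2,1,12,24,32,144],Branch 8 [(6,54,[]),(9,72,[])]),([0,1,3,2,1,12,8,32,16,384,832],Fold [8,9,10,10,4,9]),
([0,1,3,2,1,12,24,32,16,384,320,640],Fold [7,11,9,9,9,11,8]),
([0,1,3,2,1,12,24,32,16,384,320,1536],Branch 11 [(7,75,[])]),
([0,1,3,2,1,12,24,32,16,384,320,512],Branch 11 [(7,75,[]),(10,76,[])]),
([0,1,3,2,1,12,24,32,16,384,320],Branch 9 [(10,74,[]),(11,77,[])]),
([0,1,3,2,1,12,24,32,16,256,832,128],Branch 7 [(9,74,[])]),
([0,1,3,2,1,12,24,32,16,256,832],Branch 7 [(9,74,[]),(11,79,[])]),
([0,1,3,2,1,12,24,32,16,256,320,512],Branch 9 [(7,78,[]),(10,80,[])]),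
([0,1,3,2,1,12,24,32,16,256,320],Branch 9 [(7,78,[]),(10,80,[]),(11,81,[])]),
([0,1,3,2,1,12,24,32,16,256,896,576],Fold [8,10,9,8,10,10,9]),
([0,1,3,2,1,12,24,32,16,256,896,640],Branch 11 [(6,83,[])]),
([0,1,3,2,1,12,24,32,16,256,896,512],Branch 11 [(6,83,[]),(7,84,[])]),
([0,1,3,2,1,12,24,32,16,256,896],Branch 9 [(6,82,[0,1,2,3,4,5,6,7,8,10,9]),(7,0,[9,10,8,7]),(11,85,[])]),
([0,1,3,2,1,12,24,32,16,384,384,1024],Branch 9 [(6,82,[0,1,2,3,4,5,6,7,8,10,9]),(11,21,[8,9,10,11,7])]),
([0,1,3,2,1,12,24,32,16,256,384,1536],Branch 9 [(6,82,[0,1,2,3,4,5,6,7,8,10,9]),(7,21,[8,9,10,11,7])]),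
([0,1,3,2,1,12,24,32,16,256,384,1024],Branch 9 [(6,82,[0,1,2,3,4,5,6,7,8,10,9]),(7,87,[]),(11,88,[])]),
([0,1,3,2,1,12,24,32,16,256,384],Branch 10 [(6,82,[]),(9,86,[]),(11,89,[])]),
([0,1,3,2,1,12,24,32,16,256,768,512],Branch 10 [(6,82,[]),(7,90,[]),(11,0,[9,10,8,11])]),
([0,1,3,2,1,12,24,32,16,256,768],Branch 9 [(6,82,[0,1,2,3,4,5,6,7,8,10,9]),(7,90,[0,1,2,3,4,5,6,7,8,10,9]),(11,91,[])]),
([0,1,3,2,1,12,24,32,16,256,256,1024],Branch 10 [(6,82,[]),(7,90,[]),(9,92,[])]),
([0,1,3,2,1,12,24,32,16,256,256],Branch 10 [(6,82,[]),(7,90,[]),(9,92,[]),(11,93,[])]),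
([0,1,3,2,1,12,24,32,16,256],Branch 8 [(6,54,[]),(7,73,[]),(10,94,[])]),
([0,1,3,2,1,12,24,32,16],Branch 8 [(6,54,[]),(7,73,[]),(9,95,[])]),
([0,1,3,2,1,12,24,32],Branch 4 [(7,46,[]),(8,96,[])]),([0,1,3,2,1,12,8,32,80,400],Fold [8,9,4,8,4,9]),
([0,1,3,2,0,12,8,96,80,144,768],Fold [0,2,1,5,4,3,7,6,9,8]),
([0,1,3,2,1,12,8,96,80,144,512,1024],Branch 10 [(8,99,[0,1,2,3,10,5,6,7,8,9,4])]),
([0,1,3,2,1,12,8,96,80,144,512],Branch 10 [(8,99,[]),(11,100,[])]),
([0,1,3,2,1,12,8,96,80,144],Branch 9 [(8,98,[]),(10,101,[])]),([0,1,3,2,1,12,8,96,80,272],Fold [9,4,8,8,4,6]),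
([0,1,3,2,1,12,8,96,80,16,640,768],Branch 11 [(10,97,[10,11,9,8,7,4,6,0])]),
([0,1,3,2,1,12,8,96,16,384,768],Fold [8,9,10,7,4,9]),
([0,1,3,2,1,12,8,96,80,16,640,512],Branch 11 [(8,104,[]),(10,105,[0,1,2,3,4,5,6,7,9,10,11])]),
([0,1,3,2,1,12,8,96,80,16,768,512],Branch 7 [(10,106,[]),(11,106,[0,1,2,3,4,5,6,7,8,9,11,10])]),
([0,1,3,2,1,12,8,96,80,16,512,1536],Branch 10 [(7,105,[0,1,2,3,4,5,6,7,9,10,11]),(8,107,[])]),
([0,1,3,2,1,12,8,96,80,16,512,512],Branch 10 [(7,106,[]),(8,107,[]),(11,108,[])]),
([0,1,3,2,1,12,8,96,80,16,512],Branch 9 [(7,102,[]),(8,103,[]),(11,109,[])]),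
([0,1,3,2,1,12,8,96,80,16],Branch 9 [(7,102,[]),(8,103,[]),(10,110,[])]),
([0,1,3,2,12,8,48,96],Fold [0,2,1,4,3,6,5]),([0,1,3,2,1,12,8,96,16,272,320,640],Fold [8,9,4,4,4,8,8,9]),
([0,1,3,2,1,12,8,96,16,272,320,128],Branch 9 [(10,0,[8,9,10,4]),(11,113,[])]),
([0,1,3,2,1,12,8,96,16,272,64,128],Branch 8 [(10,114,[]),(11,114,[0,2,1,5,4,3,7,6,8,9,11,10])]),
([0,1,3,2,1,12,8,96,16,16,832,640],Branch 11 [(8,21,[10,8,9,11])]),
([0,1,3,2,1,12,8,96,16,16,576,640],Branch 10 [(8,116,[]),(11,74,[0,1,2,3,4,5,6,7,9,11])]),
([0,1,3,2,1,12,8,96,16,16,576,128],Branch 9 [(8,115,[]),(11,117,[])]),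
([0,1,3,2,1,12,8,96,16,16,64,128],Branch 9 [(8,115,[]),(10,118,[]),(11,118,[0,2,1,5,4,3,7,6,8,9,11,10])]),
([0,1,3,2,1,12,8,96,16,16,64],Branch 7 [(8,111,[0,2,1,5,4,3,7,6]),(9,111,[0,2,1,5,4,3,7,6,9,8]),(10,112,[0,1,2,3,5,6,7,10]),(11,119,[])]),
([0,1,3,2,1,12,8,96,16,16],Branch 6 [(8,111,[]),(9,111,[0,1,2,3,4,5,6,7,9,8]),(10,120,[])]),
([0,1,3,2,1,12,8,32,80,208,384,1024],Branch 11 []),([0,1,3,2,1,12,8,32,80,208,384],Branch 10 [(11,122,[])]),
([0,1,3,2,1,12,8,32,80,208,256,1024],Branch 10 [(7,123,[])]),
([0,1,3,2,1,12,8,32,80,208,256],Branch 10 [(7,123,[]),(11,124,[])]),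
([0,1,3,2,1,12,8,32,80,208],Branch 8 [(7,21,[4,8,9,6,7]),(10,125,[])]),
([0,1,3,2,1,12,8,32,80,80,640,1280],Branch 11 [(7,2,[10,7,11,4,9,8])]),
([0,1,3,2,1,12,8,32,80,80,640,256],Branch 10 [(11,127,[])]),
([0,1,3,2,1,12,8,32,80,80,512,1280],Branch 11 [(7,128,[0,1,2,3,4,5,6,7,9,8,11,10])]),
([0,1,3,2,1,12,8,32,80,80,512,256],Branch 10 [(7,128,[]),(11,129,[])]),
([0,1,3,2,1,12,8,32,80,80,512],Branch 8 [(7,126,[0,1,2,3,4,5,6,7,9,8]),(10,21,[10,8,9,4,6]),(11,130,[])]),
([0,1,3,2,1,12,8,32,80,80],Branch 9 [(7,126,[]),(8,0,[8,9,4,6]),(10,131,[])]),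
([0,1,3,2,1,12,8,32,80,448],Fold [8,9,6,8,4,9]),
([0,1,1,2,1,4,8,32,80,144,192,1792],Fold [0,1,2,3,4,5,1,2,0,0,0,1]),
([0,1,3,2,1,12,8,32,80,144,192,1280],Branch 11 [(9,134,[])]),
([0,1,3,2,1,12,8,32,80,144,192,256],Branch 10 [(9,133,[0,2,1,5,4,3,7,6,9,10]),(11,135,[])]),
([0,1,3,2,1,12,8,32,80,144,192],Branch 8 [(9,98,[]),(10,133,[0,1,2,3,4,5,6,7,8,10]),(11,136,[])]),
([0,1,3,2,1,4,8,32,80,144,576,1408],Fold [0,1,2,3,4,5,1,2,0,0,2,1]),
([0,1,3,2,1,12,8,32,80,144,576,1152],Branch 8 [(11,138,[])]),
([0,1,3,2,1,12,8,32,80,144,576,128],Branch 10 [(8,60,[0,2,1,5,4,3,7,6,8,10,9]),(11,139,[])]),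
([0,1,3,2,1,12,8,32,80,144,64,640],Branch 11 [(8,60,[0,1,2,3,4,5,6,7,9,11,8]),(10,60,[0,1,2,3,4,5,6,7,9,11])]),
([0,1,3,2,1,12,8,32,80,144,64,128],Branch 9 [(8,98,[]),(10,140,[]),(11,141,[])]),
([0,1,3,2,1,12,8,32,80,144,64],Branch 7 [(8,132,[0,2,1,5,4,3,7,6]),(10,137,[]),(11,142,[])]),
([0,1,3,2,1,4,8,32,80,272,192,1664],Fold [0,1,2,3,1,5,1,2,0,2,0,1]),
([0,1,3,2,1,12,8,32,80,272,192,640],Branch 10 [(11,144,[])]),
([0,1,3,2,1,12,8,32,80,272,192,1152],Branch 11 [(9,144,[])]),
([0,1,3,2,1,12,8,32,80,272,192,128],Branch 11 [(9,145,[]),(10,146,[])]),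
([0,1,3,2,1,12,8,32,80,272,192],Branch 7 [(9,98,[]),(11,147,[])]),
([0,1,3,2,1,12,8,32,80,272,64,128],Branch 7 [(9,98,[]),(10,148,[])]),
([0,1,3,2,1,12,8,32,80,272,64],Branch 7 [(9,98,[]),(10,148,[]),(11,149,[])]),
([0,1,3,2,1,4,8,32,80,16,704,896],Fold [0,1,2,3,1,5,1,2,0,2,0,1]),
([0,1,3,2,1,12,8,32,80,16,576,896],Branch 10 [(7,151,[])]),
([0,1,3,2,1,12,8,32,80,16,576,640],Branch 11 [(8,152,[]),(10,74,[0,1,2,3,4,5,6,7,9,11])]),
([0,1,3,2,1,12,8,32,80,16,576,768],Branch 11 [(7,153,[]),(10,34,[9,11,10,8,4,6])]),
([0,1,3,2,1,12,8,32,80,16,576,1536],Branch 11 [(7,74,[0,1,2,3,4,5,6,7,9,11]),(8,34,[9,11,10,8,4,6])]),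
([0,1,3,2,1,12,8,32,80,16,576,512],Branch 11 [(7,153,[]),(8,154,[]),(10,155,[])]),
([0,1,3,2,1,12,8,32,80,16,576],Branch 9 [(7,143,[]),(8,150,[]),(11,156,[])]),
([0,1,3,2,1,12,8,32,80,16,64,512],Branch 9 [(7,143,[]),(8,150,[]),(10,157,[])]),
([0,1,3,2,1,12,8,32,80,16,64],Branch 9 [(7,143,[]),(8,150,[]),(10,157,[]),(11,158,[])]),
([0,1,3,2,1,12,8,32,80,16],Branch 6 [(7,121,[]),(9,132,[]),(10,159,[])]),
([0,1,3,2,1,12,8,32,16,16,192,64],Branch 7 [(8,160,[0,2,1,5,4,3,7,6]),(9,160,[0,2,1,5,4,3,7,6,9,8]),(11,36,[0,1,2,3,10,5,6,7,11])]),
([0,1,3,2,1,12,8,32,16,16,64,64],Branch 7 [(8,160,[0,2,1,5,4,3,7,6]),(9,160,[0,2,1,5,4,3,7,6,9,8]),(10,161,[]),(11,161,[0,1,2,3,4,5,6,7,8,9,11,10])]),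
([0,1,3,2,1,12,8,32,16,16,64],Branch 6 [(7,121,[]),(8,160,[]),(9,160,[0,1,2,3,4,5,6,7,9,8]),(11,162,[])]),
([0,1,3,2,1,12,8,32,16,16],Branch 6 [(7,121,[]),(8,160,[]),(9,160,[0,1,2,3,4,5,6,7,9,8]),(10,163,[])]),
([0,1,3,2,1,12,8,32,16],Branch 4 [(6,97,[]),(7,97,[0,2,1,5,4,3,7,6]),(9,164,[])]),
([0,1,3,2,1,12,8,32],Branch 4 [(6,97,[]),(7,97,[0,2,1,5,4,3,7,6]),(8,165,[])]),
([0,1,3,2,1,12,8],Branch 5 [(4,34,[0,2,1,5,4,3]),(6,14,[0,1,2,3,5,6]),(7,166,[])]),
([0,1,3,2,1,12],Branch 3 [(4,34,[]),(6,167,[])]),([0,1,3,0,1,4,40,48,88],Fold [2,1,0,3,5,4,8,7,6]),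
([0,1,3,2,0,4,40,48,24,384],Fold [0,2,1,5,4,3,6,8,7]),
([0,1,3,2,1,0,40,48,24,0,640,1600],Fold [1,0,2,4,3,5,7,6,8,9,11,10]),
([0,1,3,2,1,4,40,48,24,256,128,1600],Branch 9 [(10,171,[])]),
([0,1,3,2,1,4,40,48,24,256,128,576],Branch 11 [(10,172,[])]),
([0,1,3,2,1,4,40,48,24,256,128,64],Branch 11 [(9,173,[]),(10,173,[0,2,1,5,4,3,6,8,7,10,9])]),
([0,1,3,2,1,4,40,48,24,256,128],Branch 6 [(9,170,[1,0,2,4,9,5,7,6,8,3]),(10,170,[2,0,1,4,10,3,8,6,7,5]),(11,174,[])]),
([0,1,3,2,1,4,40,48,24,256],Branch 7 [(6,169,[0,2,1,5,4,3,6,8,7]),(9,170,[]),(10,175,[])]),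
([0,1,3,2,1,4,40,48,24],Branch 8 [(6,169,[]),(7,169,[1,0,2,4,3,5,7,6]),(9,176,[])]),
([0,1,3,2,1,4,40,48,72,400],Fold [3,8,6,3,8,5,6,6,8,3]),([0,1,3,2,1,4,40,48,72,272,640],Fold [3,8,6,3,8,8,6,9]),
([0,1,3,2,1,4,40,48,72,272,512,1024],Branch 10 [(7,179,[])]),
([0,1,3,2,1,4,40,48,72,272,512],Branch 10 [(7,179,[]),(11,180,[])]),
([0,1,3,2,1,4,40,48,72,272],Branch 9 [(7,178,[]),(10,181,[])]),
([0,1,3,2,1,4,40,48,72,144,768],Fold [3,8,6,3,6,8,6,3,8,8]),
([0,1,3,2,1,4,40,48,72,144,256,1024],Branch 10 [(9,183,[])]),
([0,1,3,2,1,4,40,48,72,144,256],Branch 10 [(9,183,[]),(11,184,[])]),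
([0,1,3,2,1,4,40,48,72,16,768,640],Branch 10 [(11,168,[10,9,11,4,8,7])]),
([0,1,3,2,1,4,40,48,72,16,768,1536],Branch 7 [(11,168,[10,9,11,4,8,7])]),
([0,1,3,2,1,4,40,48,72,16,768,512],Branch 11 [(7,186,[]),(10,187,[])]),
([0,1,3,2,1,4,40,48,72,16,768],Branch 9 [(7,185,[]),(11,188,[])]),
([0,1,3,2,1,4,40,48,72,16,256,512],Branch 9 [(7,185,[]),(10,189,[])]),
([0,1,3,2,1,4,40,48,72,16,256],Branch 9 [(7,185,[]),(10,189,[]),(11,190,[])]),
([0,1,3,2,1,4,40,48,72,16],Branch 8 [(7,168,[3,8,6,7,1]),(9,182,[]),(10,191,[])]),
([0,1,3,2,1,4,40,48,136,272,576,1024],Branch 11 []),([0,1,3,2,1,4,40,48,136,272,576],Branch 10 [(11,193,[])]),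
([0,1,3,2,1,4,40,48,136,272,64,1024],Branch 10 [(9,194,[])]),
([0,1,3,2,1,4,40,48,136,272,64],Branch 10 [(9,194,[]),(11,195,[])]),
([0,1,3,2,1,4,40,48,136,272],Branch 6 [(9,56,[5,2,1,6,0,3,4,9,8,7]),(10,196,[])]),
([0,1,3,2,1,0,40,48,136,80,768],Fold [1,0,2,4,3,5,7,6,9,8]),
([0,1,3,2,1,4,40,48,136,80,256,1024],Branch 10 [(9,198,[0,1,2,3,4,10,8,9,6,7,5])]),
([0,1,3,2,1,4,40,48,136,80,256],Branch 10 [(9,198,[]),(11,199,[])]),
([0,1,3,2,1,4,40,48,136,16,768,1600],Fold [9,11,10,9,4,11,10,9,11]),
([0,1,3,2,1,4,40,48,136,16,768,576],Branch 10 [(11,201,[])]),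
([0,1,3,2,1,4,40,48,136,16,768,1536],Branch 6 [(11,202,[])]),
([0,1,3,2,1,4,40,48,136,16,768,512],Branch 11 [(6,202,[]),(10,203,[])]),
([0,1,3,2,1,4,40,48,136,16,768],Branch 9 [(6,198,[0,1,2,3,4,10,8,9,6,7,5]),(11,204,[])]),
([0,1,3,2,1,4,40,48,136,16,256,512],Branch 9 [(6,200,[]),(10,205,[])]),
([0,1,3,2,1,4,40,48,136,16,256],Branch 9 [(6,200,[]),(10,205,[]),(11,206,[])]),
([0,1,3,2,1,4,40,48,136,16],Branch 8 [(6,168,[3,8,6,7,1]),(9,197,[]),(10,207,[])]),
([0,1,3,2,1,4,32,32,8,272,768,1216],Fold [9,8,10,3,4,11]),
([0,1,3,2,1,4,40,48,8,272,768,1088],Branch 11 [(7,209,[])]),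
([0,1,3,2,1,4,40,48,8,272,768,1024],Branch 11 [(6,210,[]),(7,210,[1,0,2,4,3,5,7,6,9,8])]),
([0,1,3,2,1,4,40,48,8,272,768],Branch 10 [(6,168,[9,8,10,3,4,6]),(7,168,[8,9,10,4,3,7]),(11,211,[])]),
([0,1,3,2,1,4,40,48,8,272,384,1600],Fold [0,1,2,0,1,5,2,2,1,0,0,1]),
([0,1,3,2,1,4,40,48,8,272,384,576],Branch 10 [(11,213,[])]),
([0,1,3,2,1,4,40,48,8,272,256,1600],Branch 10 [(7,214,[])]),
([0,1,3,2,1,4,40,48,8,272,256,576],Branch 10 [(7,214,[]),(11,215,[])]),
([0,1,1,2,1,4,40,16,8,272,320,1664],Fold [0,1,2,0,4,5,2,7,4,9,0,4]),
([0,1,3,2,1,4,40,48,8,272,320,640],Branch 10 [(11,217,[])]),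
([0,1,3,2,1,4,40,48,8,272,256,640],Branch 6 [(10,218,[]),(11,216,[])]),
([0,1,3,2,1,4,40,48,8,272,256,1536],Branch 11 [(6,216,[]),(7,219,[])]),
([0,1,3,2,1,4,40,48,8,272,256,512],Branch 11 [(6,216,[]),(7,219,[]),(10,220,[])]),
([0,1,3,2,1,4,40,48,8,272,256],Branch 9 [(6,208,[1,0,2,4,3,5,7,6,9,8]),(7,192,[1,0,2,4,3,5,7,6,9,8]),(10,212,[]),(11,221,[])]),
([0,1,3,2,1,4,40,48,8,272],Branch 8 [(6,192,[]),(7,208,[]),(10,222,[])]),
([0,0,0,5,6,1,2,104,112],Fold [0,1,2,3,4,3,4,2,2]),
([0,1,3,2,1,4,40,48,8,16,832,768],Branch 7 [(11,224,[3,4,5,6,7,8,9,10,11])]),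
([0,1,3,2,1,4,40,48,8,16,768,768],Branch 10 [(6,225,[]),(7,225,[1,0,2,4,3,5,7,6,9,8]),(11,0,[10,11,8,9])]),
([0,1,3,2,1,4,40,48,8,16,768,256],Branch 9 [(6,208,[1,0,2,4,3,5,7,6,9,8]),(7,192,[1,0,2,4,3,5,7,6,9,8]),(11,226,[])]),
([0,1,3,2,1,4,40,48,8,16,256,256],Branch 9 [(6,208,[1,0,2,4,3,5,7,6,9,8]),(7,192,[1,0,2,4,3,5,7,6,9,8]),(10,227,[]),(11,227,[0,1,2,3,4,5,6,7,8,9,11,10])]),
([0,1,3,2,1,4,40,48,8,16,256],Branch 8 [(6,192,[]),(7,208,[]),(9,223,[]),(11,228,[])]),
([0,1,3,2,1,4,40,48,8,16],Branch 8 [(6,192,[]),(7,208,[]),(9,223,[]),(10,229,[])]),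
([0,1,3,2,1,4,40,48,8],Branch 4 [(6,2,[0,1,2,6,4,5,7]),(8,177,[]),(9,230,[])]),
([0,1,3,2,1,4,40,96,8,272,272,1152],Branch 9 [(11,21,[8,9,10,11])]),
([0,1,3,2,1,4,40,96,8,272,272,128],Branch 10 [(9,0,[9,10,8,4]),(11,232,[])]),
([0,1,3,2,1,4,40,96,8,272,768,144],Branch 10 [(11,168,[8,9,10,4,3,11])]),
([0,1,3,2,1,4,40,96,8,272,256,1168],Branch 9 [(10,168,[8,9,10,4,3,11])]),
([0,1,3,2,1,4,40,96,8,272,256,144],Branch 10 [(9,234,[]),(11,235,[])]),
([0,1,3,2,1,4,40,96,8,272,256,128],Branch 4 [(10,233,[]),(11,236,[])]),
([0,1,3,2,1,4,40,96,8,256,256,144],Branch 4 [(9,237,[]),(10,237,[0,1,2,3,4,5,6,7,8,10,9])]),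
([0,1,3,2,1,4,40,96,8,256,256,128],Branch 4 [(9,237,[]),(10,237,[0,1,2,3,4,5,6,7,8,10,9]),(11,238,[])]),
([0,1,3,2,1,4,40,96,8,256,256],Branch 7 [(4,231,[]),(9,231,[7,5,6,2,9,3,1,8,0]),(10,231,[7,5,6,2,10,3,1,8,0]),(11,239,[])]),
([0,1,3,2,1,4,40,96,8,256],Branch 8 [(4,231,[0,2,1,5,4,3,6,8,7]),(7,168,[5,6,7,3,2,8]),(10,240,[])]),
([0,1,3,2,1,4,40,96,8],Branch 8 [(4,231,[0,2,1,5,4,3,6,8,7]),(7,168,[5,6,7,3,2,8]),(9,241,[])]),
([0,1,3,2,1,4,56,32,136,128,272,512],Branch 9 [(10,170,[1,0,2,4,8,5,6,7,10])]),
([0,1,3,2,1,4,56,32,136,128,272],Branch 9 [(10,170,[1,0,2,4,8,5,6,7,10]),(11,243,[])]),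
([0,1,3,2,1,4,40,32,136,208,272,1024],Branch 11 []),([0,1,3,2,1,4,40,32,136,208,272],Branch 10 [(11,245,[])]),
([0,1,3,2,0,4,40,32,136,144,272,1536],Fold [0,2,1,5,4,3,6,8,7,10,9]),
([0,1,3,2,1,4,40,32,136,144,272,512],Branch 10 [(6,246,[0,2,1,5,4,3,6,8,7,10,9]),(11,247,[])]),
([0,1,3,2,1,4,40,32,136,144,272],Branch 9 [(6,246,[]),(10,168,[4,9,10,7,0,8]),(11,248,[])]),
([0,1,3,2,1,4,40,32,8,192,272,1552],Fold [10,4,11,10,4,9,11]),
([0,1,3,2,1,4,40,32,136,192,272,528],Branch 11 [(10,250,[])]),
([0,1,3,2,1,4,40,32,136,192,272,1040],Branch 9 [(11,250,[])]),
([0,1,3,2,1,4,40,32,136,192,272,16],Branch 11 [(9,251,[]),(10,252,[])]),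
([0,1,3,2,1,4,40,32,136,128,784,528],Branch 6 [(11,56,[0,1,6,4,3,11,8,10,9,7])]),
([0,1,3,2,1,4,40,32,136,128,784,16],Branch 9 [(6,253,[]),(11,254,[])]),
([0,1,3,2,1,4,40,32,136,128,272,528],Branch 9 [(6,253,[]),(10,255,[])]),
([0,1,3,2,1,4,40,32,136,128,272,16],Branch 9 [(6,253,[]),(10,255,[]),(11,256,[])]),
([0,1,3,2,1,4,40,32,136,128,272],Branch 4 [(6,244,[]),(9,249,[]),(11,257,[])]),
([0,1,3,2,1,4,40,32,136,128,320,16],Branch 4 [(9,258,[0,2,1,5,4,3,6,8,7,10,9]),(10,258,[])]),
([0,1,3,2,1,4,40,32,136,128,320],Branch 4 [(9,258,[0,2,1,5,4,3,6,8,7,10,9]),(10,258,[]),(11,259,[])]),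
([0,1,3,2,4,24,16,72,64,384,768],Fold [0,2,1,4,3,5,7,6,9,8]),
([0,1,3,2,1,4,40,32,136,128,768,1024],Branch 9 [(4,258,[0,2,1,5,4,3,6,8,7,10,9]),(6,260,[0,2,1,5,4,3,6,8,7,10,9]),(11,261,[0,1,2,3,5,6,7,8,9,10,11])]),
([0,1,3,2,1,4,40,32,136,128,768],Branch 10 [(4,258,[]),(6,260,[]),(11,262,[])]),
([0,1,3,2,1,4,40,32,136,128,256,1024],Branch 10 [(4,258,[]),(6,260,[]),(9,263,[])]),
([0,1,3,2,1,4,40,32,136,128,256],Branch 10 [(4,258,[]),(6,260,[]),(9,263,[]),(11,264,[])]),
([0,1,3,2,1,4,40,32,136,128],Branch 8 [(4,231,[0,2,1,5,4,3,6,8,7]),(6,168,[3,8,6,7,1]),(9,169,[1,0,2,9,3,5,7,6]),(10,265,[])]),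
([0,1,3,2,1,4,40,32,136],Branch 7 [(4,231,[]),(6,168,[5,6,7,3,2,8]),(9,266,[])]),
([0,1,3,2,1,4,8,32,8,400,144,1344],Fold [0,1,2,3,2,5,6,2,1,0,1,3]),
([0,1,3,2,1,4,40,32,8,400,144,320],Branch 10 [(11,268,[])]),
([0,1,3,2,1,4,40,32,8,400,144,256],Branch 6 [(10,56,[0,1,8,4,3,9,6,10,7,5]),(11,269,[])]),
([0,1,3,2,1,4,40,32,8,384,656,336],Fold [9,10,7,9,7,5,7,7,8,9,10,9]),
([0,1,3,2,1,4,40,32,8,384,144,336],Branch 10 [(9,271,[])]),
([0,1,3,2,1,4,40,32,8,384,144,784],Branch 6 [(10,272,[0,2,1,5,4,3,6,8,7,9,11,10])]),
([0,1,3,2,1,4,40,32,8,384,144,272],Branch 11 [(6,272,[]),(9,273,[]),(10,171,[1,2,0,5,3,9,7,8,6,4,11,10])]),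
([0,1,3,2,1,4,40,32,8,384,144,256],Branch 4 [(6,267,[1,0,2,4,3,5,6,7,10]),(9,270,[]),(11,274,[])]),
([0,1,3,2,1,4,40,32,8,384,192,1280],Branch 11 [(4,275,[0,2,1,5,4,3,6,8,7,9,11,10]),(9,168,[8,11,9,10,3,7])]),
([0,1,3,2,1,4,40,32,8,384,192,256],Branch 10 [(4,275,[]),(9,168,[9,10,7,6,8]),(11,276,[])]),
([0,1,3,2,1,4,40,32,8,384,640,256],Branch 10 [(4,275,[]),(6,168,[9,10,7,6,8]),(11,168,[7,9,10,8,5,11])]),
([0,1,3,2,1,4,40,32,8,384,128,1280],Branch 11 [(4,275,[0,2,1,5,4,3,6,8,7,9,11,10]),(6,277,[0,2,1,5,4,3,6,8,7,9,11,10]),(9,168,[8,11,9,10,3,7])]),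
([0,1,3,2,1,4,40,32,8,384,128,256],Branch 10 [(4,275,[]),(6,277,[]),(9,278,[]),(11,279,[])]),
([0,1,3,2,1,4,40,32,8,384,128],Branch 8 [(4,231,[0,2,1,5,4,3,6,8,7]),(6,231,[8,3,6,1,9,5,2,7,0]),(10,170,[0,1,2,3,9,5,6,7,8,10]),(11,280,[])]),
([0,1,3,2,1,4,40,32,8,128,128,256],Branch 8 [(4,231,[0,2,1,5,4,3,6,8,7]),(6,242,[0,2,1,5,4,3,6,8,7]),(9,281,[]),(10,281,[0,1,2,3,4,5,6,7,8,10,9])]),
([0,1,3,2,1,4,40,32,8,128,128],Branch 8 [(4,231,[0,2,1,5,4,3,6,8,7]),(6,242,[0,2,1,5,4,3,6,8,7]),(9,281,[]),(10,281,[0,1,2,3,4,5,6,7,8,10,9]),(11,282,[])]),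
([0,1,3,2,1,4,40,32,8,128],Branch 7 [(4,231,[]),(6,242,[]),(8,267,[]),(10,283,[])]),
([0,1,3,2,1,4,40,32,8],Branch 7 [(4,231,[]),(6,242,[]),(8,267,[]),(9,284,[])]),
([0,1,3,2,1,4,40,32],Branch 3 [(4,168,[2,0,1,4,5,3]),(7,2,[1,0,2,6,3,5,7]),(8,285,[])]),
([0,1,3,2,1,4,32,96,136,72,16,16],Branch 9 [(8,168,[3,8,9,7,1,6]),(10,286,[5,7,6,8,2,9,3,10]),(11,286,[5,7,6,8,2,9,3,11])]),
([0,1,3,2,1,4,32,96,8,72,400,784],Fold [5,7,6,10,7,5,6,7,8,7,10,10]),
([0,1,3,2,1,4,32,96,8,72,400,272],Branch 9 [(11,288,[])]),
([0,1,3,2,1,4,32,96,8,72,400,16],Branch 8 [(9,286,[3,8,9,10,1,6,7,5]),(11,289,[])]),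
([0,1,3,2,1,4,32,96,8,328,144,1040],Fold [7,6,5,9,10,2,1,0,8,3,4]),
([0,1,3,2,1,4,32,96,8,72,144,1040],Branch 9 [(8,291,[]),(11,286,[4,10,11,7,0,9,6,3])]),
([0,1,3,2,1,4,32,96,8,72,144,16],Branch 10 [(8,290,[]),(9,168,[5,6,7,9,2,10]),(11,292,[])]),
([0,1,3,2,1,4,32,96,8,72,16,16],Branch 7 [(8,287,[]),(9,0,[6,7,9,5]),(10,293,[]),(11,293,[0,1,2,3,4,5,6,7,8,9,11,10])]),
([0,1,3,2,1,4,32,32,72,200,144,272],Branch 10 [(11,294,[1,2,0,5,3,4,10,11,6,7,8,9])]),
([0,1,3,2,1,4,32,32,72,200,144,16],Branch 11 [(8,295,[]),(10,294,[1,2,0,5,3,4,10,11,6,7,8,9])]),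
([0,1,3,2,1,4,32,32,72,200,16,16],Branch 7 [(8,21,[8,6,7,9,5]),(10,296,[]),(11,296,[0,1,2,3,4,5,6,7,8,9,11,10])]),
([0,0,0,0,5,5,42,26],Fold [0,1,2,3,5,5,6,6]),
([0,1,3,2,1,4,32,32,72,72,656,144],Branch 8 [(11,298,[3,4,6,7,8,9,10,11])]),
([0,1,3,2,1,4,32,32,72,72,656,16],Branch 7 [(8,297,[0,1,2,3,4,5,6,7,9,8]),(11,299,[])]),
([0,1,3,2,1,4,32,32,72,72,528,16],Branch 10 [(7,300,[]),(8,21,[10,8,9,3,6]),(11,294,[2,1,0,3,5,4,10,11,8,9,6,7])]),
([0,1,3,2,1,4,32,32,72,72,16,16],Branch 9 [(7,297,[]),(8,0,[8,9,3,6]),(10,301,[]),(11,301,[0,1,2,3,4,5,6,7,8,9,11,10])]),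
([0,1,3,2,1,4,32,72,208],Fold [8,7,6]),
([0,1,3,2,1,4,32,32,136,72,80,656],Branch 8 [(10,198,[0,1,2,3,4,7,8,11,9,10,6])]),
([0,1,3,2,1,4,32,32,136,72,80,144],Branch 9 [(8,286,[3,8,9,7,1,6,5,10]),(10,303,[0,1,2,3,4,5,6,9,10]),(11,304,[])]),
([0,1,3,2,1,4,32,32,136,72,80,16],Branch 7 [(9,302,[0,1,2,3,4,5,7,6]),(10,302,[1,2,0,5,3,4,10,11,6,7,8,9]),(11,305,[])]),
([0,1,3,2,1,4,32,32,8,72,80,16],Branch 7 [(8,306,[]),(9,302,[0,2,1,5,4,3,9,8,6,7]),(10,302,[1,2,0,5,3,4,10,11,6,7,8,9]),(11,306,[1,0,2,4,3,5,6,7,11,10,9,8])]),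
([0,1,3,2,1,4,32,32,8,72,16,16],Branch 6 [(7,294,[]),(8,302,[]),(10,307,[]),(11,307,[0,1,2,3,4,5,6,7,8,9,11,10])]),
([0,1,3,2,1,4,32,32,8,264,16,16],Branch 8 [(6,308,[0,1,2,3,4,5,6,7,9,8]),(7,308,[0,1,2,3,4,5,7,6,9,8]),(10,308,[2,0,1,4,5,3,8,9,11,10,6,7]),(11,308,[2,0,1,4,5,3,8,9,10,11,6,7])]),
([0,1,3,2,1,4,32,32,8,8,16,16],Branch 9 [(6,308,[]),(7,308,[0,1,2,3,4,5,7,6]),(8,309,[]),(10,308,[2,0,1,4,5,3,9,8,11,10,6,7]),(11,308,[2,0,1,4,5,3,9,8,10,11,6,7])]),
([0,1,3,2,1,4,32,32,8,8,16],Branch 4 [(6,286,[1,0,2,4,3]),(7,286,[1,0,2,4,3,5,7,6]),(8,286,[2,0,1,4,5,3,8,9]),(9,286,[2,0,1,4,5,3,9,8]),(11,310,[])]),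
([0,1,3,2,1,4,32,32,8,8],Branch 4 [(6,286,[1,0,2,4,3]),(7,286,[1,0,2,4,3,5,7,6]),(8,286,[2,0,1,4,5,3,8,9]),(9,286,[2,0,1,4,5,3,9,8]),(10,311,[])]),
([0,1,3,2,1,4,32,32,8],Branch 3 [(4,168,[2,0,1,4,5,3]),(6,286,[]),(7,286,[0,1,2,3,4,5,7,6]),(9,312,[])]),
([0,1,3,2,1,4,32,32],Branch 3 [(4,168,[2,0,1,4,5,3]),(6,286,[]),(7,286,[0,1,2,3,4,5,7,6]),(8,313,[])]),
([0,1,3,2,1,4,32],Branch 5 [(3,168,[]),(4,168,[1,0,2,4,3]),(7,314,[])]),
([0,1,3,2,1,4],Branch 5 [(3,168,[]),(4,168,[1,0,2,4,3]),(6,315,[])]),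
([0,1,3,2,1],Branch 2 [(3,0,[1,2,0]),(4,0,[0,2,1,4]),(5,316,[])]),([0,1,3,2],Branch 0 [(3,0,[]),(4,317,[])]),
([0,1,2,2,12,1,48,0,192,129,768],Fold [6,4,2,3,4,5,6,7,8,8]),
([0,1,2,2,12,5,48,8,192,129,256,1024],Branch 10 [(9,319,[0,1,2,3,4,5,6,10,8,9,7])]),
([0,1,2,2,12,5,48,8,192,129,256],Branch 10 [(9,319,[]),(11,320,[])]),
([0,1,2,2,12,5,48,8,192,129],Branch 8 [(9,318,[8,7,9]),(10,321,[])]),
([0,1,2,2,12,5,48,8,192,1,128,768],Branch 9 [(10,134,[9,10,11,7,0,8,3,6,1,5,4,2])]),
([0,1,2,2,12,5,48,8,192,1,128,1280],Branch 10 [(9,323,[0,5,2,6,4,1,3,8,7,9,11,10])]),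
([0,1,2,2,12,5,48,8,192,1,128,256],Branch 11 [(9,323,[]),(10,324,[])]),
([0,1,2,2,12,5,48,8,192,1,128],Branch 8 [(9,322,[0,5,2,6,4,1,3,8,7]),(10,318,[8,7,10]),(11,325,[])]),
([0,1,2,2,12,5,48,8,192,1],Branch 7 [(9,322,[]),(10,326,[])]),
([0,1,2,2,12,5,48,8,64,1,256,384],Branch 7 [(9,327,[6,4,2,3,1,5,0,7,9,8]),(10,319,[3,1,0,2,5,4,6,10,8,7,11])]),
([0,1,2,2,12,5,48,8,64,1,256,256],Branch 11 [(7,328,[]),(9,328,[3,1,2,0,5,4,6,9,8,7]),(10,318,[10,8,11,6])]),
([0,1,2,2,12,5,48,8,64,1,256],Branch 8 [(7,327,[]),(9,327,[3,1,2,0,5,4,6,9,8,7]),(11,329,[])]),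
([0,1,2,2,12,5,48,8,64,1],Branch 8 [(7,327,[]),(9,327,[3,1,2,0,5,4,6,9,8,7]),(10,330,[])]),
([0,1,2,2,12,5,48,8,64],Branch 0 [(7,298,[1,2,7,6,0,3,4,5]),(8,298,[8,2,5,3,0,6,4,1]),(9,331,[])]),
([0,1,2,2,12,5,48,8],Branch 6 [(0,318,[5,0,6,1]),(7,298,[0,4,2,7,1,5,6,3]),(8,332,[])]),
([0,1,0,2,12,5,17,104],Fold [3,1,2,0,5,4,7,6]),
([0,1,2,2,12,5,16,104,64,256,257,512],Branch 9 [(10,318,[9,8,10,6])]),
([0,1,2,2,12,5,16,104,64,256,257],Branch 9 [(10,318,[9,8,10,6]),(11,335,[])]),
([0,1,2,2,12,5,16,104,64,256,256,1024],Branch 10 [(0,336,[]),(9,318,[9,8,10,6])]),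
([0,1,2,2,12,5,16,104,64,256,256],Branch 10 [(0,336,[]),(9,318,[9,8,10,6]),(11,337,[])]),
([0,1,2,2,12,5,16,104,64,256],Branch 8 [(0,224,[5,7,8,0,6,2,3,1,4]),(10,338,[])]),
([0,1,2,2,12,5,16,104,64],Branch 8 [(0,224,[5,7,8,0,6,2,3,1,4]),(9,339,[])]),
([0,1,2,2,12,5,16,104],Branch 6 [(0,334,[]),(8,340,[])]),
([0,1,2,2,12,5,16,40,192,1,576,1280],Branch 11 [(9,318,[10,9,11,0])]),
([0,1,2,2,12,5,16,40,192,1,576,1024],Branch 11 [(8,342,[]),(9,318,[10,9,11,0])]),
([0,1,2,2,12,5,16,40,192,1,576],Branch 10 [(8,318,[8,6,10,4]),(11,343,[])]),
([0,1,2,2,12,5,16,40,192,1,64,1024],Branch 10 [(8,318,[8,6,10,4]),(9,344,[])]),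
([0,1,2,2,12,5,16,40,192,1,64],Branch 10 [(8,318,[8,6,10,4]),(9,344,[]),(11,345,[])]),
([0,1,2,2,12,5,16,40,192,1],Branch 6 [(9,56,[7,8,9,5,6,0,4,2,1,3]),(10,346,[])]),
([0,1,2,2,12,5,16,40,128,1,768,832],Branch 10 [(6,21,[8,10,11,9,6])]),
([0,1,2,2,12,5,16,40,128,1,256,832],Branch 9 [(6,318,[9,6,11,4]),(10,348,[])]),
([0,1,2,2,12,5,16,40,128,1,256,320],Branch 11 [(9,349,[]),(10,318,[10,8,11,7])]),
([0,1,2,2,12,5,16,40,128,1,256,256],Branch 11 [(6,350,[]),(9,350,[4,2,1,5,0,3,9,7,8,6]),(10,318,[10,8,11,7])]),
([0,1,2,2,12,5,16,40,128,1,256],Branch 8 [(6,347,[]),(9,347,[4,2,1,5,0,3,9,7,8,6]),(11,351,[])]),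
([0,1,2,2,12,5,16,40,128,1],Branch 8 [(6,347,[]),(9,347,[4,2,1,5,0,3,9,7,8,6]),(10,352,[])]),
([0,1,2,2,12,5,16,40,128],Branch 0 [(6,334,[0,6,7,4,3,5,1,2]),(8,341,[8,0,5,1,2,7,4,3]),(9,353,[])]),
([0,1,2,2,12,5,16,40],Branch 7 [(0,318,[5,0,7,1]),(6,341,[]),(8,354,[])]),
([0,1,0,2,12,5,16,8,224,193],Fold [3,1,2,0,5,4,8,9,6,7]),
([0,1,2,2,12,5,16,8,160,193,64,1024],Branch 10 [(8,56,[6,10,7,4,8,3,5,2,1,0])]),
([0,1,2,2,12,5,16,8,160,193,64],Branch 10 [(8,56,[6,10,7,4,8,3,5,2,1,0]),(11,357,[])]),
([0,1,2,2,12,5,16,8,160,193],Branch 6 [(8,356,[]),(10,358,[])]),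
([0,1,2,2,12,5,16,8,96,193,384],Fold [4,2,1,5,0,3,9,8,7,6]),
([0,1,2,2,12,5,16,8,96,193,128,1024],Branch 10 [(8,360,[])]),
([0,1,2,2,12,5,16,8,96,193,128],Branch 10 [(8,360,[]),(11,361,[])]),
([0,1,2,2,12,5,16,8,32,193,384,1024],Branch 8 [(6,362,[]),(11,318,[10,8,11,5])]),
([0,1,2,2,12,5,16,8,32,193,384],Branch 10 [(6,56,[8,10,9,5,6,0,4,2,1,3]),(11,363,[])]),
([0,1,2,2,12,5,16,8,32,193,128,256],Branch 8 [(6,362,[]),(10,364,[])]),
([0,1,2,2,12,5,16,8,32,193,128],Branch 8 [(6,362,[]),(10,364,[]),(11,365,[])]),
([0,1,2,2,12,5,16,8,32,193],Branch 7 [(6,318,[9,6,7,4]),(8,359,[]),(10,366,[])]),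
([0,1,2,2,12,5,16,8,160,65,768,192],Fold [5,2,1,4,3,0,7,6,9,8]),
([0,1,2,2,12,5,16,8,160,65,768,64],Branch 7 [(10,318,[8,7,10]),(11,368,[])]),
([0,1,2,2,12,5,16,8,160,65,512,64],Branch 8 [(10,369,[]),(11,56,[6,11,7,4,8,3,5,2,1,0])]),
([0,1,2,2,12,5,16,8,32,65,768,64],Branch 8 [(7,370,[]),(11,56,[8,11,9,5,6,0,4,2,1,3])]),
([0,1,2,2,12,5,16,8,32,65,512,64],Branch 8 [(7,370,[]),(10,371,[]),(11,56,[8,11,9,5,6,0,4,2,1,3])]),
([0,1,2,2,12,5,16,8,32,65,512],Branch 6 [(7,224,[5,7,9,0,6,2,3,1,4]),(8,367,[4,2,1,5,0,3,9,8,7,6]),(10,318,[9,6,10,4]),(11,372,[])]),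
([0,1,2,2,12,5,16,8,32,65],Branch 9 [(7,367,[]),(8,224,[3,8,6,4,9,1,5,2,0]),(10,373,[])]),
([0,1,2,2,12,5,16,72,96,385],Fold [2,4,2,6,4,5,6,8,8,5]),([0,1,2,2,12,5,16,72,32,257,320],Fold [8,10,8,6,10]),
([0,1,2,2,12,5,16,72,32,385,64,1024],Branch 10 [(8,376,[])]),
([0,1,2,2,12,5,16,72,32,385,64],Branch 10 [(8,376,[]),(11,377,[])]),
([0,1,2,2,12,5,16,72,32,385],Branch 6 [(8,375,[]),(10,378,[])]),
([0,1,2,2,12,5,16,72,32,129,768,1088],Branch 8 [(11,318,[10,8,11,5])]),
([0,1,2,2,12,5,16,72,32,129,768,1024],Branch 11 [(6,380,[]),(8,318,[10,8,11,5])]),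
([0,1,2,2,12,5,16,72,32,129,768],Branch 10 [(6,379,[1,3,4,7,6,2,10,9,5,0]),(11,381,[])]),
([0,1,2,2,12,5,16,72,32,129,512,1024],Branch 10 [(6,379,[1,3,4,7,6,2,10,9,5,0]),(8,382,[])]),
([0,1,2,2,12,5,16,72,32,129,512],Branch 10 [(6,379,[1,3,4,7,6,2,10,9,5,0]),(8,382,[]),(11,383,[])]),
([0,1,2,2,12,5,16,72,32,129],Branch 9 [(6,318,[9,6,7,4]),(8,379,[]),(10,384,[])]),
([0,1,0,2,12,5,16,8,96,129,192,1792],Fold [3,1,2,0,5,4,8,9,6,7,11,10]),
([0,1,2,2,12,5,16,8,96,129,192,1536],Branch 8 [(11,386,[])]),
([0,1,2,2,12,5,16,8,96,129,192,512],Branch 10 [(8,318,[8,6,10,4]),(11,387,[])]),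
([0,1,2,2,12,5,16,8,96,129,384,576],Fold [4,2,1,5,0,3,9,8,7,6]),
([0,1,2,2,12,5,16,8,96,129,128,576],Branch 8 [(10,389,[]),(11,318,[8,6,11,4])]),
([0,1,2,2,12,5,16,8,96,129,128,512],Branch 6 [(10,388,[]),(11,390,[])]),
([0,1,0,2,12,5,16,8,32,129,448,832],Fold [3,1,2,0,5,4,8,9,6,7,11,10]),
([0,1,2,2,12,5,16,8,32,129,448,576],Branch 8 [(11,392,[])]),
([0,1,2,2,12,5,16,8,32,129,192,576],Branch 10 [(8,393,[]),(11,318,[10,6,11,4])]),
([0,1,2,2,12,5,16,8,32,129,192,512],Branch 6 [(8,391,[]),(11,394,[])]),
([0,1,2,2,12,5,16,8,32,129,128,576],Branch 6 [(8,391,[]),(10,395,[])]),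
([0,1,2,2,12,5,16,8,32,129,128,512],Branch 6 [(8,391,[]),(10,395,[]),(11,396,[])]),
([0,1,2,2,12,5,16,8,32,129,128],Branch 9 [(6,374,[]),(8,385,[3,1,2,0,5,4,8,9,6,7]),(10,318,[9,7,10]),(11,397,[])]),
([0,1,2,2,12,5,16,8,32,129],Branch 7 [(6,385,[]),(8,374,[3,1,2,0,5,4,8,9,6,7]),(10,398,[])]),
([0,1,2,2,12,5,16,8,32,257,448,704],Fold [1,0,5,9,8,2,10,11,4,3,6,7]),
([0,1,2,2,12,5,16,8,32,257,384,704],Branch 6 [(10,400,[])]),
([0,1,2,2,12,5,16,8,32,257,256,704],Branch 7 [(6,318,[11,6,7,4]),(10,401,[])]),
([0,1,2,2,12,5,16,8,32,257,384,1600],Fold [5,8,9,10,11,0,6,7,1,2,3,4]),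
([0,1,2,2,12,5,16,8,32,257,256,1600],Branch 10 [(6,318,[10,6,11,4]),(7,403,[])]),
([0,1,2,2,12,5,16,8,32,257,256,576],Branch 11 [(7,402,[]),(10,404,[])]),
([0,1,2,2,12,5,16,8,32,257,256,640],Branch 11 [(6,405,[]),(10,376,[2,5,0,8,9,1,11,10,3,4,7])]),
([0,1,2,2,12,5,16,8,32,257,256,1536],Branch 11 [(6,405,[]),(7,376,[2,5,0,8,9,1,11,10,3,4,7])]),
([0,1,2,2,12,5,16,8,32,257,256,512],Branch 11 [(6,405,[]),(7,406,[]),(10,407,[])]),
([0,1,2,2,12,5,16,8,32,257,256],Branch 9 [(6,224,[3,8,6,4,9,1,5,2,0]),(7,399,[]),(10,318,[9,8,10,5]),(11,408,[])]),
([0,1,2,2,12,5,16,8,32,257],Branch 8 [(6,399,[4,2,1,5,0,3,9,8,7,6]),(7,224,[4,9,7,3,8,2,0,1,5]),(10,409,[])]),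
([0,1,2,2,12,5,16,8,32,1,704,640],Branch 6 [(8,399,[4,2,1,5,0,3,9,8,7,6]),(11,21,[9,10,11,6,7])]),
([0,1,2,2,12,5,16,8,32,1,640,640],Branch 10 [(6,411,[]),(8,411,[3,1,2,0,5,4,8,9,6,7]),(11,318,[11,7,10])]),
([0,1,2,2,12,5,16,8,32,1,640,512],Branch 7 [(6,410,[3,1,2,0,5,4,8,9,6,7]),(8,374,[3,1,2,0,5,4,8,9,6,7]),(11,412,[])]),
([0,1,2,2,12,5,16,8,32,1,512,512],Branch 7 [(6,410,[3,1,2,0,5,4,8,9,6,7]),(8,374,[3,1,2,0,5,4,8,9,6,7]),(10,413,[]),(11,413,[0,1,2,3,4,5,6,7,8,9,11,10])]),
([0,1,2,2,12,5,16,8,32,1,512],Branch 9 [(6,374,[]),(7,399,[]),(8,410,[]),(11,414,[])]),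
([0,1,2,2,12,5,16,8,32,1],Branch 9 [(6,374,[]),(7,399,[]),(8,410,[]),(10,415,[])]),
([0,1,2,2,12,5,16,8,32],Branch 0 [(6,355,[3,1,2,0,5,4,8,6]),(7,333,[7,0,1,5,2,3,4,8]),(8,318,[8,0,5,1]),(9,416,[])]),
([0,1,2,2,12,5,16,8],Branch 5 [(6,333,[]),(7,355,[]),(8,417,[])]),
([0,1,2,2,12,4,17,40,1,352,384,1024],Branch 11 []),([0,1,2,2,12,4,17,40,1,352,384],Branch 10 [(11,419,[])]),
([0,1,2,2,12,4,17,40,1,96,384,256],Branch 10 [(9,420,[7,3,4,1,2,6,5,0,10,9,8]),(11,318,[10,8,11,0])]),
([0,1,2,2,12,4,17,40,1,96,384],Branch 8 [(9,420,[]),(11,421,[])]),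
([0,1,2,2,12,4,17,40,1,96,640,256],Branch 8 [(10,422,[])]),
([0,1,2,2,12,4,17,40,1,96,640],Branch 8 [(10,422,[]),(11,423,[])]),
([0,1,2,2,12,4,17,40,1,96,128,1024],Branch 10 [(8,422,[]),(9,424,[])]),
([0,1,2,2,12,4,17,40,1,96,128],Branch 10 [(8,422,[]),(9,424,[]),(11,425,[])]),
([0,1,2,2,12,4,17,40,1,96],Branch 7 [(8,356,[0,8,9,7,5,6,2,3,4,1]),(9,318,[9,5,7,2]),(10,426,[])]),
([0,1,2,2,12,4,17,8,33,224,384,1024],Branch 11 []),([0,1,2,2,12,4,17,8,33,224,384],Branch 10 [(11,428,[])]),
([0,1,2,2,12,4,17,8,33,224,256,1024],Branch 10 [(7,429,[])]),
([0,1,2,2,12,4,17,8,33,224,256],Branch 10 [(7,429,[]),(11,430,[])]),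
([0,1,2,2,12,4,17,8,33,224],Branch 8 [(7,298,[1,8,4,9,2,3,7,5]),(10,431,[])]),
([0,1,2,2,12,4,17,8,33,96,640,384],Branch 10 [(11,318,[11,7,10])]),
([0,1,2,2,12,4,17,8,33,96,640,128],Branch 11 [(8,433,[]),(10,318,[11,7,10])]),
([0,1,2,2,12,4,17,8,33,96,640],Branch 7 [(8,432,[6,4,2,3,1,5,0,7,9,8]),(11,434,[])]),
([0,1,2,2,12,4,17,8,33,96,512,128],Branch 7 [(8,432,[6,4,2,3,1,5,0,7,9,8]),(10,435,[])]),
([0,1,2,2,12,4,17,8,33,96,512],Branch 7 [(8,432,[6,4,2,3,1,5,0,7,9,8]),(10,435,[]),(11,436,[])]),
([0,1,2,2,12,4,17,8,33,96],Branch 9 [(7,432,[]),(8,318,[8,5,9,2]),(10,437,[])]),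
([0,1,2,2,12,4,17,8,1,96,416,896],Fold [5,10,8,7,11,0,9,3,2,6,1,4]),
([0,1,2,2,12,4,17,8,1,96,416,384],Branch 9 [(11,439,[])]),
([0,1,2,2,12,4,17,8,1,96,416,256],Branch 7 [(9,298,[1,9,4,10,2,3,7,5]),(11,440,[])]),
([0,1,2,2,12,4,17,8,1,96,416],Branch 8 [(7,318,[8,7,10]),(9,418,[10,8,9,0,6,5,4,1]),(11,441,[])]),
([0,1,2,2,12,4,17,8,129,96,160,1280],Branch 11 [(9,418,[7,10,11,5,9,8,6,2])]),
([0,1,2,2,12,4,17,8,129,96,160,1024],Branch 11 [(8,443,[]),(9,443,[6,4,3,2,1,7,0,5,9,8])]),
([0,1,2,2,12,4,17,8,1,96,160,1024],Branch 7 [(8,444,[]),(9,298,[1,9,4,10,2,3,7,5]),(11,318,[11,7,10])]),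
([0,1,2,2,12,4,17,8,1,96,160],Branch 10 [(8,442,[]),(9,318,[9,5,10,2]),(11,445,[])]),
([0,1,2,2,12,4,17,8,129,96,288,1536],Branch 7 [(11,418,[5,10,11,8,7,9,3,0])]),
([0,1,2,2,12,4,17,8,129,96,288,1024],Branch 9 [(7,438,[0,1,3,2,4,7,6,5]),(11,447,[])]),
([0,1,2,2,12,4,17,8,1,96,288,1024],Branch 8 [(7,448,[]),(9,418,[10,8,9,0,6,5,4,1]),(11,318,[10,8,11,0])]),
([0,1,2,2,12,4,17,8,1,96,288],Branch 10 [(7,446,[]),(9,318,[9,5,10,2]),(11,449,[])]),
([0,1,2,2,12,4,17,8,1,96,32,1024],Branch 10 [(7,446,[]),(8,450,[]),(9,318,[9,5,10,2])]),
([0,1,2,2,12,4,17,8,1,96,32],Branch 10 [(7,446,[]),(8,450,[]),(9,318,[9,5,10,2]),(11,451,[])]),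
([0,1,2,2,12,4,17,8,1,96],Branch 5 [(7,427,[]),(8,438,[]),(10,452,[])]),
([0,1,2,2,12,4,17,8,1,320,416,544],Fold [9,8,10,10,5,5,11]),
([0,1,2,2,12,4,17,8,1,320,416,512],Branch 5 [(7,318,[10,5,7,2]),(11,454,[])]),
([0,1,2,2,12,4,17,8,1,320,288,512],Branch 10 [(7,455,[]),(11,418,[10,8,9,0,6,11,4,1])]),
([0,1,2,2,12,4,17,8,1,320,256,512],Branch 10 [(5,456,[]),(7,456,[0,1,3,2,4,7,6,5]),(11,418,[10,8,9,0,6,11,4,1])]),
([0,1,2,2,12,4,17,8,1,320,256],Branch 9 [(5,453,[]),(7,453,[0,1,3,2,4,7,6,5]),(10,318,[9,8,10,0]),(11,457,[])]),
([0,1,2,2,12,4,17,8,1,320],Branch 8 [(5,453,[6,4,2,3,1,5,0,7,9,8]),(7,453,[6,4,3,2,1,7,0,5,9,8]),(10,458,[])]),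
([0,1,2,2,12,17,1,32,192,192],Fold [5,4,2,3,1,0,7,6]),
([0,1,2,2,12,4,17,8,1,64,768,512],Branch 8 [(5,453,[6,4,2,3,1,5,0,7,9,8]),(7,453,[6,4,3,2,1,7,0,5,9,8]),(11,460,[0,1,2,3,4,6,8,9,10,11])]),
([0,1,2,2,12,4,17,8,1,64,512,512],Branch 8 [(5,453,[6,4,2,3,1,5,0,7,9,8]),(7,453,[6,4,3,2,1,7,0,5,9,8]),(10,461,[]),(11,461,[0,1,2,3,4,5,6,7,8,9,11,10])]),
([0,1,2,2,12,4,17,8,1,64,512],Branch 9 [(5,453,[]),(7,453,[0,1,3,2,4,7,6,5]),(8,459,[]),(11,462,[])]),
([0,1,2,2,12,4,17,8,1,64],Branch 9 [(5,453,[]),(7,453,[0,1,3,2,4,7,6,5]),(8,459,[]),(10,463,[])]),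
([0,1,2,2,12,4,17,8,1],Branch 6 [(5,418,[5,2,4,1,3,6,7,0]),(7,418,[7,3,4,1,2,6,5,0]),(8,318,[8,0,6,1]),(9,464,[])]),
([0,1,2,2,12,4,17,8],Branch 0 [(5,418,[]),(7,418,[0,1,3,2,4,7,6,5]),(8,465,[])]),
([0,1,2,2,12,4,16,8,96,129,576,1184],Fold [0,9,10,7,11,6,5,3,8,1,2,4]),
([0,1,2,2,12,4,16,8,97,129,576,1152],Branch 5 [(11,467,[])]),
([0,1,2,2,12,4,16,8,97,129,576,128],Branch 10 [(5,466,[2,5,8,10,6,0,4,9]),(11,468,[])]),
([0,1,2,2,12,4,16,8,97,129,576],Branch 7 [(5,466,[5,2,1,4,3,0,7,6]),(10,318,[9,7,10]),(11,469,[])]),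
([0,1,2,2,12,4,16,8,97,129,192,512],Branch 10 [(5,466,[2,5,8,10,6,0,4]),(11,319,[0,1,2,3,4,8,6,11,10,9,7])]),
([0,1,2,2,12,4,16,8,97,129,64,512],Branch 7 [(5,466,[5,2,1,4,3,0,7,6]),(10,471,[]),(11,318,[11,7,9])]),
([0,1,2,2,12,4,16,8,97,129,64],Branch 9 [(5,466,[1,0,8,9,5,6,2]),(10,470,[]),(11,472,[])]),
([0,1,2,2,12,4,16,8,97,1,64,128],Branch 7 [(5,466,[5,2,1,4,3,0,7,6]),(9,473,[]),(10,473,[6,4,2,3,1,5,0,7,8,10,9])]),
([0,1,2,2,12,4,16,8,97,1,64],Branch 7 [(5,466,[5,2,1,4,3,0,7,6]),(9,473,[]),(10,473,[6,4,2,3,1,5,0,7,8,10,9]),(11,474,[])]),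
([0,1,2,2,12,4,16,8,65,161,96,256],Branch 7 [(10,298,[1,9,4,10,2,3,7,5]),(11,475,[5,2,1,4,3,0,7,6,9,10,11])]),
([0,1,2,2,12,4,16,8,65,33,96,768],Branch 10 [(7,476,[6,4,2,3,1,5,0,7,8,10,9]),(11,418,[6,8,11,0,9,10,5,1])]),
([0,1,2,2,12,4,16,8,65,33,96,256],Branch 9 [(7,476,[]),(10,318,[9,5,10,2]),(11,477,[])]),
([0,1,2,2,12,4,16,8,65,416],Fold [0,8,9,9,8]),
([0,1,2,2,12,4,16,8,65,33,64,1312],Branch 10 [(7,467,[7,3,1,4,2,0,5,6,9,10,11,8]),(9,418,[6,10,11,9,5,8,2,0])]),
([0,1,2,2,12,4,16,8,65,33,64,288],Branch 11 [(7,479,[0,1,2,3,4,5,6,7,8,11]),(9,318,[9,5,11,2]),(10,480,[])]),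
([0,1,2,2,12,4,16,8,65,33,64,256],Branch 5 [(7,466,[5,2,1,4,3,0,7,6]),(10,478,[]),(11,481,[])]),
([0,1,2,2,12,4,16,8,65,1,64,288],Branch 5 [(7,466,[5,2,1,4,3,0,7,6]),(9,482,[]),(10,482,[6,4,2,3,1,5,0,7,8,10,9])]),
([0,1,2,2,12,4,16,8,65,1,64,256],Branch 5 [(7,466,[5,2,1,4,3,0,7,6]),(9,482,[]),(10,482,[6,4,2,3,1,5,0,7,8,10,9]),(11,483,[])]),
([0,1,2,2,12,4,16,8,65,1,64],Branch 8 [(5,475,[]),(7,475,[0,1,3,2,4,7,6,5]),(9,318,[8,0,9,1]),(10,318,[8,6,10,4]),(11,484,[])]),
([0,1,2,2,12,4,16,8,65,1],Branch 6 [(5,418,[5,2,4,1,3,6,7,0]),(7,418,[7,3,4,1,2,6,5,0]),(9,298,[8,2,9,3,0,6,4,1]),(10,485,[])]),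
([0,1,2,2,12,4,16,8,1,161,64,64],Branch 7 [(5,318,[9,5,7,2]),(8,486,[7,3,1,4,2,0,5,6,9,8]),(10,486,[7,3,1,4,2,0,5,6,9,10]),(11,486,[7,3,1,4,2,0,5,6,9,11])]),
([0,1,2,2,12,4,16,8,33,33,704,64],Branch 8 [(7,466,[1,0,8,9,5,7,2,10]),(11,466,[1,0,8,9,5,11,2,10])]),
([0,1,2,2,12,4,16,8,129,33,704,96],Fold [7,3,4,1,2,6,5,0,8,10,9]),
([0,1,2,2,12,4,16,8,1,33,704,96],Branch 7 [(8,489,[]),(11,466,[4,6,10,11,7,9,3,5])]),
([0,1,2,2,12,4,16,8,1,33,704,64],Branch 5 [(7,466,[5,2,1,4,3,0,7,6]),(8,488,[]),(11,490,[])]),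
([0,1,2,2,12,4,16,8,1,33,832,96],Branch 11 [(7,486,[5,2,1,4,3,0,7,6,11]),(8,418,[11,8,10,0,9,6,5,1])]),
([0,1,2,2,12,4,16,8,1,33,832,64],Branch 5 [(7,466,[5,2,1,4,3,0,7,6]),(8,21,[0,8,9,10,5]),(11,492,[])]),
([0,1,2,2,12,4,16,8,1,33,576,64],Branch 10 [(5,318,[9,5,10,2]),(7,491,[]),(8,493,[]),(11,318,[10,6,11,4])]),
([0,1,2,2,12,4,16,8,1,33,64,64],Branch 9 [(7,487,[]),(8,318,[8,0,9,1]),(10,494,[]),(11,494,[0,1,2,3,4,5,6,7,8,9,11,10])]),
([0,1,2,2,12,4,16,8,1,1,64,64],Branch 7 [(5,466,[5,2,1,4,3,0,7,6]),(8,495,[0,1,3,2,4,7,6,5,9,8]),(9,495,[0,1,3,2,4,7,6,5]),(10,495,[6,4,3,2,1,7,0,5,11,10,8,9]),(11,495,[6,4,3,2,1,7,0,5,10,11,8,9])]),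
([0,1,2,2,12,4,16,8,1,1,64],Branch 6 [(5,418,[5,2,4,1,3,6,7,0]),(7,418,[7,3,4,1,2,6,5,0]),(8,486,[]),(9,486,[0,1,2,3,4,5,6,7,9,8]),(11,496,[])]),
([0,1,2,2,12,4,16,8,1,1],Branch 6 [(5,418,[5,2,4,1,3,6,7,0]),(7,418,[7,3,4,1,2,6,5,0]),(8,486,[]),(9,486,[0,1,2,3,4,5,6,7,9,8]),(10,497,[])]),
([0,1,2,2,12,4,16,8,1],Branch 0 [(5,418,[]),(6,466,[]),(7,418,[0,1,3,2,4,7,6,5]),(9,498,[])]),
([0,1,2,2,12,4,16,8],Branch 0 [(5,418,[]),(6,466,[]),(7,418,[0,1,3,2,4,7,6,5]),(8,499,[])]),
([0,1,2,2,12,4,16],Branch 3 [(0,318,[0,1,3,2]),(5,21,[1,2,3,4,5]),(6,318,[4,3,6,1]),(7,500,[])]),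
([0,1,2,2,12,4],Branch 4 [(0,21,[0,1,4,2,3]),(5,318,[4,2,5,1]),(6,501,[])]),
([0,1,2,2,4,4,24,24,1,1],Branch 7 [(5,502,[1,2,4,5,7,6]),(6,318,[6,3,7,1]),(8,502,[1,3,7,6,4,8]),(9,502,[1,3,7,6,4,9]),(10,502,[1,3,7,6,4,10])]),
([0,1,2,2,4,4,24,17,97],Fold [4,6,8,3,0,5,1,7,2]),
([0,1,2,2,4,4,40,24,17,129,544,320],Branch 10 [(11,502,[2,5,10,6,11,9])]),
([0,1,2,2,4,4,40,24,17,129,544,256],Branch 6 [(10,318,[10,5,6,2]),(11,505,[])]),
([0,1,2,2,4,4,40,24,17,129,576,288],Branch 10 [(11,502,[2,5,11,6,10,8])]),
([0,1,2,2,4,4,40,24,17,129,512,288],Branch 6 [(10,507,[]),(11,318,[11,5,6,2])]),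
([0,1,2,2,4,4,40,24,17,129,512,256],Branch 5 [(10,506,[]),(11,508,[])]),
([0,1,2,2,4,4,8,24,17,129,512,320],Branch 11 [(5,509,[7,4,8,2,0,11,5,1,9,3,6,10]),(10,509,[1,0,8,9,4,11,10,7,2,3,6,5])]),
([0,1,2,2,4,4,8,24,17,129,512,256],Branch 6 [(5,509,[]),(10,509,[4,7,9,3,0,10,6,1,8,2,5]),(11,510,[])]),
([0,1,2,2,4,4,8,24,17,129,512],Branch 8 [(5,502,[1,2,4,5,8,7]),(6,504,[0,8,4,6,7,2,3,9,1]),(10,502,[1,0,8,9,10,4]),(11,511,[])]),
([0,1,2,2,4,4,8,24,17,129],Branch 9 [(5,504,[0,1,2,3,4,5,7,8,9]),(6,502,[1,3,7,6,9,4]),(8,318,[8,0,9,1]),(10,512,[])]),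
([0,1,2,2,4,4,8,24,17,97,160,1344],Fold [4,7,10,3,11,5,1,6,8,2,9,0]),
([0,1,2,2,4,4,8,24,17,97,160,320],Branch 10 [(11,514,[])]),
([0,1,2,2,4,4,8,24,17,97,128,320],Branch 5 [(10,515,[]),(11,502,[2,5,9,11,6,0])]),
([0,1,2,2,4,4,8,24,17,97,128,256],Branch 6 [(5,318,[9,5,6,2]),(10,502,[1,3,6,7,10,9]),(11,516,[])]),
([0,1,0,2,4,4,40,24,17,33,640,320],Fold [3,1,2,0,5,4,8,9,6,7]),
([0,1,2,2,4,4,8,24,17,33,640,1344],Branch 5 [(6,518,[])]),
([0,1,2,2,4,4,8,24,17,33,640,1280],Branch 11 [(5,502,[2,5,9,11,10,0]),(6,519,[])]),
([0,1,2,2,4,4,8,24,17,33,640,256],Branch 10 [(5,318,[9,5,10,2]),(6,502,[1,3,7,6,10,4]),(11,520,[])]),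
([0,1,2,2,4,4,8,24,17,33,128,256],Branch 9 [(6,517,[]),(10,521,[]),(11,502,[1,0,8,9,11,4])]),
([0,1,2,2,4,4,8,24,17,1,128,256],Branch 5 [(6,522,[3,1,2,0,4,5,9,8,7,6,11,10]),(9,522,[]),(10,522,[7,4,2,8,1,5,11,0,3,10,9,6]),(11,522,[8,4,2,7,1,5,10,3,0,11,6,9])]),
([0,1,2,2,4,4,8,24,17,1,128],Branch 8 [(5,502,[1,2,4,5,8,7]),(6,513,[3,1,0,2,8,9,5,4,6,7]),(9,318,[8,0,9,1]),(10,502,[2,4,8,7,10,0]),(11,523,[])]),
([0,1,2,2,4,4,8,24,17,1],Branch 7 [(5,502,[1,2,4,5,7,8]),(6,318,[6,3,7,1]),(8,318,[8,4,7,2]),(9,513,[]),(10,524,[])]),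
([0,1,2,2,4,4,8,24,1,1,80,128],Branch 10 [(5,502,[1,2,4,5,10,7]),(8,525,[2,4,7,10,3,11,8,6,1,5]),(9,525,[2,4,7,10,3,11,9,6,1,5]),(11,502,[2,4,10,7,11,6])]),
([0,1,2,2,4,4,8,24,1,1,784,128],Branch 9 [(5,502,[1,0,9,8,10]),(6,502,[1,0,9,8,10,6]),(8,318,[8,0,9,1]),(11,502,[1,0,9,8,10,11])]),
([0,1,2,2,4,4,8,24,1,1,272,128],Branch 10 [(5,502,[1,2,4,5,10,7]),(6,525,[2,4,7,10,3,11,8,6,1,5]),(9,527,[]),(11,502,[2,4,10,7,11,8])]),
([0,1,2,2,4,4,8,24,1,1,16,128],Branch 10 [(5,502,[1,2,4,5,10,7]),(6,526,[]),(8,528,[]),(9,528,[0,1,2,3,4,5,6,7,9,8]),(11,502,[2,4,7,10,11,3])]),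
([0,1,2,2,4,4,8,24,1,1,16],Branch 7 [(5,502,[1,2,4,5,7,10]),(6,318,[6,3,7,1]),(8,525,[0,1,3,2,7,6,5,4]),(9,525,[0,1,3,2,7,6,5,4,9,8]),(10,318,[10,4,7,2]),(11,529,[])]),
([0,1,2,2,4,4,8,24,1,1],Branch 4 [(5,318,[4,2,5,1]),(6,503,[]),(8,525,[]),(9,525,[0,1,2,3,4,5,6,7,9,8]),(10,530,[])]),
([0,1,2,2,4,4,8,8,1,1,128,128],Branch 6 [(4,531,[0,1,2,3,4,5,7,6]),(5,531,[0,1,2,3,5,4,7,6]),(8,531,[2,1,0,3,8,9,7,6,4,5]),(9,531,[2,1,0,3,9,8,7,6,4,5]),(10,502,[1,3,7,6,10,11]),(11,502,[1,3,7,6,11,10])]),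
([0,1,2,2,4,4,8,8,1,1,128],Branch 7 [(4,531,[]),(5,531,[0,1,2,3,5,4]),(6,318,[6,3,7,1]),(8,531,[2,1,0,3,8,9,6,7,4,5]),(9,531,[2,1,0,3,9,8,6,7,4,5]),(11,532,[])]),
([0,1,2,2,4,4,8,8,1,1],Branch 7 [(4,531,[]),(5,531,[0,1,2,3,5,4]),(6,318,[6,3,7,1]),(8,531,[2,1,0,3,8,9,6,7,4,5]),(9,531,[2,1,0,3,9,8,6,7,4,5]),(10,533,[])]),
([0,1,2,2,4,4,8,8,1],Branch 0 [(4,502,[8,0,1,4,2,3]),(5,502,[8,0,1,5,2,3]),(6,502,[8,0,1,6,3,2]),(7,502,[8,0,1,7,3,2]),(9,534,[])]),
([0,1,2,2,4,4,8,8],Branch 0 [(4,502,[3,1,2,0]),(5,502,[3,1,2,0,5,4]),(6,502,[2,1,3,0,6,7]),(7,502,[2,1,3,0,7,6]),(8,535,[])]),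
([0,1,2,2,4,4,8],Branch 3 [(0,318,[0,1,3,2]),(4,502,[]),(5,502,[0,1,2,3,5,4]),(7,536,[])]),
([0,1,2,2,4,4],Branch 3 [(0,318,[0,1,3,2]),(4,502,[]),(5,502,[0,1,2,3,5,4]),(6,537,[])]),
([0,1,2,2,4],Branch 2 [(0,318,[]),(3,318,[2,1,3,0]),(5,538,[])]),
([0,1,2,2],Branch 2 [(0,318,[]),(3,318,[2,1,3,0]),(4,539,[])]),([0,1,2],Branch 1 [(3,540,[])]),
([0,1],Branch 1 [(2,541,[])]),([0],Branch 0 [(1,542,[])])]"

definition "cubic_12_node = (!) cubic_12"

lemmas cubic_12_node_simps =
  tabulated_nth[of cubic_12, folded cubic_12_node_def, unfolded cubic_12_def, simplified tabulate_simps]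

lemma cubic_12_ok: "list_all (node_ok 3 12 False cubic_12_node) [0..<544]"
  by (simp only: node_simps cubic_12_node_simps cong: if_weak_cong)

lemma cubic_12_root: "pattern (cubic_12_node 543) = [[]]"
  by (simp only: pattern_def cubic_12_node_simps fst_conv list.map bits_numeral)
section \<open>Orders of rigid regular graphs\<close>

lemma order_ge_add_4:
  assumes "n \<in> rigid_regular_orders d" "0 < d"
  shows "d + 4 \<le> n"
proof -
  obtain V :: "nat set" and E where G: "ugraph V E" "V \<noteq> {}" "card V = n" "regular_on V E d" "rigid_on V E"
    using ordersE[OF assms(1)] .
  interpret ugraph V E by (rule G(1))
  have "d < n" using degree_less_card[OF G(4)] G(2,3) by blast
  \<comment> \<open>From \<open>0 < d < n\<close> there are at least two vertices, as the degree
    bound for the asymmetric complement requires.\<close>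
  moreover have "2 < n - 1 - d"
    using ugraph.asymmetric_imp_degree_gt_2[OF ugraph_compl regular_compl[OF G(4)]]
      rigid_imp_asymmetric[OF G(5)] asymmetric_compl G(3) \<open>d < n\<close> assms(2) by simp
  ultimately show ?thesis by simp
qed

lemma order_parity: "n \<in> rigid_regular_orders d \<Longrightarrow> even (n * d)"
  by (metis ordersE even_card_mult_degree)

text \<open>Nonemptiness is part of the conclusion because \<open>LEAST\<close> carries no
  information about an empty set.\<close>

lemma nu_eqI:
  assumes "m \<in> rigid_regular_orders d" "\<And>n. n \<in> rigid_regular_orders d \<Longrightarrow> m \<le> n"
  shows "rigid_regular_orders d \<noteq> {} \<and> nu d = m"
  using assms by (auto simp: nu_def intro!: Least_equality)

lemma ceiling_half:
  "even d \<Longrightarrow> 2 * nat \<lceil>real d / 2\<rceil> = d"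
  "odd d \<Longrightarrow> 2 * nat \<lceil>real d / 2\<rceil> = d + 1"
proof -
  show "2 * nat \<lceil>real d / 2\<rceil> = d" if "even d" using that by (auto elim!: evenE)
  show "2 * nat \<lceil>real d / 2\<rceil> = d + 1" if "odd d"
  proof -
    from that obtain j where j: "d = 2 * j + 1" by (elim oddE)
    have "\<lceil>real d / 2\<rceil> = int j + 1" by (rule ceiling_unique) (simp_all add: j)
    then show ?thesis by (simp add: j nat_add_distrib)
  qed
qed

section \<open>Lower bounds from certificates and parity\<close>

lemma order_3_ge: "n \<in> rigid_regular_orders 3 \<Longrightarrow> 14 \<le> n"
proof -
  assume n: "n \<in> rigid_regular_orders 3"
  obtain V :: "nat set" and E where G: "ugraph V E" "V \<noteq> {}" "card V = n" "regular_on V E 3" "rigid_on V E"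
    using ordersE[OF n] .
  have "12 < n"
    using ugraph.certificate_imp_card_greater[where i = 543, OF G(1,4,2) _ cubic_12_ok] cubic_12_root G(3,5) by simp
  moreover have "n \<noteq> 13" using order_parity[OF n] by auto
  ultimately show ?thesis by simp
qed

lemma order_4_ge: "n \<in> rigid_regular_orders 4 \<Longrightarrow> 10 \<le> n"
proof -
  assume n: "n \<in> rigid_regular_orders 4"
  obtain V :: "nat set" and E where G: "ugraph V E" "V \<noteq> {}" "card V = n" "regular_on V E 4" "rigid_on V E"
    using ordersE[OF n] .
  have "9 < n"
    using ugraph.certificate_imp_card_greater[where i = 214, OF G(1,4,2) _ quartic_9_ok] quartic_9_root G(3,5) by simp
  then show ?thesis by simp
qed

lemma order_6_ge: "n \<in> rigid_regular_orders 6 \<Longrightarrow> 11 \<le> n"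
proof -
  assume n: "n \<in> rigid_regular_orders 6"
  obtain V :: "nat set" and E where G: "ugraph V E" "V \<noteq> {}" "card V = n" "regular_on V E 6" "rigid_on V E"
    using ordersE[OF n] .
  interpret ugraph V E by (rule G(1))
  have "n \<noteq> 10"
  proof
    assume "n = 10"
    then have "regular_on V (compl_on V E) 3" using regular_compl[OF G(4)] G(3) by simp
    moreover have "asymmetric_on V (compl_on V E)" using asymmetric_compl rigid_imp_asymmetric[OF G(5)] by simp
    ultimately have "10 < card V"
      using ugraph.certificate_imp_card_greater[where i = 126, OF ugraph_compl _ G(2) _ cubic_10_ok] cubic_10_root by simp
    with \<open>n = 10\<close> G(3) show False by simp
  qed
  with order_ge_add_4[OF n] show ?thesis by simp
qed

lemma order_odd_ge:
  assumes "n \<in> rigid_regular_orders d" "odd d"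
  shows "d + 5 \<le> n"
proof -
  have "n \<noteq> d + 4" using order_parity[OF assms(1)] assms(2) by auto
  moreover have "0 < d" using assms(2) by (rule odd_pos)
  ultimately show ?thesis using order_ge_add_4[OF assms(1)] by simp
qed

theorem theorem1p1:
  fixes d :: nat
  assumes "d \<ge> 3"
  shows "rigid_regular_orders d \<noteq> {} \<and>
    nu d = (if d = 3 then 14
            else if d = 4 \<or> d = 5 then 10
            else if d = 6 then 11
            else 2 * nat \<lceil>real d / 2\<rceil> + 4)"
proof -
  consider "d = 3" | "d = 4" | "d = 5" | "d = 6" | "d > 6" "even d" | "d > 6" "odd d"
    using assms by linarith
  then show ?thesis
  proof cases
    case 1
    then show ?thesis using nu_eqI[OF order_cubic14 order_3_ge] by simp
  next
    case 2
    then show ?thesis using nu_eqI[OF order_quartic10 order_4_ge] by simp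
  next
    case 3
    have "10 \<le> n" if "n \<in> rigid_regular_orders 5" for n using order_odd_ge[OF that] by simp
    with 3 show ?thesis using nu_eqI[OF order_quintic10] by simp
  next
    case 4
    then show ?thesis using nu_eqI[OF order_sextic11 order_6_ge] by simp
  next
    case 5
    \<comment> \<open>The even degree 8 lies outside the range of
      \<open>order_even_degree\<close>.\<close>
    then have "d = 8 \<or> 10 \<le> d" by presburger
    then have mem: "d + 4 \<in> rigid_regular_orders d"
      using order_octic12 order_even_degree[OF 5(2)] by (elim disjE) simp_all
    have le: "d + 4 \<le> n" if "n \<in> rigid_regular_orders d" for n
      using order_ge_add_4[OF that] 5(1) by simp
    from nu_eqI[OF mem le] show ?thesis using 5 by (simp add: ceiling_half)
  next
    case 6
    \<comment> \<open>The odd degree 7 lies outside the range of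
      \<open>order_odd_degree\<close>.\<close>
    then have "d = 7 \<or> 9 \<le> d" by presburger
    then have mem: "d + 5 \<in> rigid_regular_orders d"
      using order_septic12 order_odd_degree[OF 6(2)] by (elim disjE) simp_all
    from nu_eqI[OF mem order_odd_ge[OF _ 6(2)]] show ?thesis using 6 by (simp add: ceiling_half)
  qed
qed

end
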